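(* Let $S$ be a spray on a manifold $M$ of dimension $n\ge2$, let $I$ be an open interval containing $0$, let $c\colon I\to M$ be a geodesic of $S$, let $V\colon I\times(-\varepsilon,\varepsilon)^{n-1}\to M$ be an $(n-1)$-parameter geodesic variation of $c$, and let $(t,s^1,\ldots,s^{n-1})$ be the coordinates of the domain of $V$. Let $W$ be an $(n-1)$-dimensional subspace of $T_{c(0)}M$ with $c'(0)\notin W$, let $e_1(t),\ldots,e_{n-1}(t)$ be the parallel vector fields along $c$ extending a basis of $W$, let $W_t=\operatorname{span}\{e_1(t),\ldots,e_{n-1}(t)\}$, and let $J$ be the $(1,1)$-tensor along $c$ defined by $$J\circ c'(t)=0,\qquad J\circ e_a(t)=(\partial_{s^a}V)(t,0,\ldots,0),\quad a\in\{1,\ldots,n-1\},\ t\in I.$$ Suppose furthermore that (1) for some open interval $I_0\subset I$, the restriction $V\colon I_0\times(-\varepsilon,\varepsilon)^{n-1}\to M$ is a diffeomorphism onto its range; (2) on $I_0$, $J$ is transversal with respect to $W_t$. Then $J$ is invertible on $I_0$, and on $I_0$ we have $$A_Z=\nabla J\circ J^{-1},\qquad \frac{d}{dt}(\det J)=\operatorname{trace}A_Z\cdot\det J,$$ where $A_Z$ is the $(1,1)$-tensor along $c$ associated to the vector field $Z=\partial_tV$ (restricted to $c$), and $\det J$ is the determinant of the transverse part $J|_{W_t}\colon W_t\to W_t$ of $J$. In particular, $A_Z$ is transversal (with respect to $W_t$) on $I_0$.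
   Context: $M$ is a smooth manifold (Hausdorff, countable base, without boundary); all objects are $C^\infty$-smooth. $TM\setminus\{0\}$ is the set of nonzero tangent vectors. A semispray on $M$ is a vector field $S$ on $TM\setminus\{0\}$ with $D\pi\circ S=\mathrm{id}$, where $\pi\colon TM\to M$ is the projection; locally $S=y^i\frac{\partial}{\partial x^i}-2G^i(x,y)\frac{\partial}{\partial y^i}$ in induced coordinates $(x^i,y^i)$ of $TM$. $S$ is a spray if moreover $[\mathbb{C},S]=S$, where $\mathbb{C}=y^i\frac{\partial}{\partial y^i}$ is the Liouville vector field (so each $G^i$ is positively $2$-homogeneous in $y$). A curve $c\colon I\to M$ with $c'(t)\ne0$ for all $t$ is a geodesic of $S$ if $c''=S\circ c'$, i.e. locally $\ddot x^i+2G^i(c')=0$. A $k$-parameter geodesic variation of a geodesic $c\colon I\to M$ is a map $V\colon I\times(-\varepsilon,\varepsilon)^k\to M$ with $V(t,0,\ldots,0)=c(t)$ for all $t\in I$ and such that $t\mapsto V(t,s^1,\ldots,s^k)$ is a geodesic for all $(s^1,\ldots,s^k)$. Put $N^i_j=\partial G^i/\partial y^j$. Along a geodesic $c$ the dynamical covariant derivative $\nabla$ is defined by: $\nabla X=\left(\frac{dX^i}{dt}+N^i_j(c')X^j\right)\frac{\partial}{\partial x^i}$ for a vector field $X=X^i(t)\frac{\partial}{\partial x^i}|_{c(t)}$ along $c$; $\nabla\alpha=\left(\frac{d\alpha_i}{dt}-N^j_i(c')\alpha_j\right)dx^i$ for a $(0,1)$-tensor $\alpha$ along $c$; $\nabla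 f=df/dt$ for functions; and it extends to all tensors along $c$ by the Leibniz rule, so that for a $(1,1)$-tensor $J$ along $c$, $\nabla(J\circ v)=(\nabla J)\circ v+J\circ\nabla v$. A tensor $T$ along $c$ is parallel if $\nabla T=0$. Given an $(n-1)$-dimensional subspace $W\subset T_{c(0)}M$ with $c'(0)\notin W$, a basis of $W$ extends uniquely to parallel vector fields $e_1(t),\ldots,e_{n-1}(t)$ along $c$; $W_t=\operatorname{span}\{e_1(t),\ldots,e_{n-1}(t)\}$ is independent of the basis and $T_{c(t)}M=\operatorname{span}\{c'(t)\}\oplus W_t$. A $(1,1)$-tensor $J$ along $c$ is transversal with respect to $W_t$ (on $I_0$) if $J\circ c'(t)=0$ and $\operatorname{Im}J(t)\subset W_t$ for all $t$ (in $I_0$). A transversal $J$ is invertible (on $I_0$) if $J|_{W_t}\colon W_t\to W_t$ is an invertible linear map for each $t$ (in $I_0$); then $J^{-1}$ denotes the transversal $(1,1)$-tensor determined by $(J^{-1})|_{W_t}=(J|_{W_t})^{-1}$ (and $J^{-1}\circ c'=0$). The connection map is $K\colon T(TM\setminus\{0\})\to TM$, $K(x,y,X,Y)=(x^i,Y^i+N^i_j(x,y)X^j)$ in induced coordinates. For a nowhere zero vector field $Z$ on an open set $U\subset M$, $A_Z$ is the $(1,1)$-tensor on $U$ defined by $A_Z=K\circ DZ$, where $DZ$ is the tangent map of $Z\colon U\to TM\setminus\{0\}$; locally, $A_Z=\left(\frac{\partial Z^i}{\partial x^j}+N^i_j(Z)\right)\frac{\partial}{\partial x^i}\otimes dx^j$.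 Here $Z=\partial_tV$ is the vector field on $U=V(I_0\times(-\varepsilon,\varepsilon)^{n-1})$ given by $Z(V(t,s))=\partial_tV(t,s)$. *)

theory Defs
  imports "HOL-Analysis.Analysis" "HOL-Library.Function_Algebras"
begin

section \<open>Functions into a real vector space form a real vector space\<close>

instantiation "fun" :: (type, scaleR) scaleR
begin

definition "scaleR r f = (\<lambda>x. r *\<^sub>R f x)"

instance ..

end

lemma scaleR_fun_apply [simp]: "(r *\<^sub>R f) x = r *\<^sub>R f x"
  by (simp add: scaleR_fun_def)

instance "fun" :: (type, real_vector) real_vector
  by standard (simp_all add: fun_eq_iff algebra_simps)

section \<open>Bases, matrices, determinant and trace of endomorphisms\<close>

definition basis_of :: "('k \<Rightarrow> 'v::real_vector) \<Rightarrow> 'v set \<Rightarrow> bool" where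
  "basis_of b W \<longleftrightarrow> inj b \<and> independent (range b) \<and> span (range b) = W"

definition matrix_wrt :: "('k::finite \<Rightarrow> 'v::real_vector) \<Rightarrow> ('v \<Rightarrow> 'v) \<Rightarrow> real^'k^'k" where
  "matrix_wrt b f = (\<chi> i j. representation (range b) (f (b j)) (b i))"

(* Determinant and trace of an endomorphism f of the space W, where dim W = CARD('k).  They do not
   depend on the basis chosen. *)
definition endo_det :: "'k::finite itself \<Rightarrow> 'v::real_vector set \<Rightarrow> ('v \<Rightarrow> 'v) \<Rightarrow> real" where
  "endo_det _ W f = det (matrix_wrt (SOME b :: 'k \<Rightarrow> 'v. basis_of b W) f)"

definition endo_trace :: "'k::finite itself \<Rightarrow> 'v::real_vector set \<Rightarrow> ('v \<Rightarrow> 'v) \<Rightarrow> real" where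
  "endo_trace _ W f = trace (matrix_wrt (SOME b :: 'k \<Rightarrow> 'v. basis_of b W) f)"

definition linear_endo_on :: "'v::real_vector set \<Rightarrow> ('v \<Rightarrow> 'v) \<Rightarrow> bool" where
  "linear_endo_on T f \<longleftrightarrow> f ` T \<subseteq> T \<and> (\<forall>v\<in>T. \<forall>w\<in>T. f (v + w) = f v + f w)
     \<and> (\<forall>r. \<forall>v\<in>T. f (r *\<^sub>R v) = r *\<^sub>R f v)"

section \<open>Smooth functions on open sets of normed spaces\<close>

primrec Ck_on ::
  "nat \<Rightarrow> 'a::real_normed_vector set \<Rightarrow> ('a \<Rightarrow> 'b::real_normed_vector) \<Rightarrow> bool" where
  "Ck_on 0 D f \<longleftrightarrow> continuous_on D f"
| "Ck_on (Suc k) D f \<longleftrightarrow> (\<forall>x\<in>D. f differentiable (at x))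
     \<and> (\<forall>v. Ck_on k D (\<lambda>x. frechet_derivative f (at x) v))"

(* Only used for open D. *)
definition smooth_on ::
  "'a::real_normed_vector set \<Rightarrow> ('a \<Rightarrow> 'b::real_normed_vector) \<Rightarrow> bool" where
  "smooth_on D f \<longleftrightarrow> (\<forall>k. Ck_on k D f)"

section \<open>Manifolds, tangent vectors and smooth maps\<close>

(* A chart is a pair of a domain and a coordinate map; the values of the map outside the domain
   are irrelevant. *)
type_synonym ('p, 'e) chart = "'p set \<times> ('p \<Rightarrow> 'e)"

definition chart_inv :: "('p, 'e) chart \<Rightarrow> 'e \<Rightarrow> 'p" where
  "chart_inv \<phi> = inv_into (fst \<phi>) (snd \<phi>)"

definition smooth_manifold ::
  "('m::{t2_space, second_countable_topology}, 'e::euclidean_space) chart set \<Rightarrow> bool" where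
  "smooth_manifold A \<longleftrightarrow> (\<Union>\<phi>\<in>A. fst \<phi>) = UNIV
     \<and> (\<forall>\<phi>\<in>A. open (fst \<phi>) \<and> open (snd \<phi> ` fst \<phi>)
          \<and> homeomorphism (fst \<phi>) (snd \<phi> ` fst \<phi>) (snd \<phi>) (chart_inv \<phi>))
     \<and> (\<forall>\<phi>\<in>A. \<forall>\<psi>\<in>A. smooth_on (snd \<phi> ` (fst \<phi> \<inter> fst \<psi>)) (snd \<psi> \<circ> chart_inv \<phi>))"

definition carrier :: "('p, 'e) chart set \<Rightarrow> 'p set" where
  "carrier A = (\<Union>\<phi>\<in>A. fst \<phi>)"

definition charts_at :: "('p, 'e) chart set \<Rightarrow> 'p \<Rightarrow> ('p, 'e) chart set" where
  "charts_at A p = {\<phi> \<in> A. p \<in> fst \<phi>}"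

(* A tangent vector at p is the family of its components in all charts at p, related by the
   derivatives of the transition maps (and 0 at all other charts).  The vector space operations are
   the pointwise ones.  An element of the tangent bundle is a pair of a base point and a tangent
   vector. *)
type_synonym ('p, 'e) tvec = "('p, 'e) chart \<Rightarrow> 'e"
type_synonym ('p, 'e) tbundle = "'p \<times> ('p, 'e) tvec"

definition tangent_space ::
  "('p, 'e::euclidean_space) chart set \<Rightarrow> 'p \<Rightarrow> ('p, 'e) tvec set" where
  "tangent_space A p = {v.
     (\<forall>\<phi>\<in>charts_at A p. \<forall>\<psi>\<in>charts_at A p.
        v \<psi> = frechet_derivative (snd \<psi> \<circ> chart_inv \<phi>) (at (snd \<phi> p)) (v \<phi>))
     \<and> (\<forall>\<psi>. \<psi> \<notin> charts_at A p \<longrightarrow> v \<psi> = 0)}"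

(* The tangent vector at p with components y in the chart \<phi>, that is, y^i d/dx^i. *)
definition coord_vec ::
  "('p, 'e::euclidean_space) chart set \<Rightarrow> ('p, 'e) chart \<Rightarrow> 'p \<Rightarrow> 'e \<Rightarrow> ('p, 'e) tvec" where
  "coord_vec A \<phi> p y = (\<lambda>\<psi>. if \<psi> \<in> charts_at A p
     then frechet_derivative (snd \<psi> \<circ> chart_inv \<phi>) (at (snd \<phi> p)) y else 0)"

(* Openness of the domains of the coordinate expressions makes D open in the source manifold and f
   continuous on D. *)
definition smooth_map_on :: "('p, 'e::euclidean_space) chart set
    \<Rightarrow> ('q, 'f::euclidean_space) chart set \<Rightarrow> 'p set \<Rightarrow> ('p \<Rightarrow> 'q) \<Rightarrow> bool" where
  "smooth_map_on A B D f \<longleftrightarrow> D \<subseteq> carrier A \<and> f ` D \<subseteq> carrier B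
     \<and> (\<forall>\<phi>\<in>A. \<forall>\<psi>\<in>B. open (snd \<phi> ` (fst \<phi> \<inter> D \<inter> f -` fst \<psi>))
          \<and> smooth_on (snd \<phi> ` (fst \<phi> \<inter> D \<inter> f -` fst \<psi>)) (snd \<psi> \<circ> f \<circ> chart_inv \<phi>))"

(* In particular the range f ` D is open in the target manifold. *)
definition diffeo_onto_range :: "('p, 'e::euclidean_space) chart set
    \<Rightarrow> ('q, 'f::euclidean_space) chart set \<Rightarrow> 'p set \<Rightarrow> ('p \<Rightarrow> 'q) \<Rightarrow> bool" where
  "diffeo_onto_range A B D f \<longleftrightarrow>
     inj_on f D \<and> smooth_map_on A B D f \<and> smooth_map_on B A (f ` D) (inv_into D f)"

definition euclidean_atlas :: "('e, 'e) chart set" where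
  "euclidean_atlas = {(UNIV, \<lambda>x. x)}"

definition tangent_map :: "('p, 'e::euclidean_space) chart set
    \<Rightarrow> ('q, 'f::euclidean_space) chart set \<Rightarrow> ('p \<Rightarrow> 'q) \<Rightarrow> ('p, 'e) tbundle \<Rightarrow> ('q, 'f) tbundle" where
  "tangent_map A B f \<xi> = (case \<xi> of (p, v) \<Rightarrow>
     let \<phi> = (SOME \<phi>. \<phi> \<in> charts_at A p) in
     (f p, \<lambda>\<psi>. if \<psi> \<in> charts_at B (f p)
        then frechet_derivative (snd \<psi> \<circ> f \<circ> chart_inv \<phi>) (at (snd \<phi> p)) (v \<phi>) else 0))"

(* The curve c' in the tangent bundle. *)
definition velocity ::
  "('p, 'e::euclidean_space) chart set \<Rightarrow> (real \<Rightarrow> 'p) \<Rightarrow> real \<Rightarrow> ('p, 'e) tbundle" where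
  "velocity A c t = (c t, \<lambda>\<psi>. if \<psi> \<in> charts_at A (c t)
     then vector_derivative (snd \<psi> \<circ> c) (at t) else 0)"

definition vector_field ::
  "('p, 'e::euclidean_space) chart set \<Rightarrow> ('p \<Rightarrow> ('p, 'e) tbundle) \<Rightarrow> bool" where
  "vector_field A X \<longleftrightarrow>
     (\<forall>p\<in>carrier A. fst (X p) = p \<and> snd (X p) \<in> tangent_space A p)
     \<and> (\<forall>\<phi>\<in>A. smooth_on (snd \<phi> ` fst \<phi>) (\<lambda>x. snd (X (chart_inv \<phi> x)) \<phi>))"

definition lie_bracket :: "('p, 'e::euclidean_space) chart set
    \<Rightarrow> ('p \<Rightarrow> ('p, 'e) tbundle) \<Rightarrow> ('p \<Rightarrow> ('p, 'e) tbundle) \<Rightarrow> 'p \<Rightarrow> ('p, 'e) tbundle" where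
  "lie_bracket A X Y p = (p, \<lambda>\<phi>. if \<phi> \<in> charts_at A p
     then frechet_derivative (\<lambda>x. snd (Y (chart_inv \<phi> x)) \<phi>) (at (snd \<phi> p)) (snd (X p) \<phi>)
        - frechet_derivative (\<lambda>x. snd (X (chart_inv \<phi> x)) \<phi>) (at (snd \<phi> p)) (snd (Y p) \<phi>)
     else 0)"

section \<open>The slit tangent bundle and sprays\<close>

(* The induced coordinates (x, y) on the bundle of nonzero tangent vectors. *)
definition slit_chart :: "('p, 'e::euclidean_space) chart set \<Rightarrow> ('p, 'e) chart
    \<Rightarrow> (('p, 'e) tbundle, 'e \<times> 'e) chart" where
  "slit_chart A \<phi> = ({(p, v). p \<in> fst \<phi> \<and> v \<in> tangent_space A p \<and> v \<noteq> 0},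
                     \<lambda>(p, v). (snd \<phi> p, v \<phi>))"

definition slit_atlas :: "('p, 'e::euclidean_space) chart set
    \<Rightarrow> (('p, 'e) tbundle, 'e \<times> 'e) chart set" where
  "slit_atlas A = slit_chart A ` A"

type_synonym ('p, 'e) tslit_field =
  "('p, 'e) tbundle \<Rightarrow> (('p, 'e) tbundle, 'e \<times> 'e) tbundle"

(* y^i d/dy^i: the components in induced coordinates (x, y) are (0, y). *)
definition liouville :: "('p, 'e::euclidean_space) chart set \<Rightarrow> ('p, 'e) tslit_field" where
  "liouville A u = (u, \<lambda>\<Psi>. if \<Psi> \<in> charts_at (slit_atlas A) u then (0, snd (snd \<Psi> u)) else 0)"

definition semispray ::
  "('p, 'e::euclidean_space) chart set \<Rightarrow> ('p, 'e) tslit_field \<Rightarrow> bool" where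
  "semispray A S \<longleftrightarrow> vector_field (slit_atlas A) S
     \<and> (\<forall>u\<in>carrier (slit_atlas A). tangent_map (slit_atlas A) A fst (S u) = u)"

definition spray ::
  "('p, 'e::euclidean_space) chart set \<Rightarrow> ('p, 'e) tslit_field \<Rightarrow> bool" where
  "spray A S \<longleftrightarrow> semispray A S
     \<and> (\<forall>u\<in>carrier (slit_atlas A). lie_bracket (slit_atlas A) (liouville A) S u = S u)"

(* The functions G^i with S = y^i d/dx^i - 2 G^i d/dy^i in the coordinates induced by \<phi>. *)
definition spray_coeff :: "('p, 'e::euclidean_space) chart set \<Rightarrow> ('p, 'e) tslit_field
    \<Rightarrow> ('p, 'e) chart \<Rightarrow> 'e \<times> 'e \<Rightarrow> 'e" where
  "spray_coeff A S \<phi> z =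
     - (1/2) *\<^sub>R snd (snd (S (chart_inv (slit_chart A \<phi>) z)) (slit_chart A \<phi>))"

(* nonlin_conn A S \<phi> u X is N^i_j(u) X^j with N^i_j = dG^i/dy^j. *)
definition nonlin_conn :: "('p, 'e::euclidean_space) chart set \<Rightarrow> ('p, 'e) tslit_field
    \<Rightarrow> ('p, 'e) chart \<Rightarrow> ('p, 'e) tbundle \<Rightarrow> 'e \<Rightarrow> 'e" where
  "nonlin_conn A S \<phi> u = (case u of (p, v) \<Rightarrow>
     frechet_derivative (\<lambda>y. spray_coeff A S \<phi> (snd \<phi> p, y)) (at (v \<phi>)))"

definition geodesic :: "('p, 'e::euclidean_space) chart set \<Rightarrow> ('p, 'e) tslit_field
    \<Rightarrow> real set \<Rightarrow> (real \<Rightarrow> 'p) \<Rightarrow> bool" where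
  "geodesic A S I c \<longleftrightarrow> smooth_map_on euclidean_atlas A I c
     \<and> (\<forall>t\<in>I. snd (velocity A c t) \<noteq> 0)
     \<and> (\<forall>t\<in>I. velocity (slit_atlas A) (velocity A c) t = S (velocity A c t))"

definition cube :: "real \<Rightarrow> (real^'k) set" where
  "cube \<epsilon> = {s. \<forall>a. - \<epsilon> < s $ a \<and> s $ a < \<epsilon>}"

definition geodesic_variation :: "('p, 'e::euclidean_space) chart set \<Rightarrow> ('p, 'e) tslit_field
    \<Rightarrow> real set \<Rightarrow> real \<Rightarrow> (real \<Rightarrow> 'p) \<Rightarrow> (real \<times> (real^'k) \<Rightarrow> 'p) \<Rightarrow> bool" where
  "geodesic_variation A S I \<epsilon> c V \<longleftrightarrow> \<epsilon> > 0
     \<and> smooth_map_on euclidean_atlas A (I \<times> cube \<epsilon>) V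
     \<and> (\<forall>t\<in>I. V (t, 0) = c t)
     \<and> (\<forall>s\<in>cube \<epsilon>. geodesic A S I (\<lambda>t. V (t, s)))"

section \<open>Tensors along a curve and the dynamical covariant derivative\<close>

definition field_along :: "('p, 'e::euclidean_space) chart set \<Rightarrow> (real \<Rightarrow> 'p) \<Rightarrow> real set
    \<Rightarrow> (real \<Rightarrow> ('p, 'e) tvec) \<Rightarrow> bool" where
  "field_along A c I X \<longleftrightarrow> (\<forall>t\<in>I. X t \<in> tangent_space A (c t))
     \<and> (\<forall>\<phi>\<in>A. smooth_on (I \<inter> c -` fst \<phi>) (\<lambda>t. X t \<phi>))"

(* (1,1)-tensors along c; J t matters only on the tangent space at c t. *)
definition tensor11_along :: "('p, 'e::euclidean_space) chart set \<Rightarrow> (real \<Rightarrow> 'p) \<Rightarrow> real set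
    \<Rightarrow> (real \<Rightarrow> ('p, 'e) tvec \<Rightarrow> ('p, 'e) tvec) \<Rightarrow> bool" where
  "tensor11_along A c I J \<longleftrightarrow> (\<forall>t\<in>I. linear_endo_on (tangent_space A (c t)) (J t))
     \<and> (\<forall>\<phi>\<in>A. \<forall>y. smooth_on (I \<inter> c -` fst \<phi>) (\<lambda>t. J t (coord_vec A \<phi> (c t) y) \<phi>))"

(* dX^i/dt + N^i_j(c') X^j *)
definition nabla_vec :: "('p, 'e::euclidean_space) chart set \<Rightarrow> ('p, 'e) tslit_field
    \<Rightarrow> (real \<Rightarrow> 'p) \<Rightarrow> (real \<Rightarrow> ('p, 'e) tvec) \<Rightarrow> real \<Rightarrow> ('p, 'e) tvec" where
  "nabla_vec A S c X t = (\<lambda>\<phi>. if \<phi> \<in> charts_at A (c t)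
     then vector_derivative (\<lambda>\<tau>. X \<tau> \<phi>) (at t) + nonlin_conn A S \<phi> (velocity A c t) (X t \<phi>)
     else 0)"

(* (dJ^i_j/dt + N^i_k J^k_j - J^i_k N^k_j) v^j with N taken at c'.  This is the Leibniz rule
   applied to J^i_j d/dx^i (x) dx^j, given nabla (d/dx^j) = N^i_j d/dx^i and
   nabla (dx^j) = - N^j_i dx^i. *)
definition nabla_tensor11 :: "('p, 'e::euclidean_space) chart set \<Rightarrow> ('p, 'e) tslit_field
    \<Rightarrow> (real \<Rightarrow> 'p) \<Rightarrow> (real \<Rightarrow> ('p, 'e) tvec \<Rightarrow> ('p, 'e) tvec)
    \<Rightarrow> real \<Rightarrow> ('p, 'e) tvec \<Rightarrow> ('p, 'e) tvec" where
  "nabla_tensor11 A S c J t v = (\<lambda>\<phi>. if \<phi> \<in> charts_at A (c t)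
     then let N = nonlin_conn A S \<phi> (velocity A c t);
              J\<phi> = (\<lambda>\<tau> y. J \<tau> (coord_vec A \<phi> (c \<tau>) y) \<phi>)
          in vector_derivative (\<lambda>\<tau>. J\<phi> \<tau> (v \<phi>)) (at t) + N (J\<phi> t (v \<phi>)) - J\<phi> t (N (v \<phi>))
     else 0)"

definition parallel_along :: "('p, 'e::euclidean_space) chart set \<Rightarrow> ('p, 'e) tslit_field
    \<Rightarrow> (real \<Rightarrow> 'p) \<Rightarrow> real set \<Rightarrow> (real \<Rightarrow> ('p, 'e) tvec) \<Rightarrow> bool" where
  "parallel_along A S c I X \<longleftrightarrow> field_along A c I X \<and> (\<forall>t\<in>I. nabla_vec A S c X t = 0)"

definition transversal :: "('p, 'e::euclidean_space) chart set \<Rightarrow> (real \<Rightarrow> 'p) \<Rightarrow> real set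
    \<Rightarrow> (real \<Rightarrow> ('p, 'e) tvec set) \<Rightarrow> (real \<Rightarrow> ('p, 'e) tvec \<Rightarrow> ('p, 'e) tvec) \<Rightarrow> bool" where
  "transversal A c I W J \<longleftrightarrow> tensor11_along A c I J
     \<and> (\<forall>t\<in>I. J t (snd (velocity A c t)) = 0 \<and> J t ` tangent_space A (c t) \<subseteq> W t)"

definition transversal_invertible :: "('p, 'e::euclidean_space) chart set \<Rightarrow> (real \<Rightarrow> 'p)
    \<Rightarrow> real set \<Rightarrow> (real \<Rightarrow> ('p, 'e) tvec set) \<Rightarrow> (real \<Rightarrow> ('p, 'e) tvec \<Rightarrow> ('p, 'e) tvec)
    \<Rightarrow> bool" where
  "transversal_invertible A c I W J \<longleftrightarrow>
     transversal A c I W J \<and> (\<forall>t\<in>I. bij_betw (J t) (W t) (W t))"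

(* The inverse of J on W t, precomposed with the projection onto W t along c'. *)
definition transversal_inv :: "('p, 'e::euclidean_space) chart set \<Rightarrow> (real \<Rightarrow> 'p)
    \<Rightarrow> (real \<Rightarrow> ('p, 'e) tvec set) \<Rightarrow> (real \<Rightarrow> ('p, 'e) tvec \<Rightarrow> ('p, 'e) tvec)
    \<Rightarrow> real \<Rightarrow> ('p, 'e) tvec \<Rightarrow> ('p, 'e) tvec" where
  "transversal_inv A c W J t v =
     inv_into (W t) (J t) (THE w. w \<in> W t \<and> (\<exists>r. v = r *\<^sub>R snd (velocity A c t) + w))"

section \<open>The connection map and the tensor of a nowhere zero vector field\<close>

(* (x, y, X, Y) is sent to (x, Y + N(x, y) X). *)
definition connection_map :: "('p, 'e::euclidean_space) chart set \<Rightarrow> ('p, 'e) tslit_field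
    \<Rightarrow> (('p, 'e) tbundle, 'e \<times> 'e) tbundle \<Rightarrow> ('p, 'e) tbundle" where
  "connection_map A S \<zeta> = (case \<zeta> of (u, \<xi>) \<Rightarrow> (fst u, \<lambda>\<phi>. if \<phi> \<in> charts_at A (fst u)
     then snd (\<xi> (slit_chart A \<phi>)) + nonlin_conn A S \<phi> u (fst (\<xi> (slit_chart A \<phi>))) else 0))"

(* A_Z at p; it depends only on Z in a neighbourhood of p. *)
definition assoc_tensor :: "('p, 'e::euclidean_space) chart set \<Rightarrow> ('p, 'e) tslit_field
    \<Rightarrow> ('p \<Rightarrow> ('p, 'e) tbundle) \<Rightarrow> 'p \<Rightarrow> ('p, 'e) tvec \<Rightarrow> ('p, 'e) tvec" where
  "assoc_tensor A S Z p v = snd (connection_map A S (tangent_map A (slit_atlas A) Z (p, v)))"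

(* The vector field Z with Z (V (t, s)) = dV/dt (t, s) on the range of V on D, for V injective on D. *)
definition variation_field :: "('p, 'e::euclidean_space) chart set \<Rightarrow> (real \<times> (real^'k) \<Rightarrow> 'p)
    \<Rightarrow> (real \<times> (real^'k)) set \<Rightarrow> 'p \<Rightarrow> ('p, 'e) tbundle" where
  "variation_field A V D p =
     (case inv_into D V p of (t, s) \<Rightarrow> velocity A (\<lambda>\<tau>. V (\<tau>, s)) t)"

end

theory Submission
  imports Defs
begin

text \<open>
  The idea is to evaluate \<open>A\<^sub>Z\<close> on the vectors \<open>c'\<close> and \<open>\<partial>\<^sub>a V = \<partial>V/\<partial>s\<^sup>a\<close> along \<open>c\<close>. Since
  \<open>Z \<circ> V = \<partial>\<^sub>t V\<close>, the derivative of \<open>Z\<close> along an image of the tangent map of \<open>V\<close> is a second derivative of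
  \<open>V\<close>. Along \<open>c'\<close> this gives \<open>A\<^sub>Z c' = c'' + N(c') c' = - 2 G + 2 G = 0\<close>, by the geodesic equation and
  Euler's identity for the \<open>2\<close>-homogeneous coefficients of the spray (\<open>spray_coeff_euler\<close>,
  \<open>assoc_tensor_velocity\<close>). Along \<open>\<partial>\<^sub>a V\<close> the second derivatives commute, so
  \<open>A\<^sub>Z (\<partial>\<^sub>a V) = \<partial>\<^sub>t \<partial>\<^sub>a V + N(c') \<partial>\<^sub>a V = \<nabla>(\<partial>\<^sub>a V)\<close> (\<open>symmetric_second_derivative\<close>,
  \<open>variation_vector_derivative\<close>). Here \<open>\<partial>\<^sub>a V = J e\<^sub>a\<close> with \<open>e\<^sub>a\<close> parallel, and the Leibniz rule
  \<open>nabla_tensor_leibniz\<close> turns this into \<open>A\<^sub>Z \<circ> J = \<nabla> J\<close> on \<open>W\<^sub>t\<close>.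

  \<open>J\<close> is invertible on \<open>W\<^sub>t\<close>: the tangent map of the diffeomorphism \<open>V\<close> is injective, so the \<open>n - 1\<close>
  vectors \<open>J e\<^sub>a = \<partial>\<^sub>a V\<close> of the \<open>(n - 1)\<close>-dimensional space \<open>W\<^sub>t\<close> are independent. That \<open>c'\<close> and the \<open>e\<^sub>a\<close> form
  a basis of the tangent space at all times, not only at \<open>0\<close>, is uniqueness for the linear equation of
  parallel transport (\<open>conn_solution_unique\<close>); the velocity of a geodesic is itself parallel.

  For the determinant, let \<open>M\<close> be the matrix of \<open>J\<close> in the parallel basis \<open>e\<^sub>a\<close> of \<open>W\<^sub>t\<close>. Then
  \<open>\<nabla>(J e\<^sub>a) = \<Sum>b. M'\<^sub>b\<^sub>a e\<^sub>b\<close>, hence \<open>A\<^sub>Z (J e\<^sub>a) = \<Sum>b. M'\<^sub>b\<^sub>a e\<^sub>b\<close> (\<open>assoc_tensor_J_e\<close>). So \<open>A\<^sub>Z\<close> maps \<open>W\<^sub>t\<close> into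
  itself, and \<open>M' = B M\<close> for the matrix \<open>B\<close> of \<open>A\<^sub>Z\<close> on \<open>W\<^sub>t\<close>. Jacobi's formula yields
  \<open>(det M)' = trace B * det M\<close>, and \<open>trace B\<close> is the full trace of \<open>A\<^sub>Z\<close> because \<open>A\<^sub>Z c' = 0\<close>
  (\<open>jacobi_formula\<close>, \<open>endo_det_J_derivative\<close>).

  A tangent vector is the family of its components in all charts, so the identities between vectors are
  verified in each chart separately. The smoothness of \<open>A\<^sub>Z\<close> follows from its coordinate formula
  \<open>assoc_tensor_component\<close> and from the closure of smooth functions under composition.
\<close>

section \<open>Closure properties of smooth functions\<close>

lemma Ck_on_Suc_imp: "Ck_on (Suc k) D f \<Longrightarrow> Ck_on k D f"
proof (induction k arbitrary: f)
  case 0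
  then show ?case
    by (auto intro!: continuous_at_imp_continuous_on differentiable_imp_continuous_within)
next
  case (Suc k)
  then show ?case by auto
qed

lemma Ck_on_mono_set: "Ck_on k D f \<Longrightarrow> D' \<subseteq> D \<Longrightarrow> Ck_on k D' f"
  by (induction k arbitrary: f) (auto intro: continuous_on_subset)

text \<open>
  The derivative of a function at a point of an open set depends only on its values on that set,
  so smoothness can be checked on any expression that agrees with the function there.
\<close>

lemma Ck_on_cong:
  assumes "open D" "\<And>x. x \<in> D \<Longrightarrow> f x = g x" "Ck_on k D f"
  shows "Ck_on k D g"
  using assms(2,3)
proof (induction k arbitrary: f g)
  case 0
  then show ?case by (simp cong: continuous_on_cong)
next
  case (Suc k)
  have "g differentiable (at x)" if x: "x \<in> D" for x
  proof -
    obtain f' where "(f has_derivative f') (at x)"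
      using Suc.prems(2) x by (auto simp: differentiable_def)
    from has_derivative_transform_within_open[OF this assms(1) x Suc.prems(1)]
    show ?thesis by (auto simp: differentiable_def)
  qed
  moreover have "Ck_on k D (\<lambda>x. frechet_derivative g (at x) v)" for v
  proof (rule Suc.IH)
    show "frechet_derivative f (at x) v = frechet_derivative g (at x) v" if "x \<in> D" for x
      using frechet_derivative_transform_within_open[OF _ assms(1) that Suc.prems(1)] Suc.prems(2) that
      by simp
  qed (use Suc.prems(2) in simp)
  ultimately show ?case by simp
qed

lemma Ck_on_const: "Ck_on k D (\<lambda>x. c)"
  by (induction k arbitrary: c) auto

lemma Ck_on_bounded_linear:
  assumes "open D" "bounded_linear l" "Ck_on k D f"
  shows "Ck_on k D (\<lambda>x. l (f x))"
  using assms(3)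
proof (induction k arbitrary: f)
  case 0
  then show ?case by (auto intro: bounded_linear.continuous_on[OF assms(2)])
next
  case (Suc k)
  have d: "((\<lambda>x. l (f x)) has_derivative (\<lambda>v. l (frechet_derivative f (at x) v))) (at x)"
    if "x \<in> D" for x
    using Suc.prems that
    by (intro bounded_linear.has_derivative[OF assms(2)]) (auto simp: frechet_derivative_works[symmetric])
  have "Ck_on k D (\<lambda>x. frechet_derivative (\<lambda>x. l (f x)) (at x) v)" for v
  proof (rule Ck_on_cong[OF assms(1)])
    show "Ck_on k D (\<lambda>x. l (frechet_derivative f (at x) v))"
      using Suc by auto
  qed (simp add: frechet_derivative_at[OF d, symmetric])
  with d show ?case by (auto simp: differentiable_def)
qed

lemma Ck_on_add:
  assumes "open D" "Ck_on k D f" "Ck_on k D g"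
  shows "Ck_on k D (\<lambda>x. f x + g x)"
  using assms(2,3)
proof (induction k arbitrary: f g)
  case 0
  then show ?case by (simp add: continuous_on_add continuous_on_scaleR)
next
  case (Suc k)
  have d: "((\<lambda>x. f x + g x) has_derivative
      (\<lambda>v. frechet_derivative f (at x) v + frechet_derivative g (at x) v)) (at x)"
    if "x \<in> D" for x
    using Suc.prems that
    by (intro has_derivative_add) (auto simp: frechet_derivative_works[symmetric])
  have "Ck_on k D (\<lambda>x. frechet_derivative (\<lambda>x. f x + g x) (at x) v)" for v
  proof (rule Ck_on_cong[OF assms(1)])
    show "Ck_on k D (\<lambda>x. frechet_derivative f (at x) v + frechet_derivative g (at x) v)"
      using Suc by auto
  qed (simp add: frechet_derivative_at[OF d, symmetric])
  with d show ?case by (auto simp: differentiable_def)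
qed

lemma Ck_on_sum:
  assumes "open D" "\<And>i. i \<in> T \<Longrightarrow> Ck_on k D (f i)"
  shows "Ck_on k D (\<lambda>x. \<Sum>i\<in>T. f i x)"
  using assms(2)
  by (induction T rule: infinite_finite_induct) (auto intro: Ck_on_const Ck_on_add[OF assms(1)])

lemma Ck_on_scaleR:
  assumes "open D" "Ck_on k D f" "Ck_on k D g"
  shows "Ck_on k D (\<lambda>x. f x *\<^sub>R g x)"
  using assms(2,3)
proof (induction k arbitrary: f g)
  case 0
  then show ?case by (simp add: continuous_on_add continuous_on_scaleR)
next
  case (Suc k)
  have d: "((\<lambda>x. f x *\<^sub>R g x) has_derivative
      (\<lambda>v. f x *\<^sub>R frechet_derivative g (at x) v + frechet_derivative f (at x) v *\<^sub>R g x)) (at x)"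
    if "x \<in> D" for x
    using Suc.prems that
    by (intro has_derivative_scaleR) (auto simp: frechet_derivative_works[symmetric])
  have "Ck_on k D (\<lambda>x. frechet_derivative (\<lambda>x. f x *\<^sub>R g x) (at x) v)" for v
  proof (rule Ck_on_cong[OF assms(1)])
    show "Ck_on k D (\<lambda>x. f x *\<^sub>R frechet_derivative g (at x) v + frechet_derivative f (at x) v *\<^sub>R g x)"
      using Suc.prems Ck_on_Suc_imp[OF Suc.prems(1)] Ck_on_Suc_imp[OF Suc.prems(2)]
      by (intro Ck_on_add[OF assms(1)] Suc.IH) auto
  qed (simp add: frechet_derivative_at[OF d, symmetric])
  with d show ?case by (auto simp: differentiable_def)
qed

text \<open>
  Induction on the order: in an orthonormal basis the chain rule writes a directional derivative of
  \<open>g \<circ> f\<close> as a finite sum of products of coordinates of derivatives of \<open>f\<close> with functions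
  \<open>g' \<circ> f\<close>, where \<open>g'\<close> is a partial derivative of \<open>g\<close>. These are one order less smooth, so the
  induction hypothesis applies to \<open>g'\<close>; this is why \<open>g\<close> varies in the induction.
\<close>

lemma Ck_on_compose:
  fixes f :: "'a::real_normed_vector \<Rightarrow> 'b::euclidean_space"
    and g :: "'b \<Rightarrow> 'c::real_normed_vector"
  assumes "open D" "f ` D \<subseteq> E" "Ck_on k D f" "Ck_on k E g"
  shows "Ck_on k D (\<lambda>x. g (f x))"
  using assms(3,4)
proof (induction k arbitrary: g)
  case 0
  then show ?case using assms(2) by (auto intro: continuous_on_compose2)
next
  case (Suc k)
  let ?f' = "\<lambda>x. frechet_derivative f (at x)" and ?g' = "\<lambda>x. frechet_derivative g (at x)"
  have d: "((\<lambda>x. g (f x)) has_derivative (\<lambda>v. \<Sum>i\<in>Basis. (?f' x v \<bullet> i) *\<^sub>R ?g' (f x) i)) (at x)"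
    if "x \<in> D" for x
  proof -
    have f: "(f has_derivative ?f' x) (at x)" and g: "(g has_derivative ?g' (f x)) (at (f x))"
      using Suc.prems that assms(2) by (auto simp: frechet_derivative_works[symmetric])
    have "?g' (f x) (?f' x v) = (\<Sum>i\<in>Basis. (?f' x v \<bullet> i) *\<^sub>R ?g' (f x) i)" for v
    proof -
      interpret bounded_linear "?g' (f x)" by (rule has_derivative_bounded_linear[OF g])
      have "?g' (f x) (?f' x v) = ?g' (f x) (\<Sum>i\<in>Basis. (?f' x v \<bullet> i) *\<^sub>R i)"
        by (simp add: euclidean_representation)
      then show ?thesis by (simp add: sum scaleR)
    qed
    then show ?thesis
      using diff_chain_at[OF f g] by (simp add: o_def)
  qed
  have "Ck_on k D (\<lambda>x. frechet_derivative (\<lambda>x. g (f x)) (at x) v)" for v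
  proof (rule Ck_on_cong[OF assms(1)])
    show "Ck_on k D (\<lambda>x. \<Sum>i\<in>Basis. (?f' x v \<bullet> i) *\<^sub>R ?g' (f x) i)"
      using Suc.prems Ck_on_Suc_imp[OF Suc.prems(1)]
      by (intro Ck_on_sum Ck_on_scaleR assms(1) Suc.IH
          Ck_on_bounded_linear[OF assms(1) bounded_linear_inner_left]) auto
  qed (simp add: frechet_derivative_at[OF d, symmetric])
  with d show ?case by (auto simp: differentiable_def)
qed

lemma smooth_onD:
  assumes "smooth_on D f" "x \<in> D"
  shows "(f has_derivative frechet_derivative f (at x)) (at x)"
  using assms unfolding smooth_on_def frechet_derivative_works[symmetric]
  by (metis Ck_on.simps(2))

lemma smooth_on_continuous_on: "smooth_on D f \<Longrightarrow> continuous_on D f"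
  unfolding smooth_on_def by (metis Ck_on.simps(1))

lemma smooth_on_frechet_derivative:
  "smooth_on D f \<Longrightarrow> smooth_on D (\<lambda>x. frechet_derivative f (at x) v)"
  unfolding smooth_on_def by (metis Ck_on.simps(2))

lemma smooth_on_mono_set: "smooth_on D f \<Longrightarrow> D' \<subseteq> D \<Longrightarrow> smooth_on D' f"
  unfolding smooth_on_def by (auto intro: Ck_on_mono_set)

lemma smooth_on_cong:
  "open D \<Longrightarrow> smooth_on D f \<Longrightarrow> (\<And>x. x \<in> D \<Longrightarrow> f x = g x) \<Longrightarrow> smooth_on D g"
  unfolding smooth_on_def by (auto intro: Ck_on_cong)

lemma smooth_on_bounded_linear:
  "open D \<Longrightarrow> bounded_linear l \<Longrightarrow> smooth_on D f \<Longrightarrow> smooth_on D (\<lambda>x. l (f x))"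
  unfolding smooth_on_def by (auto intro: Ck_on_bounded_linear)

lemma smooth_on_add:
  "open D \<Longrightarrow> smooth_on D f \<Longrightarrow> smooth_on D g \<Longrightarrow> smooth_on D (\<lambda>x. f x + g x)"
  unfolding smooth_on_def by (auto intro: Ck_on_add)

lemma smooth_on_Pair:
  assumes "open D" "smooth_on D f" "smooth_on D g"
  shows "smooth_on D (\<lambda>x. (f x, g x))"
proof -
  have "smooth_on D (\<lambda>x. (f x, 0) + (0, g x))"
    by (intro smooth_on_add assms smooth_on_bounded_linear[OF assms(1), of "\<lambda>y. (y, 0)"]
        smooth_on_bounded_linear[OF assms(1), of "\<lambda>y. (0, y)"] bounded_linear_Pair
        bounded_linear_ident bounded_linear_zero)
  then show ?thesis by simp
qed

lemma smooth_on_compose: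
  fixes f :: "'a::real_normed_vector \<Rightarrow> 'b::euclidean_space"
    and g :: "'b \<Rightarrow> 'c::real_normed_vector"
  assumes "open D" "f ` D \<subseteq> E" "smooth_on D f" "smooth_on E g"
  shows "smooth_on D (\<lambda>x. g (f x))"
  unfolding smooth_on_def
proof
  show "Ck_on k D (\<lambda>x. g (f x))" for k
    by (rule Ck_on_compose[OF assms(1,2)]) (use assms(3,4) in \<open>auto simp: smooth_on_def\<close>)
qed

section \<open>Symmetry of second derivatives\<close>

text \<open>
  Two applications of the mean value theorem: first along \<open>u\<close> to the increment of \<open>f\<close> in the
  direction \<open>v\<close>, then along \<open>v\<close> to the derivative of \<open>f\<close> in the direction \<open>u\<close>.
\<close>

lemma second_difference_mean_value:
  fixes f :: "'a::real_normed_vector \<Rightarrow> real"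
  assumes smooth: "smooth_on D f" and h: "0 < h"
    and D: "\<And>a b. a \<in> {0..h} \<Longrightarrow> b \<in> {0..h} \<Longrightarrow> z + a *\<^sub>R u + b *\<^sub>R v \<in> D"
  obtains a b where "a \<in> {0..h}" "b \<in> {0..h}"
    "f (z + h *\<^sub>R u + h *\<^sub>R v) - f (z + h *\<^sub>R u) - f (z + h *\<^sub>R v) + f z
       = h * h * frechet_derivative (\<lambda>x. frechet_derivative f (at x) u)
           (at (z + a *\<^sub>R u + b *\<^sub>R v)) v"
proof -
  let ?u = "\<lambda>x. frechet_derivative f (at x) u"
  let ?uv = "\<lambda>x. frechet_derivative ?u (at x) v"
  define g where "g a = f (z + a *\<^sub>R u + h *\<^sub>R v) - f (z + a *\<^sub>R u)" for a
  have du: "((\<lambda>a. f (z + a *\<^sub>R u + w)) has_real_derivative ?u (z + a *\<^sub>R u + w)) (at a)"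
    if "z + a *\<^sub>R u + w \<in> D" for a w
  proof -
    have "((\<lambda>a. z + a *\<^sub>R u + w) has_derivative (\<lambda>r. r *\<^sub>R u)) (at a)"
      by (auto intro!: derivative_eq_intros)
    from diff_chain_at[OF this smooth_onD[OF smooth that]]
    have "((\<lambda>a. f (z + a *\<^sub>R u + w)) has_derivative
        (\<lambda>r. frechet_derivative f (at (z + a *\<^sub>R u + w)) (r *\<^sub>R u))) (at a)"
      by (simp add: o_def)
    moreover have "linear (frechet_derivative f (at (z + a *\<^sub>R u + w)))"
      using smooth_onD[OF smooth that] has_derivative_linear by blast
    ultimately show ?thesis
      by (simp add: has_field_derivative_def linear_cmul mult.commute[of _ "?u _"])
  qed
  have dv: "((\<lambda>b. ?u (w + b *\<^sub>R v)) has_real_derivative ?uv (w + b *\<^sub>R v)) (at b)"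
    if "w + b *\<^sub>R v \<in> D" for b w
  proof -
    note s = smooth_onD[OF smooth_on_frechet_derivative[OF smooth, of u] that]
    have "((\<lambda>b. w + b *\<^sub>R v) has_derivative (\<lambda>r. r *\<^sub>R v)) (at b)"
      by (auto intro!: derivative_eq_intros)
    from diff_chain_at[OF this s]
    have "((\<lambda>b. ?u (w + b *\<^sub>R v)) has_derivative
        (\<lambda>r. frechet_derivative ?u (at (w + b *\<^sub>R v)) (r *\<^sub>R v))) (at b)"
      by (simp add: o_def)
    moreover have "linear (frechet_derivative ?u (at (w + b *\<^sub>R v)))"
      using s has_derivative_linear by blast
    ultimately show ?thesis
      by (simp add: has_field_derivative_def linear_cmul mult.commute[of _ "?uv _"])
  qed
  have "(g has_real_derivative (?u (z + a *\<^sub>R u + h *\<^sub>R v) - ?u (z + a *\<^sub>R u))) (at a)"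
    if "0 \<le> a" "a \<le> h" for a
    using du[of a "h *\<^sub>R v"] du[of a 0] D[of a h] D[of a 0] that h
    unfolding g_def by (auto intro!: derivative_eq_intros)
  from MVT2[OF h this] obtain a where a: "0 < a" "a < h"
    and ga: "g h - g 0 = (h - 0) * (?u (z + a *\<^sub>R u + h *\<^sub>R v) - ?u (z + a *\<^sub>R u))"
    by blast
  have "((\<lambda>b. ?u (z + a *\<^sub>R u + b *\<^sub>R v)) has_real_derivative ?uv (z + a *\<^sub>R u + b *\<^sub>R v)) (at b)"
    if "0 \<le> b" "b \<le> h" for b
    using that a by (intro dv D) auto
  from MVT2[OF h this] obtain b where b: "0 < b" "b < h"
    and "?u (z + a *\<^sub>R u + h *\<^sub>R v) - ?u (z + a *\<^sub>R u + 0 *\<^sub>R v) = (h - 0) * ?uv (z + a *\<^sub>R u + b *\<^sub>R v)"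
    by blast
  with ga have "g h - g 0 = h * h * ?uv (z + a *\<^sub>R u + b *\<^sub>R v)" by simp
  with a b show ?thesis
    by (intro that[of a b]) (auto simp: g_def)
qed

text \<open>
  The second difference is symmetric in \<open>u\<close> and \<open>v\<close>. By the previous lemma it is \<open>h\<^sup>2\<close> times a
  value of either mixed derivative at a point that tends to \<open>z\<close> with \<open>h\<close>; both mixed derivatives
  are continuous, so they agree at \<open>z\<close>.
\<close>

lemma symmetric_second_derivative_real:
  fixes f :: "'a::real_normed_vector \<Rightarrow> real"
  assumes smooth: "smooth_on D f" and D: "open D" "z \<in> D"
  shows "frechet_derivative (\<lambda>x. frechet_derivative f (at x) u) (at z) v
    = frechet_derivative (\<lambda>x. frechet_derivative f (at x) v) (at z) u" (is "?uv z = ?vu z")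
proof -
  define X where "X = (\<lambda>n. inverse (real (Suc n)))"
  have X: "X \<longlonglongrightarrow> 0" "\<And>n. X n > 0" unfolding X_def by (rule LIMSEQ_inverse_real_of_nat, simp)
  obtain r where r: "r > 0" "ball z r \<subseteq> D" using D open_contains_ball by blast
  \<comment> \<open>the intermediate points of step \<open>h\<close> lie within distance \<open>h * ?K\<close> of \<open>z\<close>\<close>
  let ?K = "norm u + norm v + 1"
  have K: "dist z (z + a *\<^sub>R u + b *\<^sub>R v) \<le> h * ?K" if "a \<in> {0..h}" "b \<in> {0..h}" for a b h :: real
  proof -
    have "dist z (z + a *\<^sub>R u + b *\<^sub>R v) = norm (a *\<^sub>R u + b *\<^sub>R v)"
      by (subst dist_commute) (simp add: dist_norm)
    also have "\<dots> \<le> \<bar>a\<bar> * norm u + \<bar>b\<bar> * norm v"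
      using norm_triangle_ineq[of "a *\<^sub>R u" "b *\<^sub>R v"] by simp
    also have "\<dots> \<le> h * norm u + h * norm v" using that by (intro add_mono mult_right_mono) auto
    also have "\<dots> \<le> h * ?K" using that by (simp add: algebra_simps)
    finally show ?thesis .
  qed
  have "(\<lambda>n. X n * ?K) \<longlonglongrightarrow> 0" using tendsto_mult_left_zero[OF X(1)] by simp
  then have XK: "\<forall>\<^sub>F n in sequentially. X n * ?K < r"
    using r(1) order_tendstoD(2) by blast
  \<comment> \<open>the implication keeps the choice total; the points matter only once the step is small\<close>
  have "\<exists>a b a' b'. X n * ?K < r \<longrightarrow> a \<in> {0..X n} \<and> b \<in> {0..X n} \<and> a' \<in> {0..X n} \<and> b' \<in> {0..X n} \<and>
     ?uv (z + a *\<^sub>R u + b *\<^sub>R v) = ?vu (z + a' *\<^sub>R u + b' *\<^sub>R v)" for n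
  proof (cases "X n * ?K < r")
    case True
    then have inD: "z + a *\<^sub>R u + b *\<^sub>R v \<in> D" if "a \<in> {0..X n}" "b \<in> {0..X n}" for a b
      using K[OF that] r(2) by auto
    obtain a b where ab: "a \<in> {0..X n}" "b \<in> {0..X n}"
      "f (z + X n *\<^sub>R u + X n *\<^sub>R v) - f (z + X n *\<^sub>R u) - f (z + X n *\<^sub>R v) + f z
       = X n * X n * ?uv (z + a *\<^sub>R u + b *\<^sub>R v)"
      using second_difference_mean_value[OF smooth X(2)[of n], of z u v, OF inD] by blast
    have inD': "z + b *\<^sub>R v + a *\<^sub>R u \<in> D" if "b \<in> {0..X n}" "a \<in> {0..X n}" for a b
      using inD that by (simp add: add_ac)
    obtain a' b' where ab': "a' \<in> {0..X n}" "b' \<in> {0..X n}"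
      "f (z + X n *\<^sub>R v + X n *\<^sub>R u) - f (z + X n *\<^sub>R v) - f (z + X n *\<^sub>R u) + f z
       = X n * X n * ?vu (z + b' *\<^sub>R v + a' *\<^sub>R u)"
      using second_difference_mean_value[OF smooth X(2)[of n], of z v u, OF inD'] by blast
    have "X n * X n * ?uv (z + a *\<^sub>R u + b *\<^sub>R v) = X n * X n * ?vu (z + a' *\<^sub>R u + b' *\<^sub>R v)"
    proof -
      have 1: "z + X n *\<^sub>R u + X n *\<^sub>R v = z + X n *\<^sub>R v + X n *\<^sub>R u"
        and 2: "z + b' *\<^sub>R v + a' *\<^sub>R u = z + a' *\<^sub>R u + b' *\<^sub>R v"
        by (simp_all add: add_ac)
      show ?thesis using ab(3)[unfolded 1] ab'(3)[unfolded 2] by linarith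
    qed
    then have "?uv (z + a *\<^sub>R u + b *\<^sub>R v) = ?vu (z + a' *\<^sub>R u + b' *\<^sub>R v)"
      using X(2)[of n] by simp
    with ab ab' show ?thesis by blast
  qed auto
  then obtain a b a' b' where *: "\<And>n. X n * ?K < r \<Longrightarrow>
      a n \<in> {0..X n} \<and> b n \<in> {0..X n} \<and> a' n \<in> {0..X n} \<and> b' n \<in> {0..X n} \<and>
     ?uv (z + a n *\<^sub>R u + b n *\<^sub>R v) = ?vu (z + a' n *\<^sub>R u + b' n *\<^sub>R v)"
    by metis
  have lim: "(\<lambda>n. z + a n *\<^sub>R u + b n *\<^sub>R v) \<longlonglongrightarrow> z"
    if "\<And>n. X n * ?K < r \<Longrightarrow> a n \<in> {0..X n} \<and> b n \<in> {0..X n}" for a b :: "nat \<Rightarrow> real"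
  proof -
    have "\<forall>\<^sub>F n in sequentially. 0 \<le> a n \<and> a n \<le> X n \<and> 0 \<le> b n \<and> b n \<le> X n"
      using XK by eventually_elim (use that in auto)
    then have "a \<longlonglongrightarrow> 0" "b \<longlonglongrightarrow> 0"
      by (auto intro!: tendsto_sandwich[OF _ _ tendsto_const X(1)] elim: eventually_mono)
    then show ?thesis
      using tendsto_add[OF tendsto_add[OF tendsto_const[of z] tendsto_scaleR[of a 0 _ "\<lambda>_. u" u]]
          tendsto_scaleR[of b 0 _ "\<lambda>_. v" v]] by auto
  qed
  have "continuous_on D ?uv" "continuous_on D ?vu"
    by (intro smooth_on_continuous_on smooth_on_frechet_derivative smooth)+
  then have cont: "isCont ?uv z" "isCont ?vu z"
    using D by (auto simp: continuous_on_eq_continuous_at)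
  have 1: "(\<lambda>n. ?uv (z + a n *\<^sub>R u + b n *\<^sub>R v)) \<longlonglongrightarrow> ?uv z"
    using * by (intro isCont_tendsto_compose[OF cont(1)] lim) blast
  have "(\<lambda>n. ?vu (z + a' n *\<^sub>R u + b' n *\<^sub>R v)) \<longlonglongrightarrow> ?vu z"
    using * by (intro isCont_tendsto_compose[OF cont(2)] lim) blast
  then have 2: "(\<lambda>n. ?uv (z + a n *\<^sub>R u + b n *\<^sub>R v)) \<longlonglongrightarrow> ?vu z"
    by (rule Lim_transform_eventually) (use XK * in \<open>auto elim!: eventually_mono\<close>)
  from LIMSEQ_unique[OF 1 2] show ?thesis .
qed

lemma frechet_derivative_inner_left:
  assumes "f differentiable (at x)"
  shows "frechet_derivative (\<lambda>x. f x \<bullet> i) (at x) v = frechet_derivative f (at x) v \<bullet> i"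
proof -
  have "((\<lambda>x. f x \<bullet> i) has_derivative (\<lambda>v. frechet_derivative f (at x) v \<bullet> i)) (at x)"
    using assms by (auto intro!: derivative_intros simp: frechet_derivative_works)
  then show ?thesis by (metis frechet_derivative_at)
qed

lemma symmetric_second_derivative:
  fixes f :: "'a::real_normed_vector \<Rightarrow> 'b::euclidean_space"
  assumes smooth: "smooth_on D f" and D: "open D" "z \<in> D"
  shows "frechet_derivative (\<lambda>x. frechet_derivative f (at x) u) (at z) v
    = frechet_derivative (\<lambda>x. frechet_derivative f (at x) v) (at z) u"
proof (rule euclidean_eqI)
  fix i :: 'b
  have diff: "g differentiable (at x)" if "smooth_on D g" "x \<in> D" for g :: "'a \<Rightarrow> 'b" and x
    using smooth_onD[OF that] by (auto simp: differentiable_def)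
  have *: "frechet_derivative (\<lambda>x. frechet_derivative (\<lambda>x. f x \<bullet> i) (at x) u) (at z) v
    = frechet_derivative (\<lambda>x. frechet_derivative f (at x) u) (at z) v \<bullet> i" for u v
  proof -
    have "frechet_derivative (\<lambda>x. frechet_derivative (\<lambda>x. f x \<bullet> i) (at x) u) (at z)
        = frechet_derivative (\<lambda>x. frechet_derivative f (at x) u \<bullet> i) (at z)"
    proof (rule frechet_derivative_transform_within_open[OF _ D, symmetric])
      show "(\<lambda>x. frechet_derivative f (at x) u \<bullet> i) differentiable at z"
        by (intro differentiable_inner differentiable_const diff smooth_on_frechet_derivative smooth D)
    qed (use diff[OF smooth] in \<open>simp add: frechet_derivative_inner_left\<close>)
    then show ?thesis
      using diff[OF smooth_on_frechet_derivative[OF smooth] D(2)]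
      by (simp add: frechet_derivative_inner_left)
  qed
  have "smooth_on D (\<lambda>x. f x \<bullet> i)"
    by (rule smooth_on_bounded_linear[OF D(1) bounded_linear_inner_left smooth])
  from symmetric_second_derivative_real[OF this D, of u v]
  show "frechet_derivative (\<lambda>x. frechet_derivative f (at x) u) (at z) v \<bullet> i
    = frechet_derivative (\<lambda>x. frechet_derivative f (at x) v) (at z) u \<bullet> i"
    by (simp add: *)
qed

section \<open>Uniqueness for linear differential equations\<close>

text \<open>
  On an interval so short that the Lipschitz constant times its radius is at most \<open>1/2\<close>, the
  maximum of \<open>norm X\<close> is at most half of itself.
\<close>

lemma linear_ode_zero_locally:
  fixes X :: "real \<Rightarrow> 'a::real_normed_vector"
  assumes \<delta>: "\<delta> > 0" and X0: "X t = 0"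
    and deriv: "\<And>\<tau>. \<bar>\<tau> - t\<bar> < \<delta> \<Longrightarrow> (X has_vector_derivative X' \<tau>) (at \<tau>)"
    and bound: "\<And>\<tau>. \<bar>\<tau> - t\<bar> < \<delta> \<Longrightarrow> norm (X' \<tau>) \<le> K * norm (X \<tau>)"
  shows "\<exists>d>0. \<forall>\<tau>. \<bar>\<tau> - t\<bar> < d \<longrightarrow> X \<tau> = 0"
proof -
  define L where "L = \<bar>K\<bar> + 1"
  define d where "d = min (\<delta> / 2) (1 / (2 * L))"
  have L: "L > 0" "K \<le> L" unfolding L_def by auto
  have d: "0 < d" "d < \<delta>" using \<delta> L by (auto simp: d_def)
  have "L * d \<le> L * (1 / (2 * L))" using L by (intro mult_left_mono) (auto simp: d_def)
  then have Ld: "L * d \<le> 1/2" using L by simp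
  let ?C = "cball t d"
  have C: "\<bar>\<tau> - t\<bar> < \<delta>" if "\<tau> \<in> ?C" for \<tau>
    using that d by (auto simp: dist_real_def)
  have "continuous_on ?C (\<lambda>\<tau>. norm (X \<tau>))"
    by (intro continuous_on_norm continuous_at_imp_continuous_on ballI)
      (rule has_vector_derivative_continuous[OF deriv[OF C]])
  then obtain \<tau>0 where \<tau>0: "\<tau>0 \<in> ?C" "\<And>\<tau>. \<tau> \<in> ?C \<Longrightarrow> norm (X \<tau>) \<le> norm (X \<tau>0)"
    using continuous_attains_sup[of ?C "\<lambda>\<tau>. norm (X \<tau>)"] d(1) compact_cball[of t d]
    by (auto simp del: mem_cball)
  have "norm (X \<tau>0 - X t) \<le> (L * norm (X \<tau>0)) * norm (\<tau>0 - t)"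
  proof (rule differentiable_bound[OF convex_cball])
    show "(X has_derivative (\<lambda>r. r *\<^sub>R X' \<tau>)) (at \<tau> within ?C)" if "\<tau> \<in> ?C" for \<tau>
      using deriv[OF C[OF that]] unfolding has_vector_derivative_def by (rule has_derivative_at_withinI)
    show "onorm (\<lambda>r. r *\<^sub>R X' \<tau>) \<le> L * norm (X \<tau>0)" if "\<tau> \<in> ?C" for \<tau>
    proof (rule onorm_le)
      have "norm (X' \<tau>) \<le> L * norm (X \<tau>0)"
        by (rule order_trans[OF bound[OF C[OF that]] mult_mono]) (use L \<tau>0(2)[OF that] in auto)
      then have "norm (X' \<tau>) * \<bar>r\<bar> \<le> L * norm (X \<tau>0) * \<bar>r\<bar>" for r :: real
        by (intro mult_right_mono) auto
      then show "norm (r *\<^sub>R X' \<tau>) \<le> L * norm (X \<tau>0) * norm r" for r :: real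
        by (simp add: mult.commute)
    qed
  qed (use \<tau>0 d in auto)
  also have "\<dots> \<le> (L * norm (X \<tau>0)) * d"
    using \<tau>0(1) L by (intro mult_left_mono) (auto simp: dist_real_def abs_minus_commute)
  also have "\<dots> = (L * d) * norm (X \<tau>0)" by simp
  also have "\<dots> \<le> 1/2 * norm (X \<tau>0)" by (intro mult_right_mono Ld) auto
  finally have "norm (X \<tau>0) \<le> 0" by (simp add: X0)
  then have "X \<tau> = 0" if "\<bar>\<tau> - t\<bar> < d" for \<tau>
    using \<tau>0(2)[of \<tau>] that by (simp add: dist_real_def abs_minus_commute)
  with d(1) show ?thesis by blast
qed

section \<open>Bases, determinants and traces of endomorphisms\<close>

lemma representation_family:
  fixes b :: "'k::finite \<Rightarrow> 'v::real_vector"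
  assumes "inj b" "independent (range b)"
  shows "representation (range b) (\<Sum>j\<in>UNIV. x j *\<^sub>R b j) (b i) = x i"
proof -
  have "representation (range b) (\<Sum>j\<in>UNIV. x j *\<^sub>R b j)
      = (\<lambda>v. \<Sum>j\<in>UNIV. x j * representation (range b) (b j) v)"
    using assms(2) by (subst representation_sum) (auto simp: representation_scale span_base span_scale)
  then show ?thesis
    using assms by (simp add: representation_basis inj_eq if_distrib[of "\<lambda>y. _ * y"] cong: if_cong)
qed

lemma basis_of_expansion:
  fixes b :: "'k::finite \<Rightarrow> 'v::real_vector"
  assumes "basis_of b W" "v \<in> W"
  shows "v = (\<Sum>i\<in>UNIV. representation (range b) v (b i) *\<^sub>R b i)"
proof -
  have b: "inj b" "independent (range b)" "v \<in> span (range b)"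
    using assms by (auto simp: basis_of_def)
  have "v = (\<Sum>w\<in>range b. representation (range b) v w *\<^sub>R w)"
    using b by (intro sum_representation_eq[symmetric]) auto
  also have "\<dots> = (\<Sum>i\<in>UNIV. representation (range b) v (b i) *\<^sub>R b i)"
    using b(1) by (subst sum.reindex) auto
  finally show ?thesis .
qed

lemma basis_of_obtain:
  fixes b :: "'k::finite \<Rightarrow> 'v::real_vector"
  assumes "basis_of b W" "v \<in> W"
  obtains x where "v = (\<Sum>i\<in>UNIV. x i *\<^sub>R b i)"
  by (rule that[OF basis_of_expansion[OF assms]])

lemma basis_of_unique_coeffs:
  fixes b :: "'k::finite \<Rightarrow> 'v::real_vector"
  assumes "basis_of b W" "(\<Sum>i\<in>UNIV. x i *\<^sub>R b i) = (\<Sum>i\<in>UNIV. y i *\<^sub>R b i)"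
  shows "x i = y i"
  using representation_family[of b x i] representation_family[of b y i] assms
  by (auto simp: basis_of_def)

lemma basis_ofI:
  fixes b :: "'k::finite \<Rightarrow> 'v::real_vector"
  assumes "\<And>x i. (\<Sum>j\<in>UNIV. x j *\<^sub>R b j) = 0 \<Longrightarrow> x i = 0" "span (range b) = W"
  shows "basis_of b W"
proof -
  have inj: "inj b"
  proof (rule injI, rule ccontr)
    fix i j assume *: "b i = b j" "i \<noteq> j"
    define x where "x k = (if k = i then 1 else 0) - (if k = j then 1 else 0 :: real)" for k
    have "(\<Sum>k\<in>UNIV. x k *\<^sub>R b k) = b i - b j"
      by (simp add: x_def scaleR_diff_left sum_subtractf if_distrib[of "\<lambda>r. r *\<^sub>R _"] cong: if_cong)
    with assms(1)[of x i] * show False by (simp add: x_def)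
  qed
  have "independent (range b)"
  proof (rule independent_if_scalars_zero)
    fix f v assume "(\<Sum>v\<in>range b. f v *\<^sub>R v) = 0" "v \<in> range b"
    then show "f v = 0"
      using assms(1)[of "\<lambda>i. f (b i)"] inj by (auto simp: sum.reindex)
  qed auto
  with inj assms(2) show ?thesis by (simp add: basis_of_def)
qed

lemma sum_fun_apply:
  fixes f :: "'i \<Rightarrow> 'a \<Rightarrow> 'b::comm_monoid_add"
  shows "(\<Sum>i\<in>B. f i) x = (\<Sum>i\<in>B. f i x)"
  by (induction B rule: infinite_finite_induct) simp_all

lemma linear_on_sum:
  fixes f :: "'v::real_vector \<Rightarrow> 'w::real_vector"
  assumes "subspace T" and add: "\<And>v w. v \<in> T \<Longrightarrow> w \<in> T \<Longrightarrow> f (v + w) = f v + f w"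
    and scale: "\<And>r v. v \<in> T \<Longrightarrow> f (r *\<^sub>R v) = r *\<^sub>R f v"
    and b: "\<And>i. i \<in> B \<Longrightarrow> b i \<in> T"
  shows "f (\<Sum>i\<in>B. x i *\<^sub>R b i) = (\<Sum>i\<in>B. x i *\<^sub>R f (b i))"
proof -
  have f0: "f 0 = 0" using scale[of 0 0] subspace_0[OF assms(1)] by simp
  show ?thesis
    using b
  proof (induction B rule: infinite_finite_induct)
    case (insert i B)
    have "(\<Sum>i\<in>B. x i *\<^sub>R b i) \<in> T"
      by (intro subspace_sum subspace_scale assms(1) insert.prems) simp
    then have "f (x i *\<^sub>R b i + (\<Sum>i\<in>B. x i *\<^sub>R b i)) = x i *\<^sub>R f (b i) + f (\<Sum>i\<in>B. x i *\<^sub>R b i)"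
      using insert.prems by (simp add: add scale subspace_scale[OF assms(1)])
    with insert show ?case by simp
  qed (simp_all add: f0)
qed

lemma linear_endo_on_sum:
  assumes "linear_endo_on T f" "subspace T" "\<And>i. i \<in> B \<Longrightarrow> b i \<in> T"
  shows "f (\<Sum>i\<in>B. x i *\<^sub>R b i) = (\<Sum>i\<in>B. x i *\<^sub>R f (b i))"
  by (rule linear_on_sum[OF assms(2)]) (use assms in \<open>auto simp: linear_endo_on_def\<close>)

lemma basis_of_mem: "basis_of b W \<Longrightarrow> b i \<in> W"
  by (auto simp: basis_of_def intro: span_base)

lemma basis_of_subspace: "basis_of b W \<Longrightarrow> subspace W"
  by (auto simp: basis_of_def)

lemma matrix_wrt_expansion:
  fixes b :: "'k::finite \<Rightarrow> 'v::real_vector"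
  assumes "basis_of b W" "linear_endo_on W f"
  shows "f (b j) = (\<Sum>i\<in>UNIV. matrix_wrt b f $ i $ j *\<^sub>R b i)"
  unfolding matrix_wrt_def vec_lambda_beta
  by (rule basis_of_expansion[OF assms(1)]) (use assms basis_of_mem[OF assms(1)] in \<open>auto simp: linear_endo_on_def\<close>)

lemma matrix_wrt_eqI:
  fixes b :: "'k::finite \<Rightarrow> 'v::real_vector"
  assumes "basis_of b W" "\<And>j. f (b j) = (\<Sum>i\<in>UNIV. B $ i $ j *\<^sub>R b i)"
  shows "matrix_wrt b f = B"
  using assms representation_family[of b "\<lambda>i. B $ i $ _"]
  by (simp add: vec_eq_iff matrix_wrt_def basis_of_def)

lemma sum_matrix_mult_scaleR:
  fixes b :: "'k::finite \<Rightarrow> 'v::real_vector" and P :: "real^'l^'k" and Q :: "real^'j^'l"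
  shows "(\<Sum>i\<in>UNIV. (P ** Q) $ i $ j *\<^sub>R b i)
    = (\<Sum>l\<in>UNIV. Q $ l $ j *\<^sub>R (\<Sum>i\<in>UNIV. P $ i $ l *\<^sub>R b i))"
  unfolding matrix_matrix_mult_def vec_lambda_beta scaleR_sum_left scaleR_sum_right
  by (subst sum.swap) (simp add: mult.commute)

text \<open>
  The two index types may differ, so that a basis indexed by \<open>'k option\<close> can be compared with one
  indexed by \<open>'n\<close>.
\<close>

lemma change_of_basis:
  fixes b :: "'k::finite \<Rightarrow> 'v::real_vector" and b' :: "'l::finite \<Rightarrow> 'v"
  assumes b: "basis_of b W" and b': "basis_of b' W"
  obtains P :: "real^'k^'l" and Q :: "real^'l^'k"
  where "P ** Q = mat 1" "Q ** P = mat 1"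
    "\<And>f. linear_endo_on W f \<Longrightarrow> matrix_wrt b' f ** P = P ** matrix_wrt b f"
proof -
  define P :: "real^'k^'l" where "P = (\<chi> i j. representation (range b') (b j) (b' i))"
  define Q :: "real^'l^'k" where "Q = (\<chi> i j. representation (range b) (b' j) (b i))"
  have P: "b j = (\<Sum>i\<in>UNIV. P $ i $ j *\<^sub>R b' i)" for j
    unfolding P_def vec_lambda_beta by (rule basis_of_expansion[OF b' basis_of_mem[OF b]])
  have Q: "b' j = (\<Sum>i\<in>UNIV. Q $ i $ j *\<^sub>R b i)" for j
    unfolding Q_def vec_lambda_beta by (rule basis_of_expansion[OF b basis_of_mem[OF b']])
  have unit: "(\<Sum>i\<in>UNIV. mat 1 $ i $ j *\<^sub>R x i) = x j" for x :: "'i::finite \<Rightarrow> 'v" and j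
    by (simp add: mat_def if_distrib[of "\<lambda>r. r *\<^sub>R _"] cong: if_cong)
  have "P ** Q = mat 1"
  proof -
    have "(\<Sum>i\<in>UNIV. (P ** Q) $ i $ j *\<^sub>R b' i) = (\<Sum>i\<in>UNIV. mat 1 $ i $ j *\<^sub>R b' i)" for j
      by (simp only: sum_matrix_mult_scaleR P[symmetric] Q[symmetric] unit)
    from basis_of_unique_coeffs[OF b' this] show ?thesis by (simp add: vec_eq_iff)
  qed
  moreover have "Q ** P = mat 1"
  proof -
    have "(\<Sum>i\<in>UNIV. (Q ** P) $ i $ j *\<^sub>R b i) = (\<Sum>i\<in>UNIV. mat 1 $ i $ j *\<^sub>R b i)" for j
      by (simp only: sum_matrix_mult_scaleR P[symmetric] Q[symmetric] unit)
    from basis_of_unique_coeffs[OF b this] show ?thesis by (simp add: vec_eq_iff)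
  qed
  moreover have "matrix_wrt b' f ** P = P ** matrix_wrt b f" if f: "linear_endo_on W f" for f
  proof -
    have "(\<Sum>i\<in>UNIV. (matrix_wrt b' f ** P) $ i $ j *\<^sub>R b' i)
        = (\<Sum>i\<in>UNIV. (P ** matrix_wrt b f) $ i $ j *\<^sub>R b' i)" for j
    proof -
      have "(\<Sum>i\<in>UNIV. (matrix_wrt b' f ** P) $ i $ j *\<^sub>R b' i) = (\<Sum>l\<in>UNIV. P $ l $ j *\<^sub>R f (b' l))"
        by (simp only: sum_matrix_mult_scaleR matrix_wrt_expansion[OF b' f, symmetric])
      also have "\<dots> = f (b j)"
        by (subst P[of j]) (rule linear_endo_on_sum[OF f basis_of_subspace[OF b'], symmetric], rule basis_of_mem[OF b'])
      also have "\<dots> = (\<Sum>i\<in>UNIV. (P ** matrix_wrt b f) $ i $ j *\<^sub>R b' i)"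
        by (simp only: sum_matrix_mult_scaleR P[symmetric] matrix_wrt_expansion[OF b f, symmetric])
      finally show ?thesis .
    qed
    from basis_of_unique_coeffs[OF b' this] show ?thesis by (simp add: vec_eq_iff)
  qed
  ultimately show ?thesis by (rule that)
qed

text \<open>
  Similar matrices have the same determinant, so the choice of the basis in \<^const>\<open>endo_det\<close> does
  not matter.
\<close>

lemma endo_det_eq:
  fixes b :: "'k::finite \<Rightarrow> 'v::real_vector"
  assumes b: "basis_of b W" and f: "linear_endo_on W f"
  shows "endo_det TYPE('k) W f = det (matrix_wrt b f)"
proof -
  define b' :: "'k \<Rightarrow> 'v" where "b' = (SOME b. basis_of b W)"
  have b': "basis_of b' W" unfolding b'_def by (rule someI[of _ b], rule b)
  obtain P :: "real^'k^'k" and Q :: "real^'k^'k"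
    where PQ: "P ** Q = mat 1" and eq: "matrix_wrt b' f ** P = P ** matrix_wrt b f"
    using change_of_basis[OF b b'] f by metis
  have "det P * det Q = 1" using PQ by (metis det_mul det_I)
  then have "det P \<noteq> 0" by auto
  moreover have "det (matrix_wrt b' f) * det P = det P * det (matrix_wrt b f)"
    using eq by (metis det_mul)
  ultimately show ?thesis by (simp add: endo_det_def b'_def)
qed

text \<open>
  Invariance of the trace under a change of basis. Transporting \<open>b\<close> along a bijection of the index
  types shows that a basis indexed by \<open>'n\<close>, as \<^const>\<open>endo_trace\<close> wants it, exists.
\<close>

lemma endo_trace_eq:
  fixes b :: "'k::finite \<Rightarrow> 'v::real_vector"
  assumes b: "basis_of b W" and f: "linear_endo_on W f" and card: "CARD('n::finite) = CARD('k)"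
  shows "endo_trace TYPE('n) W f = trace (matrix_wrt b f)"
proof -
  obtain \<beta> :: "'n \<Rightarrow> 'k" where \<beta>: "bij \<beta>"
    using card by (metis finite finite_same_card_bij)
  have "basis_of (b \<circ> \<beta>) W"
    using b \<beta> unfolding basis_of_def
    by (metis bij_betw_def bij_is_surj fun.set_map image_comp inj_compose)
  define b' :: "'n \<Rightarrow> 'v" where "b' = (SOME b. basis_of b W)"
  have b': "basis_of b' W" unfolding b'_def by (rule someI[of "\<lambda>b. basis_of b W" "b \<circ> \<beta>"]) fact
  obtain P :: "real^'k^'n" and Q :: "real^'n^'k"
    where PQ: "P ** Q = mat 1" "Q ** P = mat 1" and eq: "matrix_wrt b' f ** P = P ** matrix_wrt b f"
    using change_of_basis[OF b b'] f by metis
  have "trace (matrix_wrt b' f) = trace ((matrix_wrt b' f ** P) ** Q)"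
    by (simp add: matrix_mul_assoc[symmetric] PQ)
  also have "\<dots> = trace (Q ** (P ** matrix_wrt b f))"
    unfolding eq by (rule trace_mul_sym)
  also have "\<dots> = trace (matrix_wrt b f)"
    by (simp add: matrix_mul_assoc PQ)
  finally show ?thesis by (simp add: endo_trace_def b'_def)
qed

lemma sum_option_UNIV:
  fixes x :: "'k::finite option \<Rightarrow> 'v::comm_monoid_add"
  shows "(\<Sum>i\<in>UNIV. x i) = x None + (\<Sum>a\<in>UNIV. x (Some a))"
  by (simp add: UNIV_option_conv sum.reindex)

text \<open>
  In the basis \<open>u, e\<close> the column of the kernel vector \<open>u\<close> is zero and \<open>B\<close> is the only other nonzero
  block, so it carries the whole trace.
\<close>

lemma endo_trace_kernel_complement:
  fixes u :: "'v::real_vector" and e :: "'k::finite \<Rightarrow> 'v" and B :: "real^'k^'k"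
  assumes basis: "basis_of (case_option u e) T" and f: "linear_endo_on T f"
    and card: "CARD('n::finite) = CARD('k) + 1"
    and u: "f u = 0" and e: "\<And>a. f (e a) = (\<Sum>b\<in>UNIV. B $ b $ a *\<^sub>R e b)"
  shows "endo_trace TYPE('n) T f = trace B"
proof -
  define C :: "real^'k option^'k option" where
    "C = (\<chi> i j. case (i, j) of (Some b, Some a) \<Rightarrow> B $ b $ a | _ \<Rightarrow> 0)"
  have "matrix_wrt (case_option u e) f = C"
  proof (rule matrix_wrt_eqI[OF basis])
    show "f (case_option u e j) = (\<Sum>i\<in>UNIV. C $ i $ j *\<^sub>R case_option u e i)" for j
      by (cases j) (simp_all add: C_def sum_option_UNIV u e)
  qed
  moreover have "trace C = trace B"
    by (simp add: trace_def C_def sum_option_UNIV)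
  ultimately show ?thesis
    using endo_trace_eq[OF basis f] card by simp
qed

section \<open>Derivatives of determinants and of coefficients\<close>

text \<open>
  The product rule in the Leibniz expansion of the determinant, differentiating one row at a time.
\<close>

lemma det_has_derivative_rows:
  fixes M :: "real \<Rightarrow> real^'n^'n"
  assumes "\<And>i j. ((\<lambda>\<tau>. M \<tau> $ i $ j) has_real_derivative M' $ i $ j) (at t)"
  shows "((\<lambda>\<tau>. det (M \<tau>)) has_real_derivative
    (\<Sum>i\<in>UNIV. det (\<chi> k. if k = i then M' $ i else M t $ k))) (at t)"
proof -
  have row: "(\<Prod>k\<in>UNIV. (\<chi> k. if k = i then M' $ i else M t $ k) $ k $ p k)
      = M' $ i $ p i * (\<Prod>k\<in>UNIV - {i}. M t $ k $ p k)" for i and p :: "'n \<Rightarrow> 'n"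
    by (subst prod.remove[of _ i]) (auto intro!: prod.cong)
  have "((\<lambda>\<tau>. det (M \<tau>)) has_real_derivative
     (\<Sum>p\<in>{p. p permutes UNIV}. of_int (sign p) *
        (\<Sum>i\<in>UNIV. M' $ i $ p i * (\<Prod>k\<in>UNIV - {i}. M t $ k $ p k)))) (at t)"
    unfolding det_def
    by (intro DERIV_sum DERIV_cmult has_field_derivative_prod assms)
  also have "(\<Sum>p\<in>{p. p permutes UNIV}. of_int (sign p) *
        (\<Sum>i\<in>UNIV. M' $ i $ p i * (\<Prod>k\<in>UNIV - {i}. M t $ k $ p k)))
     = (\<Sum>i\<in>UNIV. det (\<chi> k. if k = i then M' $ i else M t $ k))"
    unfolding det_def row sum_distrib_left by (rule sum.swap)
  finally show ?thesis .
qed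

text \<open>
  If \<open>M' = B M\<close>, the differentiated \<open>i\<close>-th row is \<open>\<Sum>j. B $ i $ j *s M $ j\<close>; every term
  with \<open>j \<noteq> i\<close> repeats a row of \<open>M\<close> and drops out of the determinant.
\<close>

lemma jacobi_formula:
  fixes M :: "real \<Rightarrow> real^'n^'n"
  assumes "\<And>i j. ((\<lambda>\<tau>. M \<tau> $ i $ j) has_real_derivative (B ** M t) $ i $ j) (at t)"
  shows "((\<lambda>\<tau>. det (M \<tau>)) has_real_derivative trace B * det (M t)) (at t)"
proof -
  have "det (\<chi> k. if k = i then (B ** M t) $ i else M t $ k) = B $ i $ i * det (M t)" for i
  proof -
    have "(B ** M t) $ i = (\<Sum>j\<in>UNIV. B $ i $ j *s M t $ j)"
      by (simp add: vec_eq_iff matrix_matrix_mult_def)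
    then have "det (\<chi> k. if k = i then (B ** M t) $ i else M t $ k)
        = det (\<chi> k. if k = i then \<Sum>j\<in>UNIV. B $ i $ j *s M t $ j else M t $ k)"
      by (rule arg_cong)
    also have "\<dots> = (\<Sum>j\<in>UNIV. B $ i $ j * det (\<chi> k. if k = i then M t $ j else M t $ k))"
      by (simp add: det_linear_row_sum det_row_mul)
    also have "\<dots> = (\<Sum>j\<in>UNIV. if j = i then B $ i $ i * det (M t) else 0)"
    proof (rule sum.cong[OF refl])
      fix j
      show "B $ i $ j * det (\<chi> k. if k = i then M t $ j else M t $ k) = (if j = i then B $ i $ i * det (M t) else 0)"
      proof (cases "j = i")
        case True
        then have "(\<chi> k. if k = i then M t $ j else M t $ k) = M t" by (simp add: vec_eq_iff)
        with True show ?thesis by simp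
      next
        case False
        then have "det (\<chi> k. if k = i then M t $ j else M t $ k) = 0"
          by (intro det_identical_rows[of i j]) (auto simp: row_def vec_eq_iff)
        with False show ?thesis by simp
      qed
    qed
    finally show ?thesis by simp
  qed
  then show ?thesis
    using det_has_derivative_rows[of M "B ** M t" t, OF assms]
    by (simp add: trace_def sum_distrib_right)
qed

text \<open>
  The coefficients of a differentiable curve in a differentiable moving basis are quotients of
  determinants by Cramer's rule.
\<close>

lemma coefficients_differentiable:
  fixes b :: "'j::finite \<Rightarrow> real \<Rightarrow> real^'n" and y :: "real \<Rightarrow> real^'n"
  assumes card: "CARD('j) = CARD('n)" and D: "open D" "t \<in> D"
    and b: "\<And>i. (b i has_vector_derivative b' i) (at t)"
    and y: "(y has_vector_derivative y') (at t)"
    and eq: "\<And>\<tau>. \<tau> \<in> D \<Longrightarrow> y \<tau> = (\<Sum>i\<in>UNIV. x i \<tau> *\<^sub>R b i \<tau>)"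
    and indep: "\<And>\<tau> r i. \<tau> \<in> D \<Longrightarrow> (\<Sum>i\<in>UNIV. r i *\<^sub>R b i \<tau>) = 0 \<Longrightarrow> r i = 0"
  shows "x i differentiable (at t)"
proof -
  obtain \<beta> :: "'n \<Rightarrow> 'j" where \<beta>: "bij \<beta>"
    using card by (metis finite finite_same_card_bij)
  define P :: "real \<Rightarrow> real^'n^'n" where "P \<tau> = (\<chi> i j. b (\<beta> j) \<tau> $ i)" for \<tau>
  have P_mult: "P \<tau> *v v = (\<Sum>i\<in>UNIV. v $ inv \<beta> i *\<^sub>R b i \<tau>)" for \<tau> v
  proof -
    have "P \<tau> *v v = (\<Sum>k\<in>UNIV. v $ k *\<^sub>R b (\<beta> k) \<tau>)"
      by (simp add: vec_eq_iff matrix_vector_mult_def P_def mult.commute)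
    also have "\<dots> = (\<Sum>i\<in>UNIV. v $ inv \<beta> i *\<^sub>R b i \<tau>)"
      using \<beta> by (intro sum.reindex_bij_witness[of _ "inv \<beta>" \<beta>]) (auto simp: bij_is_surj surj_f_inv_f bij_is_inj inv_f_f)
    finally show ?thesis .
  qed
  have det: "det (P \<tau>) \<noteq> 0" if "\<tau> \<in> D" for \<tau>
  proof -
    have "v = 0" if "P \<tau> *v v = 0" for v
    proof -
      have "v $ inv \<beta> (\<beta> k) = 0" for k
        using indep[OF \<open>\<tau> \<in> D\<close>, of "\<lambda>i. v $ inv \<beta> i"] that by (simp add: P_mult)
      then show ?thesis using \<beta> by (simp add: vec_eq_iff bij_is_inj inv_f_f)
    qed
    then show ?thesis
      by (metis invertible_det_nz invertible_left_inverse matrix_left_invertible_ker)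
  qed
  define k where "k = inv \<beta> i"
  have k: "\<beta> k = i" using \<beta> by (simp add: k_def bij_is_surj surj_f_inv_f)
  define Q :: "real \<Rightarrow> real^'n^'n" where "Q \<tau> = (\<chi> i j. if j = k then y \<tau> $ i else P \<tau> $ i $ j)" for \<tau>
  have x: "x i \<tau> = det (Q \<tau>) / det (P \<tau>)" if "\<tau> \<in> D" for \<tau>
  proof -
    have "P \<tau> *v (\<chi> k. x (\<beta> k) \<tau>) = y \<tau>"
      using \<beta> by (simp add: P_mult eq[OF that] bij_is_surj surj_f_inv_f)
    then have "(\<chi> k. x (\<beta> k) \<tau>) $ k = det (Q \<tau>) / det (P \<tau>)"
      unfolding cramer[OF det[OF that]] Q_def by simp
    then show ?thesis using k by simp
  qed
  have comp: "((\<lambda>\<tau>. z \<tau> $ i) has_real_derivative z' $ i) (at t)" 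
    if "(z has_vector_derivative z') (at t)" for z :: "real \<Rightarrow> real^'n" and z' i
    using bounded_linear.has_vector_derivative[OF bounded_linear_vec_nth that]
    by (simp add: has_real_derivative_iff_has_vector_derivative)
  have "((\<lambda>\<tau>. P \<tau> $ i $ j) has_real_derivative (\<chi> i j. b' (\<beta> j) $ i) $ i $ j) (at t)" for i j
    using comp[OF b] by (simp add: P_def)
  note dP = det_has_derivative_rows[OF this]
  have "((\<lambda>\<tau>. Q \<tau> $ i $ j) has_real_derivative
      (\<chi> i j. if j = k then y' $ i else b' (\<beta> j) $ i) $ i $ j) (at t)" for i j
    using comp[OF b] comp[OF y] by (simp add: Q_def P_def)
  note dQ = det_has_derivative_rows[OF this]
  from DERIV_divide[OF dQ dP det[OF D(2)]]
  obtain x' where "((\<lambda>\<tau>. det (Q \<tau>) / det (P \<tau>)) has_real_derivative x') (at t)" by blast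
  then have "(x i has_real_derivative x') (at t)"
    by (rule has_field_derivative_transform_within_open[OF _ D]) (simp add: x)
  then show ?thesis by (auto simp: has_field_derivative_def differentiable_def)
qed

section \<open>Independent families of full size\<close>

text \<open>
  As many independent vectors as a spanning family has members span the same space. The exchange
  lemma gives this also where the ambient space has no finite dimension, as for \<^typ>\<open>('p, 'e) tvec\<close>.
\<close>

lemma independent_family_basis_of_span:
  fixes e f :: "'k::finite \<Rightarrow> 'v::real_vector"
  assumes mem: "\<And>a. f a \<in> span (range e)"
    and indep: "\<And>x a. (\<Sum>a\<in>UNIV. x a *\<^sub>R f a) = 0 \<Longrightarrow> x a = 0"
  shows "basis_of f (span (range e))"
proof (rule basis_ofI)
  have f: "basis_of f (span (range f))" by (rule basis_ofI) (use indep in auto)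
  then have f: "inj f" "independent (range f)" by (auto simp: basis_of_def)
  show "span (range f) = span (range e)"
  proof (rule ccontr)
    assume "span (range f) \<noteq> span (range e)"
    moreover have "span (range f) \<subseteq> span (range e)" using mem by (intro span_minimal) auto
    ultimately obtain w where w: "w \<in> span (range e)" "w \<notin> span (range f)" by auto
    then have "independent (insert w (range f))" using f(2) by (simp add: independent_insert)
    from independent_span_bound[OF _ this, of "range e"]
    have "card (insert w (range f)) \<le> card (range e)" using w mem by auto
    moreover have "w \<notin> range f" using w(2) by (auto intro: span_base)
    moreover have "card (range e) \<le> CARD('k)" by (rule card_image_le) simp
    ultimately show False using f(1) by (simp add: card_image)
  qed
qed (use indep in auto)

lemma independent_family_basis_of_UNIV:
  fixes b :: "'j::finite \<Rightarrow> 'e::euclidean_space"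
  assumes card: "CARD('j) = DIM('e)"
    and indep: "\<And>x i. (\<Sum>i\<in>UNIV. x i *\<^sub>R b i) = 0 \<Longrightarrow> x i = 0"
  shows "basis_of b UNIV"
proof (rule basis_ofI)
  have "basis_of b (span (range b))" by (rule basis_ofI) (use indep in auto)
  then have b: "inj b" "independent (range b)" by (auto simp: basis_of_def)
  have "UNIV \<subseteq> span (range b)"
    by (rule card_ge_dim_independent) (use b card in \<open>auto simp: card_image\<close>)
  then show "span (range b) = UNIV" by auto
qed (use indep in auto)

section \<open>Tangent vectors in coordinates\<close>

locale smooth_atlas =
  fixes A :: "('m::{t2_space, second_countable_topology}, 'e::euclidean_space) chart set"
  assumes manifold: "smooth_manifold A"
begin

lemma charts_atD: "\<phi> \<in> charts_at A p \<Longrightarrow> \<phi> \<in> A" "\<phi> \<in> charts_at A p \<Longrightarrow> p \<in> fst \<phi>"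
  by (auto simp: charts_at_def)

lemma charts_at_mem: "\<phi> \<in> A \<Longrightarrow> p \<in> fst \<phi> \<Longrightarrow> \<phi> \<in> charts_at A p"
  by (simp add: charts_at_def)

lemma charts_at_nonempty: "\<exists>\<phi>. \<phi> \<in> charts_at A p"
proof -
  have "p \<in> (\<Union>\<phi>\<in>A. fst \<phi>)" using manifold by (simp add: smooth_manifold_def)
  then show ?thesis unfolding charts_at_def by blast
qed

lemma chart_homeomorphism:
  assumes "\<phi> \<in> A"
  shows "open (fst \<phi>)" "open (snd \<phi> ` fst \<phi>)"
    "homeomorphism (fst \<phi>) (snd \<phi> ` fst \<phi>) (snd \<phi>) (chart_inv \<phi>)"
  using manifold assms by (auto simp: smooth_manifold_def)

lemma chart_inv_chart: "\<phi> \<in> A \<Longrightarrow> p \<in> fst \<phi> \<Longrightarrow> chart_inv \<phi> (snd \<phi> p) = p"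
  using chart_homeomorphism(3) by (auto simp: homeomorphism_def)

lemma open_chart_image:
  assumes "\<phi> \<in> A" "open U"
  shows "open (snd \<phi> ` (fst \<phi> \<inter> U))"
proof -
  note h = chart_homeomorphism[OF assms(1)]
  have "snd \<phi> ` (fst \<phi> \<inter> U) = snd \<phi> ` fst \<phi> \<inter> chart_inv \<phi> -` U"
    using chart_inv_chart[OF assms(1)] by force
  moreover have "continuous_on (snd \<phi> ` fst \<phi>) (chart_inv \<phi>)"
    using h(3) by (simp add: homeomorphism_def)
  ultimately show ?thesis
    using continuous_open_preimage[OF _ h(2) assms(2)] by simp
qed

lemma transition_smooth:
  "\<phi> \<in> A \<Longrightarrow> \<psi> \<in> A \<Longrightarrow> smooth_on (snd \<phi> ` (fst \<phi> \<inter> fst \<psi>)) (snd \<psi> \<circ> chart_inv \<phi>)"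
  using manifold by (auto simp: smooth_manifold_def)

abbreviation dtransition :: "('m, 'e) chart \<Rightarrow> ('m, 'e) chart \<Rightarrow> 'm \<Rightarrow> 'e \<Rightarrow> 'e" where
  "dtransition \<phi> \<psi> p \<equiv> frechet_derivative (snd \<psi> \<circ> chart_inv \<phi>) (at (snd \<phi> p))"

lemma transition_has_derivative:
  assumes "\<phi> \<in> charts_at A p" "\<psi> \<in> charts_at A p"
  shows "((snd \<psi> \<circ> chart_inv \<phi>) has_derivative dtransition \<phi> \<psi> p) (at (snd \<phi> p))"
  using assms by (intro smooth_onD[OF transition_smooth]) (auto dest: charts_atD)

lemma linear_transition:
  "\<phi> \<in> charts_at A p \<Longrightarrow> \<psi> \<in> charts_at A p \<Longrightarrow> linear (dtransition \<phi> \<psi> p)"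
  using transition_has_derivative has_derivative_linear by blast

text \<open>
  Chain rule for \<open>h \<circ> chart_inv \<phi> = (h \<circ> chart_inv \<psi>) \<circ> (snd \<psi> \<circ> chart_inv \<phi>)\<close> near the point.
  It gives the cocycle identity for transition maps and frees \<^const>\<open>tangent_map\<close>, which fixes one
  chart by choice, from that choice.
\<close>

lemma change_of_chart_has_derivative:
  assumes \<phi>: "\<phi> \<in> charts_at A p" and \<psi>: "\<psi> \<in> charts_at A p"
    and h: "(h \<circ> chart_inv \<psi> has_derivative h') (at (snd \<psi> p))"
  shows "(h \<circ> chart_inv \<phi> has_derivative h' \<circ> dtransition \<phi> \<psi> p) (at (snd \<phi> p))"
proof -
  note A = charts_atD[OF \<phi>] charts_atD[OF \<psi>]
  have "(snd \<psi> \<circ> chart_inv \<phi>) (snd \<phi> p) = snd \<psi> p"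
    using A by (simp add: chart_inv_chart)
  then have "((h \<circ> chart_inv \<psi>) \<circ> (snd \<psi> \<circ> chart_inv \<phi>) has_derivative h' \<circ> dtransition \<phi> \<psi> p)
      (at (snd \<phi> p))"
    using h by (intro diff_chain_at transition_has_derivative[OF \<phi> \<psi>]) simp
  then show ?thesis
  proof (rule has_derivative_transform_within_open)
    show "open (snd \<phi> ` (fst \<phi> \<inter> fst \<psi>))"
      using A by (intro open_chart_image chart_homeomorphism)
  qed (use A in \<open>auto simp: chart_inv_chart\<close>)
qed

lemma transition_refl:
  assumes \<phi>: "\<phi> \<in> charts_at A p"
  shows "dtransition \<phi> \<phi> p y = y"
proof -
  note A = charts_atD[OF \<phi>]
  have "((\<lambda>x. x) has_derivative (\<lambda>y. y)) (at (snd \<phi> p))" by (rule has_derivative_ident)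
  then have "(snd \<phi> \<circ> chart_inv \<phi> has_derivative (\<lambda>y. y)) (at (snd \<phi> p))"
    by (rule has_derivative_transform_within_open[OF _ chart_homeomorphism(2)[OF A(1)]])
      (use A in \<open>auto simp: chart_inv_chart\<close>)
  from fun_cong[OF frechet_derivative_at[OF this], of y] show ?thesis by simp
qed

lemma transition_cocycle:
  assumes "\<phi> \<in> charts_at A p" "\<psi> \<in> charts_at A p" "\<rho> \<in> charts_at A p"
  shows "dtransition \<psi> \<rho> p (dtransition \<phi> \<psi> p y) = dtransition \<phi> \<rho> p y"
proof -
  have "dtransition \<psi> \<rho> p \<circ> dtransition \<phi> \<psi> p = dtransition \<phi> \<rho> p"
    by (intro frechet_derivative_at change_of_chart_has_derivative transition_has_derivative assms)
  from fun_cong[OF this, of y] show ?thesis by simp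
qed

lemma tangent_space_transition:
  "v \<in> tangent_space A p \<Longrightarrow> \<phi> \<in> charts_at A p \<Longrightarrow> \<psi> \<in> charts_at A p \<Longrightarrow>
    v \<psi> = dtransition \<phi> \<psi> p (v \<phi>)"
  unfolding tangent_space_def by blast

lemma tangent_space_outside:
  "v \<in> tangent_space A p \<Longrightarrow> \<phi> \<notin> charts_at A p \<Longrightarrow> v \<phi> = 0"
  by (simp add: tangent_space_def del: split_paired_All)

text \<open>
  A tangent vector is determined by its components in a single chart. Identities between tangent
  vectors are therefore proved in coordinates.
\<close>

lemma tangent_space_eqI:
  assumes "v \<in> tangent_space A p" "w \<in> tangent_space A p" "\<phi> \<in> charts_at A p" "v \<phi> = w \<phi>"
  shows "v = w"
proof
  fix \<psi>
  show "v \<psi> = w \<psi>"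
    using tangent_space_transition[OF assms(1,3), of \<psi>] tangent_space_transition[OF assms(2,3), of \<psi>]
      tangent_space_outside[OF assms(1), of \<psi>] tangent_space_outside[OF assms(2), of \<psi>] assms(4)
    by (cases "\<psi> \<in> charts_at A p") auto
qed

lemma tangent_spaceI:
  assumes "\<And>\<phi> \<psi>. \<phi> \<in> charts_at A p \<Longrightarrow> \<psi> \<in> charts_at A p \<Longrightarrow> v \<psi> = dtransition \<phi> \<psi> p (v \<phi>)"
    and "\<And>\<phi>. \<phi> \<notin> charts_at A p \<Longrightarrow> v \<phi> = 0"
  shows "v \<in> tangent_space A p"
  unfolding tangent_space_def using assms by blast

lemma subspace_tangent_space: "subspace (tangent_space A p)"
proof (rule subspaceI)
  show "0 \<in> tangent_space A p"
    by (rule tangent_spaceI) (simp_all add: linear_0[OF linear_transition])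
  show "v + w \<in> tangent_space A p" if "v \<in> tangent_space A p" "w \<in> tangent_space A p" for v w
  proof (rule tangent_spaceI)
    show "(v + w) \<psi> = dtransition \<phi> \<psi> p ((v + w) \<phi>)"
      if "\<phi> \<in> charts_at A p" "\<psi> \<in> charts_at A p" for \<phi> \<psi>
      using tangent_space_transition[OF \<open>v \<in> _\<close> that] tangent_space_transition[OF \<open>w \<in> _\<close> that]
      by (simp add: linear_add[OF linear_transition[OF that]])
  qed (use that in \<open>simp add: tangent_space_outside[where p = p]\<close>)
  show "r *\<^sub>R v \<in> tangent_space A p" if "v \<in> tangent_space A p" for r v
  proof (rule tangent_spaceI)
    show "(r *\<^sub>R v) \<psi> = dtransition \<phi> \<psi> p ((r *\<^sub>R v) \<phi>)"
      if "\<phi> \<in> charts_at A p" "\<psi> \<in> charts_at A p" for \<phi> \<psi>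
      using tangent_space_transition[OF \<open>v \<in> _\<close> that]
      by (simp add: linear_cmul[OF linear_transition[OF that]])
  qed (use that in \<open>simp add: tangent_space_outside[where p = p]\<close>)
qed

text \<open>
  The transition law for the components of \<^const>\<open>coord_vec\<close> is the cocycle identity.
\<close>

lemma coord_vec_tangent: "\<phi> \<in> charts_at A p \<Longrightarrow> coord_vec A \<phi> p y \<in> tangent_space A p"
  by (rule tangent_spaceI) (simp_all add: coord_vec_def transition_cocycle)

lemma coord_vec_self: "\<phi> \<in> charts_at A p \<Longrightarrow> coord_vec A \<phi> p y \<phi> = y"
  by (simp add: coord_vec_def transition_refl)

lemma coord_vec_component:
  "\<phi> \<in> charts_at A p \<Longrightarrow> v \<in> tangent_space A p \<Longrightarrow> coord_vec A \<phi> p (v \<phi>) = v"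
  by (rule tangent_space_eqI[where \<phi> = \<phi>]) (simp_all add: coord_vec_tangent coord_vec_self)

lemma euclidean_chart [simp]: "chart_inv (UNIV, \<lambda>x. x) = (\<lambda>x. x)"
  using inv_into_f_f[of "\<lambda>x. x" UNIV] by (simp add: chart_inv_def fun_eq_iff)

lemma smooth_map_from_euclidean:
  assumes "smooth_map_on euclidean_atlas A D f" "\<phi> \<in> A"
  shows "open (D \<inter> f -` fst \<phi>)" "smooth_on (D \<inter> f -` fst \<phi>) (\<lambda>z. snd \<phi> (f z))"
proof -
  have "(UNIV, \<lambda>x. x) \<in> euclidean_atlas" by (simp add: euclidean_atlas_def)
  note * = bspec[OF bspec[OF assms(1)[unfolded smooth_map_on_def, THEN conjunct2, THEN conjunct2] this]
      assms(2)]
  from * show "open (D \<inter> f -` fst \<phi>)" by simp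
  from * show "smooth_on (D \<inter> f -` fst \<phi>) (\<lambda>z. snd \<phi> (f z))" by (simp add: o_def)
qed

lemma smooth_curve_velocity:
  assumes c: "smooth_map_on euclidean_atlas A I c" and t: "t \<in> I" and \<phi>: "\<phi> \<in> charts_at A (c t)"
  shows "((\<lambda>\<tau>. snd \<phi> (c \<tau>)) has_vector_derivative snd (velocity A c t) \<phi>) (at t)"
    and "snd (velocity A c t) \<phi> = frechet_derivative (\<lambda>\<tau>. snd \<phi> (c \<tau>)) (at t) 1"
proof -
  have "t \<in> I \<inter> c -` fst \<phi>" using t charts_atD(2)[OF \<phi>] by auto
  from smooth_onD[OF smooth_map_from_euclidean(2)[OF c charts_atD(1)[OF \<phi>]] this]
  have d: "(\<lambda>\<tau>. snd \<phi> (c \<tau>)) differentiable (at t)" by (auto simp: differentiable_def)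
  with \<phi> show 1: "((\<lambda>\<tau>. snd \<phi> (c \<tau>)) has_vector_derivative snd (velocity A c t) \<phi>) (at t)"
    by (simp add: velocity_def o_def vector_derivative_works)
  show "snd (velocity A c t) \<phi> = frechet_derivative (\<lambda>\<tau>. snd \<phi> (c \<tau>)) (at t) 1"
    using frechet_derivative_eq_vector_derivative[OF d] \<phi> by (simp add: velocity_def o_def)
qed

lemma velocity_tangent:
  assumes c: "smooth_map_on euclidean_atlas A I c" and t: "t \<in> I"
  shows "snd (velocity A c t) \<in> tangent_space A (c t)"
proof -
  have "snd (velocity A c t) \<psi> = dtransition \<phi> \<psi> (c t) (snd (velocity A c t) \<phi>)"
    if \<phi>: "\<phi> \<in> charts_at A (c t)" and \<psi>: "\<psi> \<in> charts_at A (c t)" for \<phi> \<psi>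
  proof -
    note A = charts_atD[OF \<phi>] charts_atD[OF \<psi>]
    have "((snd \<psi> \<circ> chart_inv \<phi>) \<circ> (\<lambda>\<tau>. snd \<phi> (c \<tau>)) has_derivative
        dtransition \<phi> \<psi> (c t) \<circ> (\<lambda>r. r *\<^sub>R snd (velocity A c t) \<phi>)) (at t)"
      using smooth_curve_velocity(1)[OF c t \<phi>] unfolding has_vector_derivative_def
      by (intro diff_chain_at transition_has_derivative[OF \<phi> \<psi>])
    then have "((\<lambda>\<tau>. snd \<psi> (c \<tau>)) has_derivative
        dtransition \<phi> \<psi> (c t) \<circ> (\<lambda>r. r *\<^sub>R snd (velocity A c t) \<phi>)) (at t)"
      by (rule has_derivative_transform_within_open[OF _ smooth_map_from_euclidean(1)[OF c A(1)]])
        (use t A in \<open>auto simp: chart_inv_chart\<close>)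
    with smooth_curve_velocity(1)[OF c t \<psi>]
    have "(\<lambda>r. r *\<^sub>R snd (velocity A c t) \<psi>)
        = dtransition \<phi> \<psi> (c t) \<circ> (\<lambda>r. r *\<^sub>R snd (velocity A c t) \<phi>)"
      unfolding has_vector_derivative_def by (rule has_derivative_unique)
    from fun_cong[OF this, of 1] show ?thesis by simp
  qed
  moreover have "snd (velocity A c t) \<psi> = 0" if "\<psi> \<notin> charts_at A (c t)" for \<psi>
    using that by (simp add: velocity_def)
  ultimately show ?thesis by (intro tangent_spaceI)
qed

end

section \<open>The coefficients of a spray\<close>

locale spray_atlas = smooth_atlas A
  for A :: "('m::{t2_space, second_countable_topology}, 'e::euclidean_space) chart set" +
  fixes S :: "('m, 'e) tslit_field"
  assumes spray: "spray A S"
begin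

text \<open>
  The image of an induced chart of the bundle of nonzero tangent vectors.
\<close>

definition slit_domain :: "('m, 'e) chart \<Rightarrow> ('e \<times> 'e) set" where
  "slit_domain \<phi> = (snd \<phi> ` fst \<phi>) \<times> (- {0})"

lemma open_slit_domain: "\<phi> \<in> A \<Longrightarrow> open (slit_domain \<phi>)"
  unfolding slit_domain_def by (intro open_Times chart_homeomorphism) auto

lemma slit_chart_at:
  assumes "\<phi> \<in> charts_at A p" "v \<in> tangent_space A p" "v \<noteq> 0"
  shows "slit_chart A \<phi> \<in> charts_at (slit_atlas A) (p, v)"
proof -
  have "slit_chart A \<phi> \<in> slit_atlas A"
    using assms(1) unfolding slit_atlas_def by (intro imageI) (rule charts_atD)
  moreover have "(p, v) \<in> fst (slit_chart A \<phi>)"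
    using assms by (simp add: slit_chart_def charts_atD)
  ultimately show ?thesis by (simp add: charts_at_def)
qed

lemma component_nonzero:
  assumes "\<phi> \<in> charts_at A p" "v \<in> tangent_space A p" "v \<noteq> 0"
  shows "v \<phi> \<noteq> 0"
proof
  assume "v \<phi> = 0"
  then have "v = 0"
    by (intro tangent_space_eqI[OF assms(2) subspace_0[OF subspace_tangent_space] assms(1)]) simp
  with assms(3) show False by simp
qed

lemma slit_coordinates_in_domain:
  assumes "\<phi> \<in> charts_at A p" "v \<in> tangent_space A p" "v \<noteq> 0"
  shows "(snd \<phi> p, v \<phi>) \<in> slit_domain \<phi>"
  using component_nonzero[OF assms] charts_atD[OF assms(1)] by (auto simp: slit_domain_def)

lemma slit_chart_inv:
  assumes "\<phi> \<in> charts_at A p" "v \<in> tangent_space A p" "v \<noteq> 0"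
  shows "chart_inv (slit_chart A \<phi>) (snd \<phi> p, v \<phi>) = (p, v)"
proof -
  note A = charts_atD[OF assms(1)]
  have "inj_on (snd (slit_chart A \<phi>)) (fst (slit_chart A \<phi>))"
  proof (rule inj_onI)
    fix u u' assume "u \<in> fst (slit_chart A \<phi>)" "u' \<in> fst (slit_chart A \<phi>)"
      and eq: "snd (slit_chart A \<phi>) u = snd (slit_chart A \<phi>) u'"
    then obtain p v p' v' where u: "u = (p, v)" "p \<in> fst \<phi>" "v \<in> tangent_space A p"
      and u': "u' = (p', v')" "p' \<in> fst \<phi>" "v' \<in> tangent_space A p'"
      unfolding slit_chart_def by auto
    have coords: "snd \<phi> p = snd \<phi> p'" "v \<phi> = v' \<phi>"
      using eq by (simp_all add: slit_chart_def u(1) u'(1))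
    have p: "p = p'"
      using chart_inv_chart[OF A(1) u(2)] chart_inv_chart[OF A(1) u'(2)] coords(1) by metis
    have "v = v'"
      by (rule tangent_space_eqI[OF u(3) u'(3)[folded p] charts_at_mem[OF A(1) u(2)] coords(2)])
    with p show "u = u'" by (simp add: u(1) u'(1))
  qed
  moreover have "(p, v) \<in> fst (slit_chart A \<phi>)"
    using assms A by (simp add: slit_chart_def)
  ultimately have "chart_inv (slit_chart A \<phi>) (snd (slit_chart A \<phi>) (p, v)) = (p, v)"
    unfolding chart_inv_def by (rule inv_into_f_f)
  then show ?thesis by (simp add: slit_chart_def)
qed

text \<open>
  Every point of the coordinate domain comes from a nonzero tangent vector, namely from the one that
  \<^const>\<open>coord_vec\<close> builds.
\<close>

lemma slit_domainE:
  assumes "\<phi> \<in> A" "z \<in> slit_domain \<phi>"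
  obtains p v where "\<phi> \<in> charts_at A p" "v \<in> tangent_space A p" "v \<noteq> 0" "z = (snd \<phi> p, v \<phi>)"
proof -
  obtain p y where z: "z = (snd \<phi> p, y)" "p \<in> fst \<phi>" "y \<noteq> 0"
    using assms(2) by (auto simp: slit_domain_def)
  have \<phi>: "\<phi> \<in> charts_at A p" using assms(1) z by (simp add: charts_at_def)
  show ?thesis
  proof (rule that[OF \<phi> coord_vec_tangent[OF \<phi>, of y]])
    show "coord_vec A \<phi> p y \<noteq> 0" using coord_vec_self[OF \<phi>, of y] z(3) by auto
  qed (simp add: coord_vec_self[OF \<phi>] z(1))
qed

lemma slit_chart_image: "\<phi> \<in> A \<Longrightarrow> snd (slit_chart A \<phi>) ` fst (slit_chart A \<phi>) = slit_domain \<phi>"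
proof (intro equalityI subsetI)
  assume \<phi>: "\<phi> \<in> A"
  fix z
  assume "z \<in> snd (slit_chart A \<phi>) ` fst (slit_chart A \<phi>)"
  then show "z \<in> slit_domain \<phi>"
    by (auto simp: slit_chart_def intro!: slit_coordinates_in_domain charts_at_mem[OF \<phi>])
next
  assume \<phi>: "\<phi> \<in> A"
  fix z
  assume "z \<in> slit_domain \<phi>"
  from slit_domainE[OF \<phi> this] obtain p v
    where *: "\<phi> \<in> charts_at A p" "v \<in> tangent_space A p" "v \<noteq> 0" "z = (snd \<phi> p, v \<phi>)" .
  then have "(p, v) \<in> fst (slit_chart A \<phi>)" "z = snd (slit_chart A \<phi>) (p, v)"
    by (auto simp: slit_chart_def charts_at_def)
  then show "z \<in> snd (slit_chart A \<phi>) ` fst (slit_chart A \<phi>)" by blast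
qed

lemma spray_components_smooth:
  assumes "\<phi> \<in> A"
  shows "smooth_on (slit_domain \<phi>) (\<lambda>z. snd (S (chart_inv (slit_chart A \<phi>) z)) (slit_chart A \<phi>))"
proof -
  have "vector_field (slit_atlas A) S" using spray by (simp add: spray_def semispray_def)
  moreover have "slit_chart A \<phi> \<in> slit_atlas A" using assms by (simp add: slit_atlas_def)
  ultimately show ?thesis
    unfolding slit_chart_image[OF assms, symmetric] vector_field_def by blast
qed

lemma spray_coeff_smooth:
  assumes "\<phi> \<in> A"
  shows "smooth_on (slit_domain \<phi>) (spray_coeff A S \<phi>)"
proof -
  have "bounded_linear (\<lambda>z :: 'e \<times> 'e. - (1/2) *\<^sub>R snd z)"
    by (intro bounded_linear_const_scaleR bounded_linear_snd)
  from smooth_on_bounded_linear[OF open_slit_domain[OF assms] this spray_components_smooth[OF assms]]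
  show ?thesis unfolding spray_coeff_def[abs_def] .
qed

text \<open>
  In induced coordinates \<open>S = (y, - 2 G)\<close> and \<open>\<complex> = (0, y)\<close> for the Liouville field \<open>\<complex>\<close>. The second
  component of \<open>[\<complex>, S] = S\<close> reads \<open>- 2 dG(0, y) + 2 G = - 2 G\<close>, which is Euler's identity for a
  \<open>2\<close>-homogeneous \<open>G\<close>.
\<close>

lemma spray_coeff_euler:
  assumes \<phi>: "\<phi> \<in> charts_at A p" and v: "v \<in> tangent_space A p" "v \<noteq> 0"
  shows "frechet_derivative (spray_coeff A S \<phi>) (at (snd \<phi> p, v \<phi>)) (0, v \<phi>)
    = 2 *\<^sub>R spray_coeff A S \<phi> (snd \<phi> p, v \<phi>)"
proof -
  let ?\<Psi> = "slit_chart A \<phi>" and ?z = "(snd \<phi> p, v \<phi>)"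
  let ?S = "\<lambda>z. snd (S (chart_inv ?\<Psi> z)) ?\<Psi>"
  note A = charts_atD[OF \<phi>]
  note z = slit_coordinates_in_domain[OF \<phi> v]
  note \<Psi> = slit_chart_at[OF \<phi> v]
  have dS: "(?S has_derivative frechet_derivative ?S (at ?z)) (at ?z)"
    by (rule smooth_onD[OF spray_components_smooth[OF A(1)] z])
  have "((\<lambda>z. (0, snd z)) has_derivative (\<lambda>w :: 'e \<times> 'e. (0 :: 'e, snd w))) (at ?z)"
    by (intro derivative_intros has_derivative_snd has_derivative_ident)
  then have "((\<lambda>z. snd (liouville A (chart_inv ?\<Psi> z)) ?\<Psi>) has_derivative (\<lambda>w. (0, snd w))) (at ?z)"
  proof (rule has_derivative_transform_within_open[OF _ open_slit_domain[OF A(1)] z])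
    fix z assume "z \<in> slit_domain \<phi>"
    from slit_domainE[OF A(1) this] obtain q w
      where *: "\<phi> \<in> charts_at A q" "w \<in> tangent_space A q" "w \<noteq> 0" "z = (snd \<phi> q, w \<phi>)" .
    show "(0, snd z) = snd (liouville A (chart_inv ?\<Psi> z)) ?\<Psi>"
      using slit_chart_inv[OF *(1-3)] slit_chart_at[OF *(1-3)] *(4)
      by (simp add: liouville_def) (simp add: slit_chart_def)
  qed
  from frechet_derivative_at[OF this]
  have dC: "frechet_derivative (\<lambda>z. snd (liouville A (chart_inv ?\<Psi> z)) ?\<Psi>) (at ?z) = (\<lambda>w. (0, snd w))"
    by simp
  have "lie_bracket (slit_atlas A) (liouville A) S (p, v) = S (p, v)"
    using spray \<Psi> unfolding spray_def carrier_def charts_at_def by blast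
  then have "snd (lie_bracket (slit_atlas A) (liouville A) S (p, v)) ?\<Psi> = snd (S (p, v)) ?\<Psi>"
    by simp
  moreover have coords: "snd ?\<Psi> (p, v) = ?z" by (simp add: slit_chart_def)
  have "snd (lie_bracket (slit_atlas A) (liouville A) S (p, v)) ?\<Psi>
      = frechet_derivative ?S (at ?z) (snd (liouville A (p, v)) ?\<Psi>)
        - frechet_derivative (\<lambda>z. snd (liouville A (chart_inv ?\<Psi> z)) ?\<Psi>) (at ?z) (snd (S (p, v)) ?\<Psi>)"
    using \<Psi> by (simp add: lie_bracket_def coords)
  moreover have "snd (liouville A (p, v)) ?\<Psi> = (0, v \<phi>)"
    using \<Psi> by (simp add: liouville_def coords)
  ultimately have "frechet_derivative ?S (at ?z) (0, v \<phi>) - (0, snd (snd (S (p, v)) ?\<Psi>)) = snd (S (p, v)) ?\<Psi>"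
    by (simp add: dC)
  then have "snd (frechet_derivative ?S (at ?z) (0, v \<phi>)) = 2 *\<^sub>R snd (snd (S (p, v)) ?\<Psi>)"
    by (metis (no_types, lifting) add_diff_cancel_left' diff_add_cancel scaleR_2 snd_conv snd_diff)
  moreover have "(spray_coeff A S \<phi> has_derivative (\<lambda>w. - (1/2) *\<^sub>R snd (frechet_derivative ?S (at ?z) w))) (at ?z)"
    unfolding spray_coeff_def[abs_def]
    by (intro has_derivative_scaleR_right has_derivative_snd dS)
  ultimately show ?thesis
    using slit_chart_inv[OF \<phi> v] by (simp add: frechet_derivative_at[symmetric] spray_coeff_def)
qed

lemma nonlin_conn_eq:
  assumes \<phi>: "\<phi> \<in> charts_at A p" and v: "v \<in> tangent_space A p" "v \<noteq> 0"
  shows "nonlin_conn A S \<phi> (p, v) X = frechet_derivative (spray_coeff A S \<phi>) (at (snd \<phi> p, v \<phi>)) (0, X)"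
proof -
  note d = smooth_onD[OF spray_coeff_smooth[OF charts_atD(1)[OF \<phi>]] slit_coordinates_in_domain[OF \<phi> v]]
  have "((\<lambda>y. (snd \<phi> p, y)) has_derivative (\<lambda>y. (0, y))) (at (v \<phi>))"
    by (auto intro!: derivative_eq_intros)
  from diff_chain_at[OF this d] show ?thesis
    by (simp add: nonlin_conn_def o_def frechet_derivative_at[symmetric])
qed

lemma linear_nonlin_conn:
  assumes \<phi>: "\<phi> \<in> charts_at A p" and v: "v \<in> tangent_space A p" "v \<noteq> 0"
  shows "linear (nonlin_conn A S \<phi> (p, v))"
proof -
  have "linear (frechet_derivative (spray_coeff A S \<phi>) (at (snd \<phi> p, v \<phi>)))"
    using smooth_onD[OF spray_coeff_smooth[OF charts_atD(1)[OF \<phi>]] slit_coordinates_in_domain[OF \<phi> v]]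
      has_derivative_linear by blast
  from linear_compose[OF _ this, of "\<lambda>X. (0, X)"] show ?thesis
    unfolding nonlin_conn_eq[OF assms, abs_def] o_def by (simp add: linear_iff)
qed

end

section \<open>Parallel vector fields along a geodesic\<close>

locale spray_geodesic = spray_atlas A S
  for A :: "('m::{t2_space, second_countable_topology}, 'e::euclidean_space) chart set"
    and S :: "('m, 'e) tslit_field" +
  fixes I :: "real set" and c :: "real \<Rightarrow> 'm"
  assumes open_I: "open I" and interval_I: "is_interval I" and geodesic_c: "geodesic A S I c"
begin

lemma smooth_c: "smooth_map_on euclidean_atlas A I c"
  using geodesic_c by (simp add: geodesic_def)

lemma velocity_nonzero: "t \<in> I \<Longrightarrow> snd (velocity A c t) \<noteq> 0"
  using geodesic_c by (simp add: geodesic_def)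

lemma fst_velocity [simp]: "fst (velocity A \<gamma> t) = \<gamma> t"
  by (simp add: velocity_def)

abbreviation conn :: "('m, 'e) chart \<Rightarrow> real \<Rightarrow> 'e \<Rightarrow> 'e" where
  "conn \<phi> t \<equiv> nonlin_conn A S \<phi> (velocity A c t)"

lemma velocity_pair: "velocity A c t = (c t, snd (velocity A c t))"
  by (simp add: prod_eq_iff)

lemma linear_conn:
  assumes "t \<in> I" "\<phi> \<in> charts_at A (c t)"
  shows "linear (conn \<phi> t)"
  by (subst velocity_pair) (intro linear_nonlin_conn assms velocity_tangent[OF smooth_c] velocity_nonzero)

lemma conn_eq:
  assumes "t \<in> I" "\<phi> \<in> charts_at A (c t)"
  shows "conn \<phi> t X = frechet_derivative (spray_coeff A S \<phi>)
     (at (snd \<phi> (c t), snd (velocity A c t) \<phi>)) (0, X)"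
  by (subst velocity_pair) (intro nonlin_conn_eq assms velocity_tangent[OF smooth_c] velocity_nonzero)

lemma open_chart_domain: "\<phi> \<in> A \<Longrightarrow> open (I \<inter> c -` fst \<phi>)"
  by (rule smooth_map_from_euclidean(1)[OF smooth_c])

lemma velocity_smooth:
  assumes "\<phi> \<in> A"
  shows "smooth_on (I \<inter> c -` fst \<phi>) (\<lambda>t. snd (velocity A c t) \<phi>)"
proof (rule smooth_on_cong[OF open_chart_domain[OF assms]])
  show "smooth_on (I \<inter> c -` fst \<phi>) (\<lambda>t. frechet_derivative (\<lambda>\<tau>. snd \<phi> (c \<tau>)) (at t) 1)"
    by (intro smooth_on_frechet_derivative smooth_map_from_euclidean(2)[OF smooth_c assms])
  show "frechet_derivative (\<lambda>\<tau>. snd \<phi> (c \<tau>)) (at t) 1 = snd (velocity A c t) \<phi>"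
    if "t \<in> I \<inter> c -` fst \<phi>" for t
    using that assms by (intro smooth_curve_velocity(2)[OF smooth_c, symmetric]) (auto simp: charts_at_def)
qed

text \<open>
  The coefficients \<open>N\<close> are first derivatives of the smooth \<open>G\<close>, evaluated along the smooth curve
  \<open>c'\<close> in the induced coordinates.
\<close>

lemma conn_smooth:
  assumes "\<phi> \<in> A"
  shows "smooth_on (I \<inter> c -` fst \<phi>) (\<lambda>t. conn \<phi> t y)"
proof (rule smooth_on_cong[OF open_chart_domain[OF assms]])
  show "smooth_on (I \<inter> c -` fst \<phi>) (\<lambda>t. frechet_derivative (spray_coeff A S \<phi>)
     (at (snd \<phi> (c t), snd (velocity A c t) \<phi>)) (0, y))"
  proof (rule smooth_on_compose[OF open_chart_domain[OF assms],
        where g = "\<lambda>z. frechet_derivative (spray_coeff A S \<phi>) (at z) (0, y)"])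
    show "(\<lambda>t. (snd \<phi> (c t), snd (velocity A c t) \<phi>)) ` (I \<inter> c -` fst \<phi>) \<subseteq> slit_domain \<phi>"
      by (auto intro!: slit_coordinates_in_domain charts_at_mem[OF assms]
          velocity_tangent[OF smooth_c] dest: velocity_nonzero)
  qed (intro smooth_on_Pair open_chart_domain velocity_smooth smooth_map_from_euclidean(2)[OF smooth_c]
      smooth_on_frechet_derivative spray_coeff_smooth assms)+
  show "frechet_derivative (spray_coeff A S \<phi>)
     (at (snd \<phi> (c t), snd (velocity A c t) \<phi>)) (0, y) = conn \<phi> t y" if "t \<in> I \<inter> c -` fst \<phi>" for t
    using that assms by (intro conn_eq[symmetric]) (auto simp: charts_at_def)
qed

text \<open>
  \<open>N\<close> is bounded by the sum of the norms of its values on a basis, which is continuous in \<open>t\<close>. This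
  is the linear bound needed for uniqueness of parallel transport.
\<close>

lemma conn_locally_bounded:
  assumes t: "t \<in> I" and \<phi>: "\<phi> \<in> charts_at A (c t)"
  obtains \<delta> K where "\<delta> > 0"
    "\<And>\<tau>. \<bar>\<tau> - t\<bar> < \<delta> \<Longrightarrow> \<tau> \<in> I \<and> \<phi> \<in> charts_at A (c \<tau>)"
    "\<And>\<tau> X. \<bar>\<tau> - t\<bar> < \<delta> \<Longrightarrow> norm (conn \<phi> \<tau> X) \<le> K * norm X"
proof -
  let ?O = "I \<inter> c -` fst \<phi>" and ?k = "\<lambda>\<tau>. \<Sum>i\<in>Basis. norm (conn \<phi> \<tau> i)"
  note A = charts_atD[OF \<phi>]
  have O: "open ?O" "t \<in> ?O" using open_chart_domain[OF A(1)] t A(2) by auto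
  have "continuous_on ?O ?k"
    by (intro continuous_on_sum continuous_on_norm smooth_on_continuous_on[OF conn_smooth[OF A(1)]])
  then have "isCont ?k t" using O by (simp add: continuous_on_eq_continuous_at)
  then have "(?k \<longlongrightarrow> ?k t) (nhds t)"
    unfolding isCont_def by (rule tendsto_at_iff_tendsto_nhds[THEN iffD1])
  then have "\<forall>\<^sub>F \<tau> in nhds t. ?k \<tau> < ?k t + 1" by (rule order_tendstoD) simp
  then have "\<forall>\<^sub>F \<tau> in nhds t. ?k \<tau> < ?k t + 1 \<and> \<tau> \<in> ?O"
    using eventually_nhds_in_open[OF O] by (rule eventually_conj)
  then obtain \<delta> where \<delta>: "\<delta> > 0" "\<And>\<tau>. dist \<tau> t < \<delta> \<Longrightarrow> ?k \<tau> < ?k t + 1 \<and> \<tau> \<in> ?O"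
    unfolding eventually_nhds_metric by blast
  show ?thesis
  proof (rule that[OF \<delta>(1)])
    fix \<tau> assume "\<bar>\<tau> - t\<bar> < \<delta>"
    then have *: "?k \<tau> < ?k t + 1" "\<tau> \<in> ?O" using \<delta>(2)[of \<tau>] by (auto simp: dist_real_def)
    then show 1: "\<tau> \<in> I \<and> \<phi> \<in> charts_at A (c \<tau>)" using A by (auto simp: charts_at_def)
    fix X
    interpret linear "conn \<phi> \<tau>" using 1 by (intro linear_conn) auto
    have "conn \<phi> \<tau> X = (\<Sum>i\<in>Basis. (X \<bullet> i) *\<^sub>R conn \<phi> \<tau> i)"
      using arg_cong[OF euclidean_representation[of X], of "conn \<phi> \<tau>"] by (simp add: sum scale)
    then have "norm (conn \<phi> \<tau> X) \<le> (\<Sum>i\<in>Basis. norm ((X \<bullet> i) *\<^sub>R conn \<phi> \<tau> i))"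
      by (simp only: norm_sum)
    also have "\<dots> \<le> (\<Sum>i\<in>Basis. norm X * norm (conn \<phi> \<tau> i))"
      by (intro sum_mono) (auto intro!: mult_right_mono Basis_le_norm)
    also have "\<dots> = ?k \<tau> * norm X" by (simp add: sum_distrib_left mult.commute)
    also have "\<dots> \<le> (?k t + 1) * norm X" using * by (intro mult_right_mono) auto
    finally show "norm (conn \<phi> \<tau> X) \<le> (?k t + 1) * norm X" .
  qed
qed

text \<open>
  Parallel vector fields along \<open>c\<close>, written as the linear differential equation \<open>X' = - N X\<close> that they
  satisfy in every chart. In this form they can be added, scaled and differentiated directly.
\<close>

definition conn_solution :: "(real \<Rightarrow> ('m, 'e) tvec) \<Rightarrow> bool" where
  "conn_solution X \<longleftrightarrow> (\<forall>t\<in>I. X t \<in> tangent_space A (c t) \<and> (\<forall>\<phi>\<in>charts_at A (c t).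
     ((\<lambda>\<tau>. X \<tau> \<phi>) has_vector_derivative - conn \<phi> t (X t \<phi>)) (at t)))"

lemma parallel_imp_conn_solution:
  assumes "parallel_along A S c I X"
  shows "conn_solution X"
  unfolding conn_solution_def
proof (intro ballI conjI)
  fix t assume t: "t \<in> I"
  show "X t \<in> tangent_space A (c t)"
    using assms t by (simp add: parallel_along_def field_along_def)
  fix \<phi> assume \<phi>: "\<phi> \<in> charts_at A (c t)"
  note A = charts_atD[OF \<phi>]
  have "smooth_on (I \<inter> c -` fst \<phi>) (\<lambda>t. X t \<phi>)"
    using assms A(1) unfolding parallel_along_def field_along_def by blast
  from smooth_onD[OF this, of t] t A(2) have "(\<lambda>t. X t \<phi>) differentiable (at t)"
    by (auto simp: differentiable_def)
  moreover have "nabla_vec A S c X t \<phi> = 0"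
    using assms t by (simp add: parallel_along_def)
  then have "vector_derivative (\<lambda>\<tau>. X \<tau> \<phi>) (at t) = - conn \<phi> t (X t \<phi>)"
    using \<phi> by (simp add: nabla_vec_def eq_neg_iff_add_eq_0)
  ultimately show "((\<lambda>\<tau>. X \<tau> \<phi>) has_vector_derivative - conn \<phi> t (X t \<phi>)) (at t)"
    by (metis vector_derivative_works)
qed

text \<open>
  The geodesic equation and Euler's identity give \<open>c'' = - 2 G(c') = - N(c') c'\<close>.
\<close>

lemma velocity_conn_solution: "conn_solution (\<lambda>t. snd (velocity A c t))"
  unfolding conn_solution_def
proof (intro ballI conjI)
  fix t assume t: "t \<in> I"
  note v = velocity_tangent[OF smooth_c] velocity_nonzero
  show "snd (velocity A c t) \<in> tangent_space A (c t)" by (rule v(1)[OF t])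
  fix \<phi> assume \<phi>: "\<phi> \<in> charts_at A (c t)"
  note A = charts_atD[OF \<phi>]
  let ?\<Psi> = "slit_chart A \<phi>"
  let ?y = "snd (velocity A c t) \<phi>"
  have O: "open (I \<inter> c -` fst \<phi>)" "t \<in> I \<inter> c -` fst \<phi>" using open_chart_domain[OF A(1)] t A(2) by auto
  obtain y' where y': "((\<lambda>\<tau>. snd (velocity A c \<tau>) \<phi>) has_vector_derivative y') (at t)"
    using smooth_onD[OF velocity_smooth[OF A(1)] O(2)]
    by (metis differentiable_def vector_derivative_works)
  have "((\<lambda>\<tau>. (snd \<phi> (c \<tau>), snd (velocity A c \<tau>) \<phi>)) has_vector_derivative (?y, y')) (at t)"
    by (intro has_vector_derivative_Pair y' smooth_curve_velocity(1)[OF smooth_c t \<phi>])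
  moreover have "snd ?\<Psi> \<circ> velocity A c = (\<lambda>\<tau>. (snd \<phi> (c \<tau>), snd (velocity A c \<tau>) \<phi>))"
    by (auto simp: slit_chart_def fun_eq_iff velocity_def)
  ultimately have "vector_derivative (snd ?\<Psi> \<circ> velocity A c) (at t) = (?y, y')"
    by (simp add: vector_derivative_at)
  moreover have \<Psi>: "?\<Psi> \<in> charts_at (slit_atlas A) (velocity A c t)"
    by (subst velocity_pair) (intro slit_chart_at \<phi> v t)
  then have "snd (velocity (slit_atlas A) (velocity A c) t) ?\<Psi> = vector_derivative (snd ?\<Psi> \<circ> velocity A c) (at t)"
    by (simp add: velocity_def[of "slit_atlas A"])
  moreover have "velocity (slit_atlas A) (velocity A c) t = S (velocity A c t)"
    using geodesic_c t by (simp add: geodesic_def)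
  ultimately have "(?y, y') = snd (S (velocity A c t)) ?\<Psi>"
    by simp
  from arg_cong[OF this, of snd]
  have "y' = - (2 *\<^sub>R spray_coeff A S \<phi> (snd \<phi> (c t), ?y))"
    by (simp add: spray_coeff_def slit_chart_inv[OF \<phi> v(1)[OF t] v(2)[OF t]] velocity_pair[symmetric])
  also have "\<dots> = - conn \<phi> t ?y"
    by (simp add: conn_eq[OF t \<phi>] spray_coeff_euler[OF \<phi> v(1)[OF t] v(2)[OF t]])
  finally show "((\<lambda>\<tau>. snd (velocity A c \<tau>) \<phi>) has_vector_derivative - conn \<phi> t ?y) (at t)"
    using y' by simp
qed

lemma conn_solution_add:
  assumes "conn_solution X" "conn_solution Y"
  shows "conn_solution (\<lambda>t. X t + Y t)"
  unfolding conn_solution_def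
proof (intro ballI conjI)
  fix t assume t: "t \<in> I"
  show "X t + Y t \<in> tangent_space A (c t)"
    using assms t by (auto simp: conn_solution_def intro: subspace_add[OF subspace_tangent_space])
  fix \<phi> assume \<phi>: "\<phi> \<in> charts_at A (c t)"
  have "((\<lambda>\<tau>. X \<tau> \<phi> + Y \<tau> \<phi>) has_vector_derivative - conn \<phi> t (X t \<phi>) + - conn \<phi> t (Y t \<phi>)) (at t)"
    using assms t \<phi> unfolding conn_solution_def by (intro has_vector_derivative_add) blast+
  then show "((\<lambda>\<tau>. (X \<tau> + Y \<tau>) \<phi>) has_vector_derivative - conn \<phi> t ((X t + Y t) \<phi>)) (at t)"
    by (simp add: linear_add[OF linear_conn[OF t \<phi>]])
qed

lemma conn_solution_scaleR:
  assumes "conn_solution X"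
  shows "conn_solution (\<lambda>t. r *\<^sub>R X t)"
  unfolding conn_solution_def
proof (intro ballI conjI)
  fix t assume t: "t \<in> I"
  show "r *\<^sub>R X t \<in> tangent_space A (c t)"
    using assms t by (auto simp: conn_solution_def intro: subspace_scale[OF subspace_tangent_space])
  fix \<phi> assume \<phi>: "\<phi> \<in> charts_at A (c t)"
  have "((\<lambda>\<tau>. r *\<^sub>R X \<tau> \<phi>) has_vector_derivative r *\<^sub>R (- conn \<phi> t (X t \<phi>))) (at t)"
    using assms t \<phi> unfolding conn_solution_def
    by (intro bounded_linear.has_vector_derivative[OF bounded_linear_scaleR_right]) blast
  then show "((\<lambda>\<tau>. (r *\<^sub>R X \<tau>) \<phi>) has_vector_derivative - conn \<phi> t ((r *\<^sub>R X t) \<phi>)) (at t)"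
    by (simp add: linear_cmul[OF linear_conn[OF t \<phi>]])
qed

lemma conn_solution_zero: "conn_solution (\<lambda>t. 0)"
  using conn_solution_scaleR[OF velocity_conn_solution, of 0] by simp

lemma conn_solution_sum:
  assumes "\<And>i. i \<in> B \<Longrightarrow> conn_solution (X i)"
  shows "conn_solution (\<lambda>t. \<Sum>i\<in>B. r i *\<^sub>R X i t)"
  using assms
proof (induction B rule: infinite_finite_induct)
  case (insert i B)
  have 1: "conn_solution (\<lambda>t. \<Sum>i\<in>B. r i *\<^sub>R X i t)"
    by (rule insert.IH) (rule insert.prems, rule insertI2)
  have 2: "conn_solution (X i)" by (rule insert.prems) (rule insertI1)
  show ?case
    unfolding sum.insert[OF insert(1,2)] by (rule conn_solution_add[OF conn_solution_scaleR[OF 2] 1])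
qed (simp_all add: conn_solution_zero)

text \<open>
  The zeros of a solution form an open set by local uniqueness and a closed one by continuity; \<open>I\<close> is
  connected.
\<close>

lemma conn_solution_unique:
  assumes X: "conn_solution X" and t: "t \<in> I" "X t = 0" and s: "s \<in> I"
  shows "X s = 0"
proof -
  define U where "U = {t\<in>I. X t = 0}"
  have "open U"
    unfolding open_dist
  proof
    fix t assume "t \<in> U"
    then have t: "t \<in> I" "X t = 0" by (auto simp: U_def)
    obtain \<phi> where \<phi>: "\<phi> \<in> charts_at A (c t)" using charts_at_nonempty by blast
    obtain \<delta> K where \<delta>: "\<delta> > 0" "\<And>\<tau>. \<bar>\<tau> - t\<bar> < \<delta> \<Longrightarrow> \<tau> \<in> I \<and> \<phi> \<in> charts_at A (c \<tau>)"
      and K: "\<And>\<tau> X. \<bar>\<tau> - t\<bar> < \<delta> \<Longrightarrow> norm (conn \<phi> \<tau> X) \<le> K * norm X"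
      using conn_locally_bounded[OF t(1) \<phi>] by blast
    have "\<exists>d>0. \<forall>\<tau>. \<bar>\<tau> - t\<bar> < d \<longrightarrow> X \<tau> \<phi> = 0"
    proof (rule linear_ode_zero_locally[OF \<delta>(1)])
      show "((\<lambda>\<tau>. X \<tau> \<phi>) has_vector_derivative - conn \<phi> \<tau> (X \<tau> \<phi>)) (at \<tau>)" if "\<bar>\<tau> - t\<bar> < \<delta>" for \<tau>
        using \<delta>(2)[OF that] X by (auto simp: conn_solution_def)
    qed (use t K in auto)
    then obtain d where d: "d > 0" "\<And>\<tau>. \<bar>\<tau> - t\<bar> < d \<Longrightarrow> X \<tau> \<phi> = 0" by blast
    have "\<tau> \<in> U" if "dist \<tau> t < min \<delta> d" for \<tau>
    proof -
      have \<tau>: "\<tau> \<in> I" "\<phi> \<in> charts_at A (c \<tau>)" "X \<tau> \<phi> = 0"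
        using \<delta>(2) d(2) that by (auto simp: dist_real_def)
      then have "X \<tau> = 0"
        using X by (intro tangent_space_eqI[OF _ subspace_0[OF subspace_tangent_space] \<tau>(2)])
          (auto simp: conn_solution_def)
      with \<tau> show ?thesis by (simp add: U_def)
    qed
    then show "\<exists>d>0. \<forall>\<tau>. dist \<tau> t < d \<longrightarrow> \<tau> \<in> U"
      using \<delta>(1) d(1) by (intro exI[of _ "min \<delta> d"]) auto
  qed
  moreover have "open (I - U)"
    unfolding open_dist
  proof
    fix t assume "t \<in> I - U"
    then have t: "t \<in> I" "X t \<noteq> 0" by (auto simp: U_def)
    obtain \<phi> where \<phi>: "\<phi> \<in> charts_at A (c t)" using charts_at_nonempty by blast
    have ne: "X t \<phi> \<noteq> 0"
      using X t by (intro component_nonzero[OF \<phi>]) (auto simp: conn_solution_def)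
    have "isCont (\<lambda>\<tau>. X \<tau> \<phi>) t"
      using X t \<phi> by (auto simp: conn_solution_def intro: has_vector_derivative_continuous)
    then have "((\<lambda>\<tau>. X \<tau> \<phi>) \<longlongrightarrow> X t \<phi>) (nhds t)"
      unfolding isCont_def by (rule tendsto_at_iff_tendsto_nhds[THEN iffD1])
    then have "\<forall>\<^sub>F \<tau> in nhds t. X \<tau> \<phi> \<noteq> 0" by (rule tendsto_imp_eventually_ne) fact
    moreover have "\<forall>\<^sub>F \<tau> in nhds t. \<tau> \<in> I" by (rule eventually_nhds_in_open[OF open_I t(1)])
    ultimately have "\<forall>\<^sub>F \<tau> in nhds t. \<tau> \<in> I - U"
      by eventually_elim (auto simp: U_def)
    then show "\<exists>d>0. \<forall>\<tau>. dist \<tau> t < d \<longrightarrow> \<tau> \<in> I - U" by (simp add: eventually_nhds_metric)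
  qed
  moreover have "connected I" using interval_I by (simp add: is_interval_connected)
  moreover have "t \<in> U" "U \<subseteq> I" using t by (auto simp: U_def)
  ultimately have "I - U = {}"
    unfolding connected_def by blast
  with s show ?thesis by (auto simp: U_def)
qed

section \<open>The Leibniz rule\<close>

text \<open>
  This is \<open>\<nabla>(J X) = (\<nabla> J) X\<close> for parallel \<open>X\<close>, in components. The term \<open>- J (N X)\<close> in the
  definition of \<open>\<nabla> J\<close> is what the derivative of \<open>X\<close> contributes to the product rule.
\<close>

lemma nabla_tensor_leibniz:
  assumes J: "tensor11_along A c I\<^sub>0 J" and I\<^sub>0: "open I\<^sub>0" "I\<^sub>0 \<subseteq> I"
    and X: "conn_solution X" and t: "t \<in> I\<^sub>0" and \<phi>: "\<phi> \<in> charts_at A (c t)"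
  shows "((\<lambda>\<tau>. J \<tau> (X \<tau>) \<phi>) has_vector_derivative
    nabla_tensor11 A S c J t (X t) \<phi> - conn \<phi> t (J t (X t) \<phi>)) (at t)"
proof -
  note A = charts_atD[OF \<phi>]
  have tI: "t \<in> I" using t I\<^sub>0 by auto
  \<comment> \<open>the matrix of \<open>J\<close> in the chart, as a function of the components of its argument\<close>
  define J\<phi> where "J\<phi> \<tau> y = J \<tau> (coord_vec A \<phi> (c \<tau>) y) \<phi>" for \<tau> y
  have I\<phi>: "I\<^sub>0 \<inter> c -` fst \<phi> = I\<^sub>0 \<inter> (I \<inter> c -` fst \<phi>)" using I\<^sub>0 by auto
  have open_I\<phi>: "open (I\<^sub>0 \<inter> c -` fst \<phi>)" "t \<in> I\<^sub>0 \<inter> c -` fst \<phi>"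
    unfolding I\<phi> using open_chart_domain[OF A(1)] I\<^sub>0(1) t tI A(2) by auto
  have lin: "J\<phi> \<tau> y = (\<Sum>i\<in>Basis. (y \<bullet> i) *\<^sub>R J\<phi> \<tau> i)" if "\<tau> \<in> I\<^sub>0 \<inter> c -` fst \<phi>" for \<tau> y
  proof -
    have \<tau>: "\<phi> \<in> charts_at A (c \<tau>)" using that by (intro charts_at_mem A) auto
    have "coord_vec A \<phi> (c \<tau>) y = (\<Sum>i\<in>Basis. (y \<bullet> i) *\<^sub>R coord_vec A \<phi> (c \<tau>) i)"
    proof (rule tangent_space_eqI[OF coord_vec_tangent[OF \<tau>] _ \<tau>])
      show "(\<Sum>i\<in>Basis. (y \<bullet> i) *\<^sub>R coord_vec A \<phi> (c \<tau>) i) \<in> tangent_space A (c \<tau>)"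
        by (intro subspace_sum subspace_scale subspace_tangent_space coord_vec_tangent \<tau>)
      show "coord_vec A \<phi> (c \<tau>) y \<phi> = (\<Sum>i\<in>Basis. (y \<bullet> i) *\<^sub>R coord_vec A \<phi> (c \<tau>) i) \<phi>"
        by (simp add: sum_fun_apply coord_vec_self[OF \<tau>] euclidean_representation)
    qed
    moreover have J\<tau>: "linear_endo_on (tangent_space A (c \<tau>)) (J \<tau>)"
      using J that by (simp add: tensor11_along_def)
    ultimately have "J \<tau> (coord_vec A \<phi> (c \<tau>) y) = (\<Sum>i\<in>Basis. (y \<bullet> i) *\<^sub>R J \<tau> (coord_vec A \<phi> (c \<tau>) i))"
      by (simp only: linear_endo_on_sum[OF J\<tau> subspace_tangent_space coord_vec_tangent[OF \<tau>]])
    then show ?thesis by (simp add: J\<phi>_def sum_fun_apply)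
  qed
  define d where "d y = vector_derivative (\<lambda>\<tau>. J\<phi> \<tau> y) (at t)" for y
  have d: "((\<lambda>\<tau>. J\<phi> \<tau> y) has_vector_derivative d y) (at t)" for y
  proof -
    have "smooth_on (I\<^sub>0 \<inter> c -` fst \<phi>) (\<lambda>\<tau>. J\<phi> \<tau> y)"
      using J A(1) unfolding tensor11_along_def J\<phi>_def by blast
    from smooth_onD[OF this open_I\<phi>(2)] show ?thesis
      unfolding d_def by (intro vector_derivative_works[THEN iffD1]) (auto simp: differentiable_def)
  qed
  have d_lin: "d y = (\<Sum>i\<in>Basis. (y \<bullet> i) *\<^sub>R d i)" for y
  proof -
    have "((\<lambda>\<tau>. \<Sum>i\<in>Basis. (y \<bullet> i) *\<^sub>R J\<phi> \<tau> i) has_vector_derivative (\<Sum>i\<in>Basis. (y \<bullet> i) *\<^sub>R d i)) (at t)"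
      by (intro has_vector_derivative_sum bounded_linear.has_vector_derivative[OF bounded_linear_scaleR_right] d)
    then have "((\<lambda>\<tau>. J\<phi> \<tau> y) has_vector_derivative (\<Sum>i\<in>Basis. (y \<bullet> i) *\<^sub>R d i)) (at t)"
      by (rule has_vector_derivative_transform_within_open[OF _ open_I\<phi>]) (rule lin[symmetric])
    from vector_derivative_at[OF this] show ?thesis by (simp add: d_def)
  qed
  let ?N = "conn \<phi> t"
  have dX: "((\<lambda>\<tau>. X \<tau> \<phi>) has_vector_derivative - ?N (X t \<phi>)) (at t)"
    using X tI \<phi> by (auto simp: conn_solution_def)
  have "((\<lambda>\<tau>. \<Sum>i\<in>Basis. (X \<tau> \<phi> \<bullet> i) *\<^sub>R J\<phi> \<tau> i) has_vector_derivative
      (\<Sum>i\<in>Basis. (X t \<phi> \<bullet> i) *\<^sub>R d i + ((- ?N (X t \<phi>)) \<bullet> i) *\<^sub>R J\<phi> t i)) (at t)"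
  proof (rule has_vector_derivative_sum)
    fix i
    show "((\<lambda>\<tau>. (X \<tau> \<phi> \<bullet> i) *\<^sub>R J\<phi> \<tau> i) has_vector_derivative
        (X t \<phi> \<bullet> i) *\<^sub>R d i + ((- ?N (X t \<phi>)) \<bullet> i) *\<^sub>R J\<phi> t i) (at t)"
      by (intro has_vector_derivative_scaleR d
          bounded_linear.has_vector_derivative[OF bounded_linear_inner_left dX, folded has_real_derivative_iff_has_vector_derivative])
  qed
  also have "(\<Sum>i\<in>Basis. (X t \<phi> \<bullet> i) *\<^sub>R d i + ((- ?N (X t \<phi>)) \<bullet> i) *\<^sub>R J\<phi> t i)
      = d (X t \<phi>) + J\<phi> t (- ?N (X t \<phi>))"
    by (simp only: sum.distrib d_lin[of "X t \<phi>"] lin[OF open_I\<phi>(2), of "- ?N (X t \<phi>)"])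
  also have "J\<phi> t (- ?N (X t \<phi>)) = - J\<phi> t (?N (X t \<phi>))"
    using lin[OF open_I\<phi>(2), of "- ?N (X t \<phi>)"] lin[OF open_I\<phi>(2), of "?N (X t \<phi>)"]
    by (simp add: sum_negf)
  also have "d (X t \<phi>) + - J\<phi> t (?N (X t \<phi>)) = nabla_tensor11 A S c J t (X t) \<phi> - ?N (J t (X t) \<phi>)"
  proof -
    have "J\<phi> t (X t \<phi>) = J t (X t) \<phi>"
      using X tI by (simp add: J\<phi>_def coord_vec_component[OF \<phi>] conn_solution_def)
    then show ?thesis
      using \<phi> by (simp add: nabla_tensor11_def Let_def J\<phi>_def[symmetric] d_def[symmetric])
  qed
  finally have *: "((\<lambda>\<tau>. \<Sum>i\<in>Basis. (X \<tau> \<phi> \<bullet> i) *\<^sub>R J\<phi> \<tau> i) has_vector_derivative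
      nabla_tensor11 A S c J t (X t) \<phi> - ?N (J t (X t) \<phi>)) (at t)" .
  show ?thesis
  proof (rule has_vector_derivative_transform_within_open[OF * open_I\<phi>])
    fix \<tau> assume \<tau>: "\<tau> \<in> I\<^sub>0 \<inter> c -` fst \<phi>"
    then have "\<tau> \<in> I" "\<phi> \<in> charts_at A (c \<tau>)" using I\<^sub>0 by (auto intro: charts_at_mem[OF A(1)])
    then have "J\<phi> \<tau> (X \<tau> \<phi>) = J \<tau> (X \<tau>) \<phi>"
      using X by (simp add: J\<phi>_def coord_vec_component conn_solution_def)
    with lin[OF \<tau>, of "X \<tau> \<phi>"] show "(\<Sum>i\<in>Basis. (X \<tau> \<phi> \<bullet> i) *\<^sub>R J\<phi> \<tau> i) = J \<tau> (X \<tau>) \<phi>" by simp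
  qed
qed

end

section \<open>The tensor of the variation field\<close>

text \<open>
  The vector field \<open>Z\<close> and its tensor near \<open>c\<close>. On \<open>D\<close> the map \<open>V\<close> is a diffeomorphism onto
  its range, so \<open>Z\<close> is a smooth vector field on a neighbourhood of each \<open>c(t)\<close> with \<open>t \<in> I\<^sub>0\<close>.
\<close>

locale variation_diffeo = spray_geodesic A S I c
  for A :: "('m::{t2_space, second_countable_topology}, 'e::euclidean_space) chart set"
    and S :: "('m, 'e) tslit_field" and I c +
  fixes I\<^sub>0 :: "real set" and \<epsilon> :: real and V :: "real \<times> (real^'k::finite) \<Rightarrow> 'm"
  assumes open_I\<^sub>0: "open I\<^sub>0" and I\<^sub>0_subset: "I\<^sub>0 \<subseteq> I" and \<epsilon>_pos: "\<epsilon> > 0"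
    and V_0: "\<And>t. t \<in> I \<Longrightarrow> V (t, 0) = c t"
    and diffeo: "diffeo_onto_range euclidean_atlas A (I\<^sub>0 \<times> cube \<epsilon>) V"
begin

abbreviation D where "D \<equiv> I\<^sub>0 \<times> (cube \<epsilon> :: (real^'k) set)"

abbreviation Z where "Z \<equiv> variation_field A V D"

abbreviation chart_domain :: "('m, 'e) chart \<Rightarrow> (real \<times> (real^'k)) set" where
  "chart_domain \<phi> \<equiv> D \<inter> V -` fst \<phi>"

abbreviation chart_range :: "('m, 'e) chart \<Rightarrow> 'e set" where
  "chart_range \<phi> \<equiv> snd \<phi> ` (fst \<phi> \<inter> V ` D)"

abbreviation dV :: "('m, 'e) chart \<Rightarrow> real \<times> (real^'k) \<Rightarrow> real \<times> (real^'k) \<Rightarrow> 'e" where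
  "dV \<phi> z \<equiv> frechet_derivative (\<lambda>z. snd \<phi> (V z)) (at z)"

abbreviation V_inv :: "('m, 'e) chart \<Rightarrow> 'e \<Rightarrow> real \<times> (real^'k)" where
  "V_inv \<phi> \<equiv> \<lambda>x. inv_into D V (chart_inv \<phi> x)"

abbreviation Z_coord :: "('m, 'e) chart \<Rightarrow> 'e \<Rightarrow> 'e" where
  "Z_coord \<phi> \<equiv> \<lambda>x. snd (Z (chart_inv \<phi> x)) \<phi>"

abbreviation dZ :: "('m, 'e) chart \<Rightarrow> 'e \<Rightarrow> 'e \<Rightarrow> 'e" where
  "dZ \<phi> x \<equiv> frechet_derivative (Z_coord \<phi>) (at x)"

lemma inj_V: "inj_on V D"
  and smooth_V: "smooth_map_on euclidean_atlas A D V"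
  and smooth_V_inv: "smooth_map_on A euclidean_atlas (V ` D) (inv_into D V)"
  using diffeo by (auto simp: diffeo_onto_range_def)

lemma chart_domain_smooth:
  assumes "\<phi> \<in> A"
  shows "open (chart_domain \<phi>)" "smooth_on (chart_domain \<phi>) (\<lambda>z. snd \<phi> (V z))"
  using smooth_map_from_euclidean[OF smooth_V assms] by auto

lemma axis_domain:
  assumes "t \<in> I\<^sub>0"
  shows "(t, 0) \<in> D" and "\<phi> \<in> charts_at A (c t) \<Longrightarrow> (t, 0) \<in> chart_domain \<phi>"
  using assms \<epsilon>_pos I\<^sub>0_subset V_0[of t] by (auto simp: cube_def charts_at_def)

lemma chart_range_smooth:
  assumes "\<phi> \<in> A"
  shows "open (chart_range \<phi>)" "smooth_on (chart_range \<phi>) (V_inv \<phi>)"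
proof -
  have "(UNIV, \<lambda>x. x) \<in> euclidean_atlas" by (simp add: euclidean_atlas_def)
  note * = bspec[OF bspec[OF smooth_V_inv[unfolded smooth_map_on_def, THEN conjunct2, THEN conjunct2]
        assms] this]
  from * show "open (chart_range \<phi>)" by simp
  from * show "smooth_on (chart_range \<phi>) (V_inv \<phi>)" by (simp add: o_def)
qed

lemma chart_range_mem: "z \<in> chart_domain \<phi> \<Longrightarrow> snd \<phi> (V z) \<in> chart_range \<phi>"
  by blast

lemma V_inv_V: "\<phi> \<in> A \<Longrightarrow> z \<in> chart_domain \<phi> \<Longrightarrow> V_inv \<phi> (snd \<phi> (V z)) = z"
  using inj_V by (simp add: chart_inv_chart)

lemma dV_works:
  assumes "\<phi> \<in> A" "z \<in> chart_domain \<phi>"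
  shows "((\<lambda>z. snd \<phi> (V z)) has_derivative dV \<phi> z) (at z)" "linear (dV \<phi> z)"
  using smooth_onD[OF chart_domain_smooth(2)[OF assms(1)] assms(2)] has_derivative_linear by blast+

text \<open>
  \<open>V\<close> has a differentiable inverse in coordinates, so its derivative has a left inverse.
\<close>

lemma dV_injective:
  assumes \<phi>: "\<phi> \<in> A" and z: "z \<in> chart_domain \<phi>" and w: "dV \<phi> z w = 0"
  shows "w = 0"
proof -
  let ?G = "frechet_derivative (V_inv \<phi>) (at (snd \<phi> (V z)))"
  have G: "(V_inv \<phi> has_derivative ?G) (at (snd \<phi> (V z)))"
    by (rule smooth_onD[OF chart_range_smooth(2)[OF \<phi>] chart_range_mem[OF z]])
  have "((\<lambda>z. z) has_derivative ?G \<circ> dV \<phi> z) (at z)"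
    by (rule has_derivative_transform_within_open[OF diff_chain_at[OF dV_works(1)[OF \<phi> z] G]
          chart_domain_smooth(1)[OF \<phi>] z]) (use V_inv_V[OF \<phi>] in auto)
  from has_derivative_unique[OF this has_derivative_ident] have "?G (dV \<phi> z w) = w"
    by (metis comp_apply)
  with w show ?thesis using linear_0[OF has_derivative_linear[OF G]] by simp
qed

text \<open>
  The velocity of \<open>V \<circ> \<gamma>\<close> is the derivative of \<open>V\<close> in the direction \<open>\<gamma>'\<close>. Used for the lines
  \<open>\<tau> \<mapsto> (\<tau>, s)\<close>, which give \<open>Z\<close>, and for the coordinate lines \<open>r \<mapsto> (t, axis a r)\<close>.
\<close>

lemma velocity_variation_curve:
  assumes \<gamma>: "(\<gamma> has_vector_derivative w) (at \<tau>)" and \<phi>: "\<phi> \<in> A" and z: "\<gamma> \<tau> \<in> chart_domain \<phi>"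
  shows "((\<lambda>\<tau>. snd \<phi> (V (\<gamma> \<tau>))) has_vector_derivative dV \<phi> (\<gamma> \<tau>) w) (at \<tau>)"
    and "snd (velocity A (\<lambda>\<tau>. V (\<gamma> \<tau>)) \<tau>) \<phi> = dV \<phi> (\<gamma> \<tau>) w"
proof -
  have "((\<lambda>z. snd \<phi> (V z)) \<circ> \<gamma> has_derivative dV \<phi> (\<gamma> \<tau>) \<circ> (\<lambda>r. r *\<^sub>R w)) (at \<tau>)"
    using \<gamma> unfolding has_vector_derivative_def by (intro diff_chain_at dV_works[OF \<phi> z])
  then show 1: "((\<lambda>\<tau>. snd \<phi> (V (\<gamma> \<tau>))) has_vector_derivative dV \<phi> (\<gamma> \<tau>) w) (at \<tau>)"
    by (simp add: has_vector_derivative_def o_def linear_cmul[OF dV_works(2)[OF \<phi> z]])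
  show "snd (velocity A (\<lambda>\<tau>. V (\<gamma> \<tau>)) \<tau>) \<phi> = dV \<phi> (\<gamma> \<tau>) w"
    using vector_derivative_at[OF 1] charts_at_mem[OF \<phi>, of "V (\<gamma> \<tau>)"] z
    by (simp add: velocity_def o_def)
qed

lemma Z_component:
  assumes \<phi>: "\<phi> \<in> A" and z: "z \<in> chart_domain \<phi>"
  shows "snd (Z (V z)) \<phi> = dV \<phi> z (1, 0)"
proof -
  obtain t s where ts: "z = (t, s)" by (cases z)
  have "Z (V z) = velocity A (\<lambda>\<tau>. V (\<tau>, s)) t"
    using inj_V z by (simp add: variation_field_def ts)
  moreover have "((\<lambda>\<tau>. (\<tau>, s)) has_vector_derivative (1, 0)) (at t)"
    by (intro has_vector_derivative_Pair has_vector_derivative_id has_vector_derivative_const)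
  from velocity_variation_curve(2)[OF this \<phi>] z
  have "snd (velocity A (\<lambda>\<tau>. V (\<tau>, s)) t) \<phi> = dV \<phi> z (1, 0)" by (simp add: ts)
  ultimately show ?thesis by simp
qed

lemma Z_coord_smooth:
  assumes \<phi>: "\<phi> \<in> A"
  shows "smooth_on (chart_range \<phi>) (Z_coord \<phi>)"
proof (rule smooth_on_cong[OF chart_range_smooth(1)[OF \<phi>]])
  have *: "V_inv \<phi> x \<in> chart_domain \<phi> \<and> V (V_inv \<phi> x) = chart_inv \<phi> x"
    if "x \<in> chart_range \<phi>" for x
  proof -
    obtain z where "z \<in> chart_domain \<phi>" "x = snd \<phi> (V z)" using \<open>x \<in> _\<close> by auto
    then show ?thesis using V_inv_V[OF \<phi>, of z] by (simp add: chart_inv_chart[OF \<phi>])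
  qed
  show "smooth_on (chart_range \<phi>) (\<lambda>x. dV \<phi> (V_inv \<phi> x) (1, 0))"
  proof (rule smooth_on_compose[OF chart_range_smooth(1)[OF \<phi>] _ chart_range_smooth(2)[OF \<phi>],
        where g = "\<lambda>z. dV \<phi> z (1, 0)"])
    show "V_inv \<phi> ` chart_range \<phi> \<subseteq> chart_domain \<phi>" using * by blast
    show "smooth_on (chart_domain \<phi>) (\<lambda>z. dV \<phi> z (1, 0))"
      by (rule smooth_on_frechet_derivative[OF chart_domain_smooth(2)[OF \<phi>]])
  qed
  show "dV \<phi> (V_inv \<phi> x) (1, 0) = Z_coord \<phi> x" if "x \<in> chart_range \<phi>" for x
    using Z_component[OF \<phi> conjunct1[OF *[OF that]]] unfolding conjunct2[OF *[OF that]] by (rule sym)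
qed

lemma Z_along_c:
  assumes t: "t \<in> I\<^sub>0"
  shows "Z (c t) = velocity A c t"
proof -
  have tI: "t \<in> I" using t I\<^sub>0_subset by auto
  have Z: "Z (c t) = velocity A (\<lambda>\<tau>. V (\<tau>, 0)) t"
    using inj_V axis_domain(1)[OF t] V_0[OF tI, symmetric] by (simp add: variation_field_def)
  have "vector_derivative (snd \<phi> \<circ> (\<lambda>\<tau>. V (\<tau>, 0))) (at t) = vector_derivative (snd \<phi> \<circ> c) (at t)"
    if \<phi>: "\<phi> \<in> charts_at A (c t)" for \<phi>
  proof (rule vector_derivative_at, rule has_vector_derivative_transform_within_open[OF _ open_I tI])
    show "(snd \<phi> \<circ> c has_vector_derivative vector_derivative (snd \<phi> \<circ> c) (at t)) (at t)"
      using smooth_curve_velocity(1)[OF smooth_c tI \<phi>] \<phi> by (simp add: velocity_def o_def)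
  qed (simp add: V_0)
  then show ?thesis
    unfolding Z velocity_def by (auto simp: V_0[OF tI])
qed

text \<open>
  Derivative of the identity \<open>Z \<circ> V = \<partial>\<^sub>t V\<close>, in a chart.
\<close>

lemma dZ_dV:
  assumes \<phi>: "\<phi> \<in> A" and z: "z \<in> chart_domain \<phi>"
  shows "dZ \<phi> (snd \<phi> (V z)) (dV \<phi> z w) = frechet_derivative (\<lambda>z. dV \<phi> z (1, 0)) (at z) w"
proof -
  have "(Z_coord \<phi> has_derivative dZ \<phi> (snd \<phi> (V z))) (at (snd \<phi> (V z)))"
    by (rule smooth_onD[OF Z_coord_smooth[OF \<phi>] chart_range_mem[OF z]])
  from diff_chain_at[OF dV_works(1)[OF \<phi> z] this]
  have "((\<lambda>z. dV \<phi> z (1, 0)) has_derivative dZ \<phi> (snd \<phi> (V z)) \<circ> dV \<phi> z) (at z)"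
    by (rule has_derivative_transform_within_open[OF _ chart_domain_smooth(1)[OF \<phi>] z])
      (use Z_component[OF \<phi>] in \<open>auto simp: chart_inv_chart[OF \<phi>]\<close>)
  from fun_cong[OF frechet_derivative_at[OF this], of w] show ?thesis by simp
qed

text \<open>
  The coordinate formula \<open>A\<^sub>Z v = DZ v + N(Z) v\<close>, valid in any chart at \<open>c(t)\<close>. The change of chart
  removes the dependence on the chart \<open>\<phi>0\<close> that \<^const>\<open>tangent_map\<close> chooses.
\<close>

lemma assoc_tensor_component:
  assumes t: "t \<in> I\<^sub>0" and \<phi>: "\<phi> \<in> charts_at A (c t)" and v: "v \<in> tangent_space A (c t)"
  shows "assoc_tensor A S Z (c t) v \<phi> = dZ \<phi> (snd \<phi> (c t)) (v \<phi>) + conn \<phi> t (v \<phi>)"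
proof -
  define \<phi>0 where "\<phi>0 = (SOME \<phi>. \<phi> \<in> charts_at A (c t))"
  have \<phi>0: "\<phi>0 \<in> charts_at A (c t)" unfolding \<phi>0_def using \<phi> by (rule someI)
  note A = charts_atD[OF \<phi>]
  let ?\<Psi> = "slit_chart A \<phi>" and ?x = "snd \<phi> (c t)"
  have tI: "t \<in> I" using t I\<^sub>0_subset by auto
  have z: "(t, 0) \<in> chart_domain \<phi>" "V (t, 0) = c t"
    using axis_domain(2)[OF t \<phi>] V_0[OF tI] by auto
  have x: "?x \<in> chart_range \<phi>" using chart_range_mem[OF z(1)] z(2) by simp
  have "((\<lambda>x. (x, Z_coord \<phi> x)) has_derivative (\<lambda>y. (y, dZ \<phi> ?x y))) (at ?x)"
    by (intro has_derivative_Pair has_derivative_ident smooth_onD[OF Z_coord_smooth[OF A(1)] x])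
  then have "((snd ?\<Psi> \<circ> Z) \<circ> chart_inv \<phi> has_derivative (\<lambda>y. (y, dZ \<phi> ?x y))) (at ?x)"
  proof (rule has_derivative_transform_within_open[OF _ chart_range_smooth(1)[OF A(1)] x])
    fix x assume "x \<in> chart_range \<phi>"
    then obtain z where z: "z \<in> D" "V z \<in> fst \<phi>" "x = snd \<phi> (V z)" by auto
    have "fst (Z (V z)) = V z" using inj_V z by (simp add: variation_field_def split: prod.split)
    then show "(x, Z_coord \<phi> x) = ((snd ?\<Psi> \<circ> Z) \<circ> chart_inv \<phi>) x"
      using z by (cases "Z (V z)") (simp add: chart_inv_chart[OF A(1)] slit_chart_def)
  qed
  from change_of_chart_has_derivative[OF \<phi>0 \<phi> this]
  have "frechet_derivative (snd ?\<Psi> \<circ> Z \<circ> chart_inv \<phi>0) (at (snd \<phi>0 (c t)))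
      = (\<lambda>y. (y, dZ \<phi> ?x y)) \<circ> dtransition \<phi>0 \<phi> (c t)"
    by (rule frechet_derivative_at[symmetric])
  then have d: "frechet_derivative (snd ?\<Psi> \<circ> Z \<circ> chart_inv \<phi>0) (at (snd \<phi>0 (c t))) (v \<phi>0)
      = (v \<phi>, dZ \<phi> ?x (v \<phi>))"
    by (simp add: tangent_space_transition[OF v \<phi>0 \<phi>])
  have "?\<Psi> \<in> charts_at (slit_atlas A) (velocity A c t)"
    by (subst velocity_pair) (intro slit_chart_at \<phi> velocity_tangent[OF smooth_c tI] velocity_nonzero tI)
  then show ?thesis
    using \<phi> d by (simp add: assoc_tensor_def connection_map_def tangent_map_def Let_def
        \<phi>0_def[symmetric] Z_along_c[OF t])
qed

lemma assoc_tensor_outside: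
  assumes t: "t \<in> I\<^sub>0" and \<phi>: "\<phi> \<notin> charts_at A (c t)"
  shows "assoc_tensor A S Z (c t) v \<phi> = 0"
  using \<phi> by (simp add: assoc_tensor_def connection_map_def tangent_map_def Let_def Z_along_c[OF t])

lemma linear_dZ:
  assumes t: "t \<in> I\<^sub>0" and \<phi>: "\<phi> \<in> charts_at A (c t)"
  shows "linear (dZ \<phi> (snd \<phi> (c t)))"
proof -
  have "V (t, 0) = c t" using t I\<^sub>0_subset V_0 by auto
  with chart_range_mem[OF axis_domain(2)[OF t \<phi>]] have "snd \<phi> (c t) \<in> chart_range \<phi>" by simp
  from smooth_onD[OF Z_coord_smooth[OF charts_atD(1)[OF \<phi>]] this] show ?thesis
    by (rule has_derivative_linear)
qed

lemma assoc_tensor_add: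
  assumes t: "t \<in> I\<^sub>0" and v: "v \<in> tangent_space A (c t)" and w: "w \<in> tangent_space A (c t)"
  shows "assoc_tensor A S Z (c t) (v + w) = assoc_tensor A S Z (c t) v + assoc_tensor A S Z (c t) w"
proof
  fix \<phi>
  have tI: "t \<in> I" using t I\<^sub>0_subset by auto
  show "assoc_tensor A S Z (c t) (v + w) \<phi> = (assoc_tensor A S Z (c t) v + assoc_tensor A S Z (c t) w) \<phi>"
  proof (cases "\<phi> \<in> charts_at A (c t)")
    case True
    then show ?thesis
      using assoc_tensor_component[OF t True] v w subspace_add[OF subspace_tangent_space v w]
      by (simp add: linear_add[OF linear_dZ[OF t True]] linear_add[OF linear_conn[OF tI True]])
  qed (simp add: assoc_tensor_outside[OF t])
qed

lemma assoc_tensor_scaleR: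
  assumes t: "t \<in> I\<^sub>0" and v: "v \<in> tangent_space A (c t)"
  shows "assoc_tensor A S Z (c t) (r *\<^sub>R v) = r *\<^sub>R assoc_tensor A S Z (c t) v"
proof
  fix \<phi>
  have tI: "t \<in> I" using t I\<^sub>0_subset by auto
  show "assoc_tensor A S Z (c t) (r *\<^sub>R v) \<phi> = (r *\<^sub>R assoc_tensor A S Z (c t) v) \<phi>"
  proof (cases "\<phi> \<in> charts_at A (c t)")
    case True
    then show ?thesis
      using assoc_tensor_component[OF t True] v subspace_scale[OF subspace_tangent_space v, of r]
      by (simp add: linear_cmul[OF linear_dZ[OF t True]] linear_cmul[OF linear_conn[OF tI True]] scaleR_add_right)
  qed (simp add: assoc_tensor_outside[OF t])
qed

lemma dV_partial_derivative:
  assumes \<phi>: "\<phi> \<in> A" and z: "(t, s) \<in> chart_domain \<phi>"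
  shows "((\<lambda>\<tau>. dV \<phi> (\<tau>, s) w) has_vector_derivative
      frechet_derivative (\<lambda>z. dV \<phi> z w) (at (t, s)) (1, 0)) (at t)"
proof -
  let ?d = "frechet_derivative (\<lambda>z. dV \<phi> z w) (at (t, s))"
  have d: "((\<lambda>z. dV \<phi> z w) has_derivative ?d) (at (t, s))"
    by (rule smooth_onD[OF smooth_on_frechet_derivative[OF chart_domain_smooth(2)[OF \<phi>]] z])
  have "((\<lambda>\<tau>. (\<tau>, s)) has_derivative (\<lambda>r. r *\<^sub>R (1, 0))) (at t)"
    by (auto intro!: derivative_eq_intros)
  from diff_chain_at[OF this d] show ?thesis
    unfolding has_vector_derivative_def o_def linear_cmul[OF has_derivative_linear[OF d]] .
qed

text \<open>
  \<open>A\<^sub>Z c' = \<partial>\<^sub>t \<partial>\<^sub>t V + N c' = c'' + N c'\<close>, and \<open>c'\<close> is parallel.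
\<close>

lemma assoc_tensor_velocity:
  assumes t: "t \<in> I\<^sub>0"
  shows "assoc_tensor A S Z (c t) (snd (velocity A c t)) = 0"
proof
  fix \<phi>
  have tI: "t \<in> I" using t I\<^sub>0_subset by auto
  show "assoc_tensor A S Z (c t) (snd (velocity A c t)) \<phi> = 0 \<phi>"
  proof (cases "\<phi> \<in> charts_at A (c t)")
    case \<phi>: True
    note A = charts_atD[OF \<phi>] and z = axis_domain(2)[OF t \<phi>]
    let ?y = "snd (velocity A c t) \<phi>"
    have comp: "snd (velocity A c \<tau>) \<phi> = dV \<phi> (\<tau>, 0) (1, 0)"
      if "\<tau> \<in> I\<^sub>0 \<inter> (I \<inter> c -` fst \<phi>)" for \<tau>
      using Z_component[OF A(1) axis_domain(2)[of \<tau> \<phi>]] Z_along_c[of \<tau>] V_0[of \<tau>] charts_at_mem[OF A(1)] that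
      by simp
    have O: "open (I\<^sub>0 \<inter> (I \<inter> c -` fst \<phi>))" "t \<in> I\<^sub>0 \<inter> (I \<inter> c -` fst \<phi>)"
      using open_I\<^sub>0 open_chart_domain[OF A(1)] t tI A(2) by auto
    have "((\<lambda>\<tau>. snd (velocity A c \<tau>) \<phi>) has_vector_derivative
        frechet_derivative (\<lambda>z. dV \<phi> z (1, 0)) (at (t, 0)) (1, 0)) (at t)"
      by (rule has_vector_derivative_transform_within_open[OF dV_partial_derivative[OF A(1) z] O])
        (rule comp[symmetric])
    moreover have "((\<lambda>\<tau>. snd (velocity A c \<tau>) \<phi>) has_vector_derivative - conn \<phi> t ?y) (at t)"
      using velocity_conn_solution tI \<phi> by (simp add: conn_solution_def)
    ultimately have "frechet_derivative (\<lambda>z. dV \<phi> z (1, 0)) (at (t, 0)) (1, 0) = - conn \<phi> t ?y"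
      by (metis vector_derivative_at)
    then have "dZ \<phi> (snd \<phi> (c t)) ?y = - conn \<phi> t ?y"
      using dZ_dV[OF A(1) z, of "(1, 0)"] comp[OF O(2)] V_0[OF tI] by simp
    then show ?thesis
      using assoc_tensor_component[OF t \<phi> velocity_tangent[OF smooth_c tI]] by simp
  qed (simp add: assoc_tensor_outside[OF t])
qed

text \<open>
  The vector field \<open>\<partial>V/\<partial>s\<^sup>a\<close> along \<open>c\<close>.
\<close>

definition variation_vector :: "'k \<Rightarrow> real \<Rightarrow> ('m, 'e) tvec" where
  "variation_vector a t = snd (velocity A (\<lambda>r. V (t, axis a r)) 0)"

lemma variation_vector_component:
  assumes t: "t \<in> I\<^sub>0" and \<phi>: "\<phi> \<in> charts_at A (c t)"
  shows "variation_vector a t \<phi> = dV \<phi> (t, 0) (0, axis a 1)"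
proof -
  have "(\<lambda>r. (t, axis a r)) = (\<lambda>r. (t, r *\<^sub>R axis a (1::real)))"
    by (auto simp: axis_def vec_eq_iff fun_eq_iff)
  moreover have "((\<lambda>r. (t, r *\<^sub>R axis a (1::real))) has_vector_derivative (0, axis a 1)) (at 0)"
    by (auto intro!: derivative_eq_intros simp: has_vector_derivative_def)
  ultimately have "((\<lambda>r. (t, axis a r)) has_vector_derivative (0, axis a (1::real))) (at 0)"
    by (simp only:)
  note velocity_variation_curve(2)[OF this charts_atD(1)[OF \<phi>]]
  moreover have "axis a (0::real) = 0" by (auto simp: axis_def vec_eq_iff)
  ultimately show ?thesis
    unfolding variation_vector_def using axis_domain(2)[OF t \<phi>] by (simp only:)
qed

text \<open>
  \<open>\<nabla>(\<partial>\<^sub>a V) = A\<^sub>Z (\<partial>\<^sub>a V)\<close> in components. This is where the order of the derivatives is exchanged: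
  \<open>\<partial>\<^sub>t \<partial>\<^sub>a V = \<partial>\<^sub>a \<partial>\<^sub>t V\<close>, and the right-hand side is the derivative of \<open>Z\<close> along \<open>\<partial>\<^sub>a V\<close>.
\<close>

lemma variation_vector_derivative:
  assumes t: "t \<in> I\<^sub>0" and \<phi>: "\<phi> \<in> charts_at A (c t)"
    and Y: "variation_vector a t \<in> tangent_space A (c t)"
  shows "((\<lambda>\<tau>. variation_vector a \<tau> \<phi>) has_vector_derivative
    assoc_tensor A S Z (c t) (variation_vector a t) \<phi> - conn \<phi> t (variation_vector a t \<phi>)) (at t)"
proof -
  have tI: "t \<in> I" using t I\<^sub>0_subset by auto
  note A = charts_atD[OF \<phi>] and z = axis_domain(2)[OF t \<phi>]
  have O: "open (I\<^sub>0 \<inter> (I \<inter> c -` fst \<phi>))" "t \<in> I\<^sub>0 \<inter> (I \<inter> c -` fst \<phi>)"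
    using open_I\<^sub>0 open_chart_domain[OF A(1)] t tI A(2) by auto
  have "((\<lambda>\<tau>. variation_vector a \<tau> \<phi>) has_vector_derivative
        frechet_derivative (\<lambda>z. dV \<phi> z (0, axis a 1)) (at (t, 0)) (1, 0)) (at t)"
    by (rule has_vector_derivative_transform_within_open[OF dV_partial_derivative[OF A(1) z] O])
      (auto intro!: variation_vector_component[symmetric] charts_at_mem[OF A(1)])
  also have "frechet_derivative (\<lambda>z. dV \<phi> z (0, axis a 1)) (at (t, 0)) (1, 0)
      = frechet_derivative (\<lambda>z. dV \<phi> z (1, 0)) (at (t, 0)) (0, axis a 1)"
    by (rule symmetric_second_derivative[OF chart_domain_smooth(2,1)[OF A(1)] z])
  also have "\<dots> = dZ \<phi> (snd \<phi> (c t)) (variation_vector a t \<phi>)"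
    using dZ_dV[OF A(1) z, of "(0, axis a 1)"] variation_vector_component[OF t \<phi>, of a] V_0[OF tI] by simp
  also have "\<dots> = assoc_tensor A S Z (c t) (variation_vector a t) \<phi> - conn \<phi> t (variation_vector a t \<phi>)"
    using assoc_tensor_component[OF t \<phi> Y] by simp
  finally show ?thesis .
qed

lemma variation_vectors_independent:
  assumes t: "t \<in> I\<^sub>0" and vanish: "(\<Sum>a\<in>UNIV. r a *\<^sub>R variation_vector a t) = 0"
  shows "r a = 0"
proof -
  obtain \<phi> where \<phi>: "\<phi> \<in> charts_at A (c t)" using charts_at_nonempty by blast
  note A = charts_atD[OF \<phi>] and z = axis_domain(2)[OF t \<phi>]
  interpret linear "dV \<phi> (t, 0)" by (rule dV_works(2)[OF A(1) z])
  have "(\<Sum>a\<in>UNIV. r a *\<^sub>R (0::real, axis a (1::real))) = (0, \<chi> a. r a)"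
    by (simp add: prod_eq_iff fst_sum snd_sum vec_eq_iff axis_def if_distrib[of "\<lambda>x. _ * x"] cong: if_cong)
  then have "dV \<phi> (t, 0) (0, \<chi> a. r a) = (\<Sum>a\<in>UNIV. r a *\<^sub>R variation_vector a t \<phi>)"
    by (simp add: sum[symmetric] scale[symmetric] variation_vector_component[OF t \<phi>])
  also have "\<dots> = 0"
    using fun_cong[OF vanish, of \<phi>] by (simp add: sum_fun_apply)
  finally have "(0 :: real, \<chi> a. r a) = 0" by (rule dV_injective[OF A(1) z])
  then show ?thesis by (simp add: prod_eq_iff vec_eq_iff)
qed

text \<open>
  Both terms of the coordinate formula for \<open>A\<^sub>Z\<close> are smooth functions composed with smooth curves.
\<close>

lemma assoc_tensor_smooth:
  assumes \<phi>: "\<phi> \<in> A"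
  shows "smooth_on (I\<^sub>0 \<inter> c -` fst \<phi>) (\<lambda>t. assoc_tensor A S Z (c t) (coord_vec A \<phi> (c t) y) \<phi>)"
proof -
  have I\<phi>: "I\<^sub>0 \<inter> c -` fst \<phi> \<subseteq> I \<inter> c -` fst \<phi>" "I\<^sub>0 \<inter> c -` fst \<phi> = I\<^sub>0 \<inter> (I \<inter> c -` fst \<phi>)"
    using I\<^sub>0_subset by auto
  have O: "open (I\<^sub>0 \<inter> c -` fst \<phi>)"
    unfolding I\<phi>(2) using open_I\<^sub>0 open_chart_domain[OF \<phi>] by auto
  show ?thesis
  proof (rule smooth_on_cong[OF O])
    show "smooth_on (I\<^sub>0 \<inter> c -` fst \<phi>) (\<lambda>t. dZ \<phi> (snd \<phi> (c t)) y + conn \<phi> t y)"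
    proof (rule smooth_on_add[OF O])
      show "smooth_on (I\<^sub>0 \<inter> c -` fst \<phi>) (\<lambda>t. conn \<phi> t y)"
        by (rule smooth_on_mono_set[OF conn_smooth[OF \<phi>] I\<phi>(1)])
      show "smooth_on (I\<^sub>0 \<inter> c -` fst \<phi>) (\<lambda>t. dZ \<phi> (snd \<phi> (c t)) y)"
      proof (rule smooth_on_compose[OF O, where g = "\<lambda>x. dZ \<phi> x y"])
        show "(\<lambda>t. snd \<phi> (c t)) ` (I\<^sub>0 \<inter> c -` fst \<phi>) \<subseteq> chart_range \<phi>"
        proof clarify
          fix t assume t: "t \<in> I\<^sub>0" "c t \<in> fst \<phi>"
          have "V (t, 0) = c t" using t I\<^sub>0_subset V_0 by auto
          with chart_range_mem[OF axis_domain(2)[OF t(1) charts_at_mem[OF \<phi> t(2)]]]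
          show "snd \<phi> (c t) \<in> chart_range \<phi>" by simp
        qed
        show "smooth_on (I\<^sub>0 \<inter> c -` fst \<phi>) (\<lambda>t. snd \<phi> (c t))"
          by (rule smooth_on_mono_set[OF smooth_map_from_euclidean(2)[OF smooth_c \<phi>] I\<phi>(1)])
        show "smooth_on (chart_range \<phi>) (\<lambda>x. dZ \<phi> x y)"
          by (rule smooth_on_frechet_derivative[OF Z_coord_smooth[OF \<phi>]])
      qed
    qed
    show "dZ \<phi> (snd \<phi> (c t)) y + conn \<phi> t y = assoc_tensor A S Z (c t) (coord_vec A \<phi> (c t) y) \<phi>"
      if "t \<in> I\<^sub>0 \<inter> c -` fst \<phi>" for t
      using that charts_at_mem[OF \<phi>, of "c t"]
      by (simp add: assoc_tensor_component coord_vec_tangent coord_vec_self)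
  qed
qed

end

section \<open>Invertibility and the determinant\<close>

locale variation_jacobi_tensor = variation_diffeo A S I c I\<^sub>0 \<epsilon> V
  for A :: "('m::{t2_space, second_countable_topology}, real^'n) chart set"
    and S :: "('m, real^'n) tslit_field" and I c I\<^sub>0 \<epsilon>
    and V :: "real \<times> (real^'k::finite) \<Rightarrow> 'm" +
  fixes W :: "('m, real^'n) tvec set"
    and e :: "'k \<Rightarrow> real \<Rightarrow> ('m, real^'n) tvec"
    and Wt :: "real \<Rightarrow> ('m, real^'n) tvec set"
    and J :: "real \<Rightarrow> ('m, real^'n) tvec \<Rightarrow> ('m, real^'n) tvec"
  assumes zero_I: "0 \<in> I" and num_params: "CARD('n) = CARD('k) + 1"
    and velocity_notin_W: "snd (velocity A c 0) \<notin> W"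
    and e_basis: "basis_of (\<lambda>a. e a 0) W"
    and e_parallel: "\<And>a. parallel_along A S c I (e a)"
    and Wt: "\<And>t. Wt t = span (range (\<lambda>a. e a t))"
    and J_transversal: "transversal A c I\<^sub>0 Wt J"
    and J_e: "\<And>t a. t \<in> I\<^sub>0 \<Longrightarrow> J t (e a t) = variation_vector a t"
begin

lemma I\<^sub>0_I: "t \<in> I\<^sub>0 \<Longrightarrow> t \<in> I"
  using I\<^sub>0_subset by auto

lemma e_solution: "conn_solution (e a)"
  by (rule parallel_imp_conn_solution[OF e_parallel])

text \<open>
  Adding the velocity as the \<open>None\<close> member turns the \<open>e a\<close> into a moving basis of the whole tangent
  space that consists of parallel fields.
\<close>

definition frame :: "real \<Rightarrow> 'k option \<Rightarrow> ('m, real^'n) tvec" where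
  "frame t = case_option (snd (velocity A c t)) (\<lambda>a. e a t)"

lemma frame_simps [simp]: "frame t None = snd (velocity A c t)" "frame t (Some a) = e a t"
  by (simp_all add: frame_def)

lemma frame_solution: "conn_solution (\<lambda>t. frame t i)"
  using velocity_conn_solution e_solution by (cases i) simp_all

lemma frame_tangent: "t \<in> I \<Longrightarrow> frame t i \<in> tangent_space A (c t)"
  using frame_solution[of i] by (simp add: conn_solution_def)

lemma e_tangent: "t \<in> I \<Longrightarrow> e a t \<in> tangent_space A (c t)"
  using frame_tangent[of t "Some a"] by simp

lemma subspace_Wt: "subspace (Wt t)"
  unfolding Wt by (rule subspace_span)

lemma e_in_Wt: "e a t \<in> Wt t"
  unfolding Wt by (rule span_base) simp

lemma Wt_tangent: "t \<in> I \<Longrightarrow> Wt t \<subseteq> tangent_space A (c t)"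
  unfolding Wt using e_tangent by (intro span_minimal subspace_tangent_space) auto

text \<open>
  A linear combination of parallel fields that vanishes at \<open>t\<close> vanishes at \<open>0\<close>, where \<open>c'(0) \<notin> W\<close> and the
  \<open>e a 0\<close> form a basis of \<open>W\<close>.
\<close>

lemma frame_independent:
  assumes t: "t \<in> I" and r: "(\<Sum>i\<in>UNIV. r i *\<^sub>R frame t i) = 0"
  shows "r i = 0"
proof -
  have "conn_solution (\<lambda>t. \<Sum>i\<in>UNIV. r i *\<^sub>R frame t i)" by (rule conn_solution_sum[OF frame_solution])
  then have "(\<Sum>i\<in>UNIV. r i *\<^sub>R frame 0 i) = 0"
    by (rule conn_solution_unique) (use t r zero_I in auto)
  then have sum0: "r None *\<^sub>R snd (velocity A c 0) + (\<Sum>a\<in>UNIV. r (Some a) *\<^sub>R e a 0) = 0"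
    by (simp add: sum_option_UNIV)
  have e_in_W: "(\<Sum>a\<in>UNIV. r (Some a) *\<^sub>R e a 0) \<in> W"
    by (intro subspace_sum subspace_scale basis_of_subspace[OF e_basis] basis_of_mem[OF e_basis])
  have r0: "r None = 0"
  proof (rule ccontr)
    assume "r None \<noteq> 0"
    then have "snd (velocity A c 0) = (- inverse (r None)) *\<^sub>R (\<Sum>a\<in>UNIV. r (Some a) *\<^sub>R e a 0)"
      using arg_cong[OF sum0, of "\<lambda>v. inverse (r None) *\<^sub>R v"]
      by (simp add: scaleR_add_right eq_neg_iff_add_eq_0)
    then have "snd (velocity A c 0) \<in> W" using subspace_scale[OF basis_of_subspace[OF e_basis] e_in_W, of "- inverse (r None)"] by (simp only:)
    with velocity_notin_W show False by simp
  qed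
  have "(\<Sum>a\<in>UNIV. r (Some a) *\<^sub>R e a 0) = (\<Sum>a\<in>UNIV. 0 *\<^sub>R e a 0)"
    using sum0 r0 by simp
  from basis_of_unique_coeffs[OF e_basis this] r0 show ?thesis by (cases i) auto
qed

lemma card_frame: "CARD('k option) = CARD('n)"
  using num_params by simp

lemma frame_components_independent:
  assumes t: "t \<in> I" and \<phi>: "\<phi> \<in> charts_at A (c t)"
    and r: "(\<Sum>i\<in>UNIV. r i *\<^sub>R frame t i \<phi>) = 0"
  shows "r i = 0"
proof (rule frame_independent[OF t])
  show "(\<Sum>i\<in>UNIV. r i *\<^sub>R frame t i) = 0"
  proof (rule tangent_space_eqI[OF _ subspace_0[OF subspace_tangent_space] \<phi>])
    show "(\<Sum>i\<in>UNIV. r i *\<^sub>R frame t i) \<in> tangent_space A (c t)"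
      by (intro subspace_sum subspace_scale subspace_tangent_space frame_tangent t)
  qed (use r in \<open>simp add: sum_fun_apply\<close>)
qed

lemma frame_basis:
  assumes t: "t \<in> I"
  shows "basis_of (frame t) (tangent_space A (c t))"
proof (rule basis_ofI)
  obtain \<phi> where \<phi>: "\<phi> \<in> charts_at A (c t)" using charts_at_nonempty by blast
  have coord_basis: "basis_of (\<lambda>i. frame t i \<phi>) UNIV"
    by (rule independent_family_basis_of_UNIV) (use card_frame frame_components_independent[OF t \<phi>] in auto)
  show "span (range (frame t)) = tangent_space A (c t)"
  proof
    show "span (range (frame t)) \<subseteq> tangent_space A (c t)"
      using frame_tangent[OF t] by (intro span_minimal subspace_tangent_space) auto
    show "tangent_space A (c t) \<subseteq> span (range (frame t))"
    proof
      fix v assume v: "v \<in> tangent_space A (c t)"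
      define r where "r i = representation (range (\<lambda>i. frame t i \<phi>)) (v \<phi>) (frame t i \<phi>)" for i
      have "v \<phi> = (\<Sum>i\<in>UNIV. r i *\<^sub>R frame t i \<phi>)"
        unfolding r_def by (rule basis_of_expansion[OF coord_basis]) simp
      then have "v = (\<Sum>i\<in>UNIV. r i *\<^sub>R frame t i)"
        by (intro tangent_space_eqI[OF v _ \<phi>] subspace_sum subspace_scale subspace_tangent_space frame_tangent t)
          (simp add: sum_fun_apply)
      also have "\<dots> \<in> span (range (frame t))"
        by (intro span_sum span_scale span_base) auto
      finally show "v \<in> span (range (frame t))" .
    qed
  qed
qed (rule frame_independent[OF t])

lemma e_basis_along:
  assumes t: "t \<in> I"
  shows "basis_of (\<lambda>a. e a t) (Wt t)"
proof (rule basis_ofI)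
  fix r a assume "(\<Sum>a\<in>UNIV. r a *\<^sub>R e a t) = 0"
  then have "(\<Sum>i\<in>UNIV. case_option 0 r i *\<^sub>R frame t i) = 0"
    by (simp add: sum_option_UNIV)
  from frame_independent[OF t this, of "Some a"] show "r a = 0" by simp
qed (simp add: Wt)

lemma J_endo_Wt:
  assumes t: "t \<in> I\<^sub>0"
  shows "linear_endo_on (Wt t) (J t)"
proof -
  have "J t ` tangent_space A (c t) \<subseteq> Wt t" "linear_endo_on (tangent_space A (c t)) (J t)"
    using J_transversal t by (simp_all add: transversal_def tensor11_along_def)
  then show ?thesis
    using Wt_tangent[OF I\<^sub>0_I[OF t]] unfolding linear_endo_on_def by blast
qed

lemma J_e_in_Wt: "t \<in> I\<^sub>0 \<Longrightarrow> J t (e a t) \<in> Wt t"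
  using J_endo_Wt[of t] e_in_Wt[of a t] by (auto simp: linear_endo_on_def)

lemma J_e_tangent: "t \<in> I\<^sub>0 \<Longrightarrow> J t (e a t) \<in> tangent_space A (c t)"
  using J_e_in_Wt Wt_tangent[OF I\<^sub>0_I] by blast

text \<open>
  The vectors \<open>J e\<^sub>a = \<partial>\<^sub>a V\<close> are independent because \<open>V\<close> is an immersion, they lie in \<open>W\<^sub>t\<close> because
  \<open>J\<close> is transversal, and there are as many of them as the dimension of \<open>W\<^sub>t\<close>.
\<close>

lemma J_e_basis:
  assumes t: "t \<in> I\<^sub>0"
  shows "basis_of (\<lambda>a. J t (e a t)) (Wt t)"
  unfolding Wt
proof (rule independent_family_basis_of_span)
  show "J t (e a t) \<in> span (range (\<lambda>a. e a t))" for a using J_e_in_Wt[OF t] by (simp add: Wt)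
  show "r a = 0" if "(\<Sum>a\<in>UNIV. r a *\<^sub>R J t (e a t)) = 0" for r a
    using that variation_vectors_independent[OF t, of r a] by (simp add: J_e[OF t])
qed

lemma J_sum:
  assumes "t \<in> I\<^sub>0"
  shows "J t (\<Sum>a\<in>UNIV. r a *\<^sub>R e a t) = (\<Sum>a\<in>UNIV. r a *\<^sub>R J t (e a t))"
  by (rule linear_endo_on_sum[OF J_endo_Wt[OF assms] subspace_Wt e_in_Wt])

lemma J_bij:
  assumes t: "t \<in> I\<^sub>0"
  shows "bij_betw (J t) (Wt t) (Wt t)"
proof (rule bij_betw_imageI)
  show "inj_on (J t) (Wt t)"
  proof (rule inj_onI)
    fix v w assume v: "v \<in> Wt t" and w: "w \<in> Wt t" and eq: "J t v = J t w"
    note basis = e_basis_along[OF I\<^sub>0_I[OF t]]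
    obtain x where x: "v = (\<Sum>a\<in>UNIV. x a *\<^sub>R e a t)" by (rule basis_of_obtain[OF basis v])
    obtain y where y: "w = (\<Sum>a\<in>UNIV. y a *\<^sub>R e a t)" by (rule basis_of_obtain[OF basis w])
    have "(\<Sum>a\<in>UNIV. x a *\<^sub>R J t (e a t)) = (\<Sum>a\<in>UNIV. y a *\<^sub>R J t (e a t))"
      using eq unfolding x y J_sum[OF t] .
    from basis_of_unique_coeffs[OF J_e_basis[OF t] this] show "v = w" by (simp add: x y)
  qed
  show "J t ` Wt t = Wt t"
  proof
    show "J t ` Wt t \<subseteq> Wt t" using J_endo_Wt[OF t] by (simp add: linear_endo_on_def)
    show "Wt t \<subseteq> J t ` Wt t"
    proof
      fix w assume w: "w \<in> Wt t"
      define y where "y a = representation (range (\<lambda>a. J t (e a t))) w (J t (e a t))" for a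
      have "w = J t (\<Sum>a\<in>UNIV. y a *\<^sub>R e a t)"
        unfolding J_sum[OF t] y_def by (rule basis_of_expansion[OF J_e_basis[OF t] w])
      moreover have "(\<Sum>a\<in>UNIV. y a *\<^sub>R e a t) \<in> Wt t"
        by (intro subspace_sum subspace_scale subspace_Wt e_in_Wt)
      ultimately show "w \<in> J t ` Wt t" by blast
    qed
  qed
qed

abbreviation A_Z :: "real \<Rightarrow> ('m, real^'n) tvec \<Rightarrow> ('m, real^'n) tvec" where
  "A_Z t \<equiv> assoc_tensor A S Z (c t)"

lemma A_Z_sum:
  assumes "t \<in> I\<^sub>0" "\<And>i. i \<in> B \<Longrightarrow> v i \<in> tangent_space A (c t)"
  shows "A_Z t (\<Sum>i\<in>B. x i *\<^sub>R v i) = (\<Sum>i\<in>B. x i *\<^sub>R A_Z t (v i))"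
  by (rule linear_on_sum[OF subspace_tangent_space assoc_tensor_add[OF assms(1)]
        assoc_tensor_scaleR[OF assms(1)] assms(2)])

lemma J_e_derivative:
  assumes t: "t \<in> I\<^sub>0" and \<phi>: "\<phi> \<in> charts_at A (c t)"
  shows "((\<lambda>\<tau>. J \<tau> (e a \<tau>) \<phi>) has_vector_derivative
    A_Z t (J t (e a t)) \<phi> - conn \<phi> t (J t (e a t) \<phi>)) (at t)"
proof -
  have "((\<lambda>\<tau>. variation_vector a \<tau> \<phi>) has_vector_derivative
      A_Z t (J t (e a t)) \<phi> - conn \<phi> t (J t (e a t) \<phi>)) (at t)"
    using variation_vector_derivative[OF t \<phi>] J_e_tangent[OF t, of a] by (simp add: J_e[OF t])
  then show ?thesis
    by (rule has_vector_derivative_transform_within_open[OF _ open_I\<^sub>0 t]) (simp add: J_e)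
qed

definition J_matrix :: "real \<Rightarrow> real^'k^'k" where
  "J_matrix t = matrix_wrt (\<lambda>a. e a t) (J t)"

lemma J_e_expansion:
  assumes t: "t \<in> I\<^sub>0"
  shows "J t (e a t) = (\<Sum>b\<in>UNIV. J_matrix t $ b $ a *\<^sub>R e b t)"
  unfolding J_matrix_def by (rule matrix_wrt_expansion[OF e_basis_along[OF I\<^sub>0_I[OF t]] J_endo_Wt[OF t]])

definition J_matrix_deriv :: "real \<Rightarrow> real^'k^'k" where
  "J_matrix_deriv t = (\<chi> b a. vector_derivative (\<lambda>\<tau>. J_matrix \<tau> $ b $ a) (at t))"

lemma chart_times:
  assumes "t \<in> I\<^sub>0" "\<phi> \<in> charts_at A (c t)"
  shows "open (I\<^sub>0 \<inter> (I \<inter> c -` fst \<phi>))" "t \<in> I\<^sub>0 \<inter> (I \<inter> c -` fst \<phi>)"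
  using assms open_I\<^sub>0 I\<^sub>0_I open_chart_domain[OF charts_atD(1)[OF assms(2)]] charts_atD(2)[OF assms(2)] by auto

text \<open>
  The column \<open>a\<close> of the matrix consists of coefficients of \<open>J e\<^sub>a\<close> in the frame, whose \<open>c'\<close>-coefficient
  is \<open>0\<close>; in a chart, frame and vector are differentiable.
\<close>

lemma J_matrix_has_derivative:
  assumes t: "t \<in> I\<^sub>0"
  shows "((\<lambda>\<tau>. J_matrix \<tau> $ b $ a) has_real_derivative J_matrix_deriv t $ b $ a) (at t)"
proof -
  obtain \<phi> where \<phi>: "\<phi> \<in> charts_at A (c t)" using charts_at_nonempty by blast
  define x where "x i \<tau> = case_option 0 (\<lambda>b. J_matrix \<tau> $ b $ a) i" for i \<tau>
  have "x (Some b) differentiable (at t)"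
  proof (rule coefficients_differentiable[OF card_frame chart_times[OF t \<phi>]])
    show "((\<lambda>\<tau>. frame \<tau> i \<phi>) has_vector_derivative - conn \<phi> t (frame t i \<phi>)) (at t)" for i
      using frame_solution[of i] I\<^sub>0_I[OF t] \<phi> by (simp add: conn_solution_def)
    show "((\<lambda>\<tau>. J \<tau> (e a \<tau>) \<phi>) has_vector_derivative
        A_Z t (J t (e a t)) \<phi> - conn \<phi> t (J t (e a t) \<phi>)) (at t)"
      by (rule J_e_derivative[OF t \<phi>])
    show "J \<tau> (e a \<tau>) \<phi> = (\<Sum>i\<in>UNIV. x i \<tau> *\<^sub>R frame \<tau> i \<phi>)"
      if "\<tau> \<in> I\<^sub>0 \<inter> (I \<inter> c -` fst \<phi>)" for \<tau>
      using that by (simp add: J_e_expansion sum_fun_apply sum_option_UNIV x_def)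
    show "r i = 0" if "\<tau> \<in> I\<^sub>0 \<inter> (I \<inter> c -` fst \<phi>)" "(\<Sum>i\<in>UNIV. r i *\<^sub>R frame \<tau> i \<phi>) = 0" for \<tau> r i
      using frame_components_independent[of \<tau> \<phi> r i] charts_at_mem[OF charts_atD(1)[OF \<phi>], of "c \<tau>"] that by simp
  qed
  moreover have "x (Some b) = (\<lambda>\<tau>. J_matrix \<tau> $ b $ a)" by (simp add: x_def fun_eq_iff)
  ultimately have "(\<lambda>\<tau>. J_matrix \<tau> $ b $ a) differentiable (at t)" by simp
  then show ?thesis
    by (simp add: J_matrix_deriv_def has_real_derivative_iff_has_vector_derivative vector_derivative_works)
qed

text \<open>
  Two expressions for the derivative of \<open>J e\<^sub>a = \<Sum>b. M\<^sub>b\<^sub>a e\<^sub>b\<close>, with \<open>M\<close> the matrix of \<open>J\<close>. As the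
  \<open>e\<^sub>b\<close> are parallel, \<open>\<nabla>(J e\<^sub>a) = \<Sum>b. M'\<^sub>b\<^sub>a e\<^sub>b\<close>; as \<open>J e\<^sub>a\<close> is a variation vector, it is also
  \<open>A\<^sub>Z (J e\<^sub>a)\<close>. The coefficients do not depend on the chart, so the right-hand side is a vector in
  \<open>W\<^sub>t\<close>.
\<close>

lemma assoc_tensor_J_e:
  assumes t: "t \<in> I\<^sub>0"
  shows "A_Z t (J t (e a t)) = (\<Sum>b\<in>UNIV. J_matrix_deriv t $ b $ a *\<^sub>R e b t)"
proof
  fix \<phi>
  show "A_Z t (J t (e a t)) \<phi> = (\<Sum>b\<in>UNIV. J_matrix_deriv t $ b $ a *\<^sub>R e b t) \<phi>"
  proof (cases "\<phi> \<in> charts_at A (c t)")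
    case \<phi>: True
    have e_deriv: "((\<lambda>\<tau>. e b \<tau> \<phi>) has_vector_derivative - conn \<phi> t (e b t \<phi>)) (at t)" for b
      using e_solution[of b] I\<^sub>0_I[OF t] \<phi> by (simp add: conn_solution_def)
    have "((\<lambda>\<tau>. \<Sum>b\<in>UNIV. J_matrix \<tau> $ b $ a *\<^sub>R e b \<tau> \<phi>) has_vector_derivative
        (\<Sum>b\<in>UNIV. J_matrix t $ b $ a *\<^sub>R (- conn \<phi> t (e b t \<phi>)) + J_matrix_deriv t $ b $ a *\<^sub>R e b t \<phi>)) (at t)"
      by (intro has_vector_derivative_sum has_vector_derivative_scaleR J_matrix_has_derivative[OF t] e_deriv)
    then have "((\<lambda>\<tau>. J \<tau> (e a \<tau>) \<phi>) has_vector_derivative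
        (\<Sum>b\<in>UNIV. J_matrix t $ b $ a *\<^sub>R (- conn \<phi> t (e b t \<phi>)) + J_matrix_deriv t $ b $ a *\<^sub>R e b t \<phi>)) (at t)"
      by (rule has_vector_derivative_transform_within_open[OF _ open_I\<^sub>0 t])
        (simp add: J_e_expansion sum_fun_apply)
    from vector_derivative_unique_at[OF this J_e_derivative[OF t \<phi>]]
    have "A_Z t (J t (e a t)) \<phi> - conn \<phi> t (J t (e a t) \<phi>)
        = (\<Sum>b\<in>UNIV. J_matrix_deriv t $ b $ a *\<^sub>R e b t \<phi>) - (\<Sum>b\<in>UNIV. J_matrix t $ b $ a *\<^sub>R conn \<phi> t (e b t \<phi>))"
      by (simp add: sum.distrib sum_negf sum_subtractf)
    moreover have "conn \<phi> t (J t (e a t) \<phi>) = (\<Sum>b\<in>UNIV. J_matrix t $ b $ a *\<^sub>R conn \<phi> t (e b t \<phi>))"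
    proof -
      interpret N: linear "conn \<phi> t" by (rule linear_conn[OF I\<^sub>0_I[OF t] \<phi>])
      show ?thesis by (simp add: J_e_expansion[OF t] sum_fun_apply N.sum N.scale)
    qed
    ultimately show ?thesis by (simp add: sum_fun_apply)
  next
    case False
    have "e b t \<phi> = 0" for b by (rule tangent_space_outside[OF e_tangent[OF I\<^sub>0_I[OF t]] False])
    then show ?thesis
      using assoc_tensor_outside[OF t False] by (simp add: sum_fun_apply)
  qed
qed

text \<open>
  The \<open>J e\<^sub>a\<close> span \<open>W\<^sub>t\<close> and \<open>A\<^sub>Z\<close> maps each of them into \<open>W\<^sub>t\<close>.
\<close>

lemma assoc_tensor_e_in_Wt:
  assumes t: "t \<in> I\<^sub>0"
  shows "A_Z t (e a t) \<in> Wt t"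
proof -
  define y where "y d = representation (range (\<lambda>a. J t (e a t))) (e a t) (J t (e d t))" for d
  have "e a t = (\<Sum>d\<in>UNIV. y d *\<^sub>R J t (e d t))"
    unfolding y_def by (rule basis_of_expansion[OF J_e_basis[OF t] e_in_Wt])
  then have "A_Z t (e a t) = (\<Sum>d\<in>UNIV. y d *\<^sub>R A_Z t (J t (e d t)))"
    using A_Z_sum[OF t, of UNIV "\<lambda>d. J t (e d t)" y] J_e_tangent[OF t] by simp
  also have "\<dots> \<in> Wt t"
    unfolding assoc_tensor_J_e[OF t] by (intro subspace_sum subspace_scale subspace_Wt e_in_Wt)
  finally show ?thesis .
qed

lemma assoc_tensor_in_Wt:
  assumes t: "t \<in> I\<^sub>0" and v: "v \<in> tangent_space A (c t)"
  shows "A_Z t v \<in> Wt t"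
proof -
  obtain r where r: "v = (\<Sum>i\<in>UNIV. r i *\<^sub>R frame t i)"
    by (rule basis_of_obtain[OF frame_basis[OF I\<^sub>0_I[OF t]] v])
  have "A_Z t v = (\<Sum>i\<in>UNIV. r i *\<^sub>R A_Z t (frame t i))"
    unfolding r by (rule A_Z_sum[OF t frame_tangent[OF I\<^sub>0_I[OF t]]])
  also have "\<dots> = (\<Sum>a\<in>UNIV. r (Some a) *\<^sub>R A_Z t (e a t))"
    by (simp add: sum_option_UNIV assoc_tensor_velocity[OF t])
  also have "\<dots> \<in> Wt t" by (intro subspace_sum subspace_scale subspace_Wt assoc_tensor_e_in_Wt[OF t])
  finally show ?thesis .
qed

lemma assoc_tensor_endo:
  assumes t: "t \<in> I\<^sub>0"
  shows "linear_endo_on (tangent_space A (c t)) (A_Z t)" "linear_endo_on (Wt t) (A_Z t)"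
  using assoc_tensor_in_Wt[OF t] Wt_tangent[OF I\<^sub>0_I[OF t]] assoc_tensor_add[OF t] assoc_tensor_scaleR[OF t]
  unfolding linear_endo_on_def by blast+

text \<open>
  Let \<open>B\<close> be the matrix of \<open>A\<^sub>Z\<close> on \<open>W\<^sub>t\<close>. Applying \<open>A\<^sub>Z\<close> to \<open>J e\<^sub>a = \<Sum>d. M\<^sub>d\<^sub>a e\<^sub>d\<close> and comparing with
  the previous expression gives \<open>M' = B M\<close>, and Jacobi's formula applies. The trace of \<open>B\<close> is the trace
  of \<open>A\<^sub>Z\<close> on the tangent space because \<open>A\<^sub>Z c' = 0\<close>.
\<close>

lemma endo_det_J_derivative:
  assumes t: "t \<in> I\<^sub>0"
  shows "((\<lambda>\<tau>. endo_det TYPE('k) (Wt \<tau>) (J \<tau>)) has_real_derivative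
    endo_trace TYPE('n) (tangent_space A (c t)) (A_Z t) * endo_det TYPE('k) (Wt t) (J t)) (at t)"
proof -
  have det: "det (J_matrix \<tau>) = endo_det TYPE('k) (Wt \<tau>) (J \<tau>)" if "\<tau> \<in> I\<^sub>0" for \<tau>
    unfolding J_matrix_def by (rule endo_det_eq[symmetric, OF e_basis_along[OF I\<^sub>0_I[OF that]] J_endo_Wt[OF that]])
  define B where "B = matrix_wrt (\<lambda>a. e a t) (A_Z t)"
  have B: "A_Z t (e a t) = (\<Sum>b\<in>UNIV. B $ b $ a *\<^sub>R e b t)" for a
    unfolding B_def by (rule matrix_wrt_expansion[OF e_basis_along[OF I\<^sub>0_I[OF t]] assoc_tensor_endo(2)[OF t]])
  have "J_matrix_deriv t $ b $ a = (B ** J_matrix t) $ b $ a" for a b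
  proof (rule basis_of_unique_coeffs[OF e_basis_along[OF I\<^sub>0_I[OF t]],
        where x = "\<lambda>b. J_matrix_deriv t $ b $ a" and y = "\<lambda>b. (B ** J_matrix t) $ b $ a"])
    have "(\<Sum>b\<in>UNIV. J_matrix_deriv t $ b $ a *\<^sub>R e b t) = A_Z t (\<Sum>d\<in>UNIV. J_matrix t $ d $ a *\<^sub>R e d t)"
      using assoc_tensor_J_e[OF t, of a] by (simp only: J_e_expansion[OF t])
    also have "\<dots> = (\<Sum>d\<in>UNIV. J_matrix t $ d $ a *\<^sub>R A_Z t (e d t))"
      by (rule A_Z_sum[OF t e_tangent[OF I\<^sub>0_I[OF t]]])
    also have "\<dots> = (\<Sum>b\<in>UNIV. (B ** J_matrix t) $ b $ a *\<^sub>R e b t)"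
      by (simp only: B sum_matrix_mult_scaleR)
    finally show "(\<Sum>b\<in>UNIV. J_matrix_deriv t $ b $ a *\<^sub>R e b t) = (\<Sum>b\<in>UNIV. (B ** J_matrix t) $ b $ a *\<^sub>R e b t)" .
  qed
  then have "((\<lambda>\<tau>. det (J_matrix \<tau>)) has_real_derivative trace B * det (J_matrix t)) (at t)"
    using J_matrix_has_derivative[OF t] by (intro jacobi_formula) simp
  moreover have "endo_trace TYPE('n) (tangent_space A (c t)) (A_Z t) = trace B"
  proof (rule endo_trace_kernel_complement)
    show "basis_of (case_option (snd (velocity A c t)) (\<lambda>a. e a t)) (tangent_space A (c t))"
      using frame_basis[OF I\<^sub>0_I[OF t]] by (simp only: frame_def)
  qed (use assoc_tensor_endo(1)[OF t] num_params assoc_tensor_velocity[OF t] B in auto)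
  ultimately have "((\<lambda>\<tau>. det (J_matrix \<tau>)) has_real_derivative
      endo_trace TYPE('n) (tangent_space A (c t)) (A_Z t) * endo_det TYPE('k) (Wt t) (J t)) (at t)"
    by (simp add: det[OF t])
  then show ?thesis
    by (rule has_field_derivative_transform_within_open[OF _ open_I\<^sub>0 t]) (rule det)
qed

text \<open>
  For \<open>w = \<Sum>a. r\<^sub>a e\<^sub>a(t)\<close> extend \<open>w\<close> to the parallel field with the same coefficients \<open>r\<^sub>a\<close>. Then
  \<open>(\<nabla> J) w = \<nabla>(J X) = \<Sum>a. r\<^sub>a A\<^sub>Z (J e\<^sub>a) = A\<^sub>Z (J w)\<close>.
\<close>

lemma assoc_tensor_J:
  assumes t: "t \<in> I\<^sub>0" and w: "w \<in> Wt t"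
  shows "A_Z t (J t w) = nabla_tensor11 A S c J t w"
proof
  fix \<phi>
  obtain r where r: "w = (\<Sum>a\<in>UNIV. r a *\<^sub>R e a t)"
    by (rule basis_of_obtain[OF e_basis_along[OF I\<^sub>0_I[OF t]] w])
  show "A_Z t (J t w) \<phi> = nabla_tensor11 A S c J t w \<phi>"
  proof (cases "\<phi> \<in> charts_at A (c t)")
    case \<phi>: True
    interpret N: linear "conn \<phi> t" by (rule linear_conn[OF I\<^sub>0_I[OF t] \<phi>])
    define X where "X \<tau> = (\<Sum>a\<in>UNIV. r a *\<^sub>R e a \<tau>)" for \<tau>
    have X: "conn_solution X" unfolding X_def[abs_def] by (rule conn_solution_sum[OF e_solution])
    have J0: "tensor11_along A c I\<^sub>0 J" using J_transversal by (simp add: transversal_def)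
    have "((\<lambda>\<tau>. \<Sum>a\<in>UNIV. r a *\<^sub>R J \<tau> (e a \<tau>) \<phi>) has_vector_derivative
        (\<Sum>a\<in>UNIV. r a *\<^sub>R (A_Z t (J t (e a t)) \<phi> - conn \<phi> t (J t (e a t) \<phi>)))) (at t)"
      by (intro has_vector_derivative_sum J_e_derivative[OF t \<phi>]
          bounded_linear.has_vector_derivative[OF bounded_linear_scaleR_right])
    then have "((\<lambda>\<tau>. J \<tau> (X \<tau>) \<phi>) has_vector_derivative
        (\<Sum>a\<in>UNIV. r a *\<^sub>R (A_Z t (J t (e a t)) \<phi> - conn \<phi> t (J t (e a t) \<phi>)))) (at t)"
      by (rule has_vector_derivative_transform_within_open[OF _ open_I\<^sub>0 t])
        (simp add: X_def J_sum sum_fun_apply)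
    note vector_derivative_unique_at[OF nabla_tensor_leibniz[OF J0 open_I\<^sub>0 I\<^sub>0_subset X t \<phi>] this]
    moreover have "X t = w" by (simp add: X_def r)
    ultimately have "nabla_tensor11 A S c J t w \<phi> - conn \<phi> t (J t w \<phi>)
        = (\<Sum>a\<in>UNIV. r a *\<^sub>R (A_Z t (J t (e a t)) \<phi> - conn \<phi> t (J t (e a t) \<phi>)))"
      by simp
    also have "\<dots> = A_Z t (J t w) \<phi> - conn \<phi> t (J t w \<phi>)"
    proof -
      have "A_Z t (J t w) = (\<Sum>a\<in>UNIV. r a *\<^sub>R A_Z t (J t (e a t)))"
        unfolding r J_sum[OF t] by (rule A_Z_sum[OF t J_e_tangent[OF t]])
      moreover have "conn \<phi> t (J t w \<phi>) = (\<Sum>a\<in>UNIV. r a *\<^sub>R conn \<phi> t (J t (e a t) \<phi>))"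
        by (simp add: r J_sum[OF t] sum_fun_apply N.sum N.scale)
      ultimately show ?thesis by (simp add: sum_fun_apply scaleR_diff_right sum_subtractf)
    qed
    finally show ?thesis by simp
  next
    case False
    then show ?thesis by (simp add: assoc_tensor_outside[OF t] nabla_tensor11_def)
  qed
qed

text \<open>
  Both sides vanish on \<open>c'\<close>, so only the \<open>W\<^sub>t\<close>-part \<open>w\<close> of \<open>v\<close> counts, and \<open>w = J w'\<close> for a unique \<open>w'\<close>
  in \<open>W\<^sub>t\<close>.
\<close>

lemma assoc_tensor_eq_nabla:
  assumes t: "t \<in> I\<^sub>0" and v: "v \<in> tangent_space A (c t)"
  shows "A_Z t v = nabla_tensor11 A S c J t (transversal_inv A c Wt J t v)"
proof -
  obtain r where "v = (\<Sum>i\<in>UNIV. r i *\<^sub>R frame t i)"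
    by (rule basis_of_obtain[OF frame_basis[OF I\<^sub>0_I[OF t]] v])
  then have r: "v = r None *\<^sub>R snd (velocity A c t) + (\<Sum>a\<in>UNIV. r (Some a) *\<^sub>R e a t)"
    by (simp add: sum_option_UNIV)
  define w where "w = (\<Sum>a\<in>UNIV. r (Some a) *\<^sub>R e a t)"
  have w: "w \<in> Wt t" unfolding w_def by (intro subspace_sum subspace_scale subspace_Wt e_in_Wt)
  have "(THE w. w \<in> Wt t \<and> (\<exists>r. v = r *\<^sub>R snd (velocity A c t) + w)) = w"
  proof (rule the_equality)
    show "w \<in> Wt t \<and> (\<exists>r. v = r *\<^sub>R snd (velocity A c t) + w)"
      using w r by (auto simp: w_def)
    fix w' assume "w' \<in> Wt t \<and> (\<exists>r. v = r *\<^sub>R snd (velocity A c t) + w')"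
    then obtain r' where w': "w' \<in> Wt t" "v = r' *\<^sub>R snd (velocity A c t) + w'" by auto
    obtain x where x: "w' = (\<Sum>a\<in>UNIV. x a *\<^sub>R e a t)"
      by (rule basis_of_obtain[OF e_basis_along[OF I\<^sub>0_I[OF t]] w'(1)])
    have "(\<Sum>i\<in>UNIV. r i *\<^sub>R frame t i) = (\<Sum>i\<in>UNIV. case_option r' x i *\<^sub>R frame t i)"
      using r w'(2) x by (simp add: sum_option_UNIV)
    from basis_of_unique_coeffs[OF frame_basis[OF I\<^sub>0_I[OF t]] this, of "Some _"]
    have "r (Some a) = x a" for a by simp
    then show "w' = w" by (simp add: x w_def)
  qed
  then have inv: "transversal_inv A c Wt J t v = inv_into (Wt t) (J t) w"
    by (simp add: transversal_inv_def)
  have w_image: "w \<in> J t ` Wt t" using J_bij[OF t] w by (simp add: bij_betw_def)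
  have "A_Z t v = A_Z t (r None *\<^sub>R snd (velocity A c t)) + A_Z t w"
    unfolding r w_def[symmetric]
    using frame_tangent[OF I\<^sub>0_I[OF t], of None] w Wt_tangent[OF I\<^sub>0_I[OF t]]
    by (intro assoc_tensor_add[OF t] subspace_scale subspace_tangent_space) (auto simp:)
  also have "A_Z t (r None *\<^sub>R snd (velocity A c t)) = 0"
    using frame_tangent[OF I\<^sub>0_I[OF t], of None] by (simp add: assoc_tensor_scaleR[OF t] assoc_tensor_velocity[OF t])
  also have "0 + A_Z t w = A_Z t (J t (inv_into (Wt t) (J t) w))"
    by (simp add: f_inv_into_f[OF w_image])
  also have "\<dots> = nabla_tensor11 A S c J t (inv_into (Wt t) (J t) w)"
    by (rule assoc_tensor_J[OF t inv_into_into[OF w_image]])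
  finally show ?thesis by (simp only: inv)
qed

lemma assoc_tensor_transversal: "transversal A c I\<^sub>0 Wt A_Z"
  unfolding transversal_def tensor11_along_def
  using assoc_tensor_smooth assoc_tensor_velocity assoc_tensor_endo(1) assoc_tensor_in_Wt
  by (auto simp del: split_paired_All)

end

theorem proposition4p7:
  fixes A :: "('m::{t2_space, second_countable_topology}, real^'n) chart set"
    and S :: "('m, real^'n) tslit_field"
    and I I\<^sub>0 :: "real set"
    and \<epsilon> :: real
    and c :: "real \<Rightarrow> 'm"
    and V :: "real \<times> (real^'k) \<Rightarrow> 'm"
    and W :: "('m, real^'n) tvec set"
    and e :: "'k::finite \<Rightarrow> real \<Rightarrow> ('m, real^'n) tvec"
    and Wt :: "real \<Rightarrow> ('m, real^'n) tvec set"
    and J :: "real \<Rightarrow> ('m, real^'n) tvec \<Rightarrow> ('m, real^'n) tvec"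
    and Z :: "'m \<Rightarrow> ('m, real^'n) tbundle"
    and A_Z :: "real \<Rightarrow> ('m, real^'n) tvec \<Rightarrow> ('m, real^'n) tvec"
  assumes manifold: "smooth_manifold A"
    and dim_M: "CARD('n) \<ge> 2"
    and num_params: "CARD('k) = CARD('n) - 1"
    and spray: "spray A S"
    and I: "open I" "is_interval I" "0 \<in> I"
    and c: "geodesic A S I c"
    and V: "geodesic_variation A S I \<epsilon> c V"
    and W: "subspace W" "W \<subseteq> tangent_space A (c 0)" "dim W = CARD('n) - 1"
      "snd (velocity A c 0) \<notin> W"
    and e_basis: "basis_of (\<lambda>a. e a 0) W"
    and e_parallel: "\<And>a. parallel_along A S c I (e a)"
    and Wt: "\<And>t. Wt t = span (range (\<lambda>a. e a t))"
    and J: "tensor11_along A c I J"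
    and J_velocity: "\<And>t. t \<in> I \<Longrightarrow> J t (snd (velocity A c t)) = 0"
    and J_e: "\<And>t a. t \<in> I \<Longrightarrow> J t (e a t) = snd (velocity A (\<lambda>r. V (t, axis a r)) 0)"
    and I\<^sub>0: "open I\<^sub>0" "is_interval I\<^sub>0" "I\<^sub>0 \<subseteq> I"
    and diffeo: "diffeo_onto_range euclidean_atlas A (I\<^sub>0 \<times> cube \<epsilon>) V"
    and J_transversal: "transversal A c I\<^sub>0 Wt J"
    and Z: "Z = variation_field A V (I\<^sub>0 \<times> cube \<epsilon>)"
    and A_Z: "\<And>t. A_Z t = assoc_tensor A S Z (c t)"
  shows "transversal_invertible A c I\<^sub>0 Wt J
    \<and> (\<forall>t\<in>I\<^sub>0. \<forall>v\<in>tangent_space A (c t).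
         A_Z t v = nabla_tensor11 A S c J t (transversal_inv A c Wt J t v))
    \<and> (\<forall>t\<in>I\<^sub>0. ((\<lambda>\<tau>. endo_det TYPE('k) (Wt \<tau>) (J \<tau>)) has_real_derivative
         endo_trace TYPE('n) (tangent_space A (c t)) (A_Z t)
           * endo_det TYPE('k) (Wt t) (J t)) (at t))
    \<and> transversal A c I\<^sub>0 Wt A_Z"
proof -
  interpret var: variation_diffeo A S I c I\<^sub>0 \<epsilon> V
  proof
    show "\<epsilon> > 0" and "\<And>t. t \<in> I \<Longrightarrow> V (t, 0) = c t"
      using V by (simp_all add: geodesic_variation_def)
  qed fact+
  interpret jac: variation_jacobi_tensor A S I c I\<^sub>0 \<epsilon> V W e Wt J
  proof
    show "CARD('n) = CARD('k) + 1" using num_params dim_M by simp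
    show "J t (e a t) = var.variation_vector a t" if "t \<in> I\<^sub>0" for t a
      using J_e[of t a] that I\<^sub>0(3) by (auto simp: var.variation_vector_def)
  qed fact+
  show ?thesis
    unfolding A_Z[abs_def] Z transversal_invertible_def
    using J_transversal jac.J_bij jac.assoc_tensor_eq_nabla jac.endo_det_J_derivative jac.assoc_tensor_transversal
    by blast
qed

end
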